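(* There is a universal constant $c>0$ such that the following holds. Let $m\le n$ be positive integers, let $\Omega\subset\{1,\dots,n\}$ be an arbitrary fixed set with $|\Omega|=m$, let $s\le n$ be a positive integer and $\delta\in(0,1)$. Let $\epsilon=(\epsilon_i)_{i=1}^n$ be a Rademacher vector and let $\Phi=\frac{1}{\sqrt m}R_\Omega H_\epsilon\in\mathbb{R}^{m\times n}$ be the associated partial random circulant matrix. If $$m \ge c\,\delta^{-2}\, s\,(\log s)^2(\log n)^2,$$ then with probability at least $1-n^{-(\log n)(\log s)^2}$ the restricted isometry constant $\delta_s$ of $\Phi$ satisfies $\delta_s\le\delta$.
   Context: A Rademacher vector of length $n$ is a random vector with independent entries satisfying $\mathbb{P}(\epsilon_i=\pm1)=1/2$. For $z,x\in\mathbb{C}^n$ the circular convolution is $(z*x)_j=\sum_{k=1}^n z_{j\ominus k}x_k$, $j=1,\dots,n$, where $j\ominus k=j-k \bmod n$ is cyclic subtraction (indices taken in $\{1,\dots,n\}$). The circulant matrix $H_z\in\mathbb{C}^{n\times n}$ is defined by $H_zx=z*x$. The operator $R_\Omega:\mathbb{C}^n\to\mathbb{C}^m$ restricts a vector to its entries indexed by $\Omega$. Thus $\Phi x=\frac1{\sqrt m}R_\Omega(\epsilon*x)$. A vector $x\in\mathbb{C}^n$ is $s$-sparse if it has at most $s$ nonzero entries. The restricted isometry constant $\delta_s$ of $\Phi\in\mathbb{C}^{m\times n}$ is the smallest number such that $(1-\delta_s)\|x\|_2^2\le\|\Phi x\|_2^2\le(1+\delta_s)\|x\|_2^2$ for all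 $s$-sparse $x\in\mathbb{C}^n$. *)

theory Defs
  imports "HOL-Probability.Probability" "Jordan_Normal_Form.Matrix"
begin

no_notation Finite_Cartesian_Product.vec_nth (infixl \<open>$\<close> 90)
hide_type (open) Finite_Cartesian_Product.vec
hide_const (open) Finite_Cartesian_Product.vec Finite_Cartesian_Product.mat

text \<open>
  Vectors of length \<open>n\<close> are elements of \<^term>\<open>carrier_vec n\<close>, whose library indexing is
  \<open>0, \<dots>, n - 1\<close>.  The function \<open>entry\<close> reads them with the indices \<open>1, \<dots>, n\<close>.
\<close>

definition entry :: "'a vec \<Rightarrow> nat \<Rightarrow> 'a" where
  "entry x j = x $ (j - 1)"

text \<open>Cyclic subtraction: the representative in \<open>{1, \<dots>, n}\<close> of \<open>j - k\<close> modulo \<open>n\<close>.\<close>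

definition cyclic_sub :: "nat \<Rightarrow> nat \<Rightarrow> nat \<Rightarrow> nat" where
  "cyclic_sub n j k = nat ((int j - int k - 1) mod int n) + 1"

definition circular_convolution :: "'a::semiring_0 vec \<Rightarrow> 'a vec \<Rightarrow> 'a vec" where
  "circular_convolution z x =
     (let n = dim_vec z
      in vec n (\<lambda>i. \<Sum>k=1..n. entry z (cyclic_sub n (i + 1) k) * entry x k))"

definition circulant_mat :: "'a vec \<Rightarrow> 'a mat" where
  "circulant_mat z =
     (let n = dim_vec z
      in mat n n (\<lambda>(i, k). entry z (cyclic_sub n (i + 1) (k + 1))))"

text \<open>
  The matrix of the operator that keeps the entries indexed by \<open>\<Omega> \<subseteq> {1, \<dots>, n}\<close>, listed in
  increasing order of the index.
\<close>

definition restriction_mat :: "nat \<Rightarrow> nat set \<Rightarrow> 'a::zero_neq_one mat" where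
  "restriction_mat n \<Omega> =
     mat (card \<Omega>) n (\<lambda>(i, k). if k + 1 = sorted_list_of_set \<Omega> ! i then 1 else 0)"

definition partial_circulant_mat :: "nat set \<Rightarrow> real vec \<Rightarrow> real mat" where
  "partial_circulant_mat \<Omega> z =
     (1 / sqrt (real (card \<Omega>))) \<cdot>\<^sub>m (restriction_mat (dim_vec z) \<Omega> * circulant_mat z)"

definition norm2 :: "complex vec \<Rightarrow> real" where
  "norm2 x = L2_set (\<lambda>j. cmod (entry x j)) {1..dim_vec x}"

definition sparse :: "nat \<Rightarrow> complex vec \<Rightarrow> bool" where
  "sparse s x \<longleftrightarrow> card {j \<in> {1..dim_vec x}. entry x j \<noteq> 0} \<le> s"

definition restricted_isometry_bound :: "complex mat \<Rightarrow> nat \<Rightarrow> real \<Rightarrow> bool" where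
  "restricted_isometry_bound A s d \<longleftrightarrow>
     (\<forall>x \<in> carrier_vec (dim_col A). sparse s x \<longrightarrow>
        (1 - d) * (norm2 x)\<^sup>2 \<le> (norm2 (A *\<^sub>v x))\<^sup>2 \<and>
        (norm2 (A *\<^sub>v x))\<^sup>2 \<le> (1 + d) * (norm2 x)\<^sup>2)"

text \<open>
  The infimum is a minimum for \<open>s > 0\<close> and a matrix with at least one column; see
  \<open>restricted_isometry_constant_least\<close> below.
\<close>

definition restricted_isometry_constant :: "complex mat \<Rightarrow> nat \<Rightarrow> real" where
  "restricted_isometry_constant A s = Inf {d. restricted_isometry_bound A s d}"

text \<open>
  The law of a Rademacher vector.  Using the law, rather than random variables on an arbitrary
  probability space, lets a constant be quantified before (and hence independently of) the
  type of the sample space; \<open>prob_rademacher_vector\<close> below covers arbitrary realisations.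
\<close>

definition rademacher_vector :: "nat \<Rightarrow> real vec pmf" where
  "rademacher_vector n =
     map_pmf (\<lambda>e. vec n (\<lambda>i. e (i + 1))) (Pi_pmf {1..n} 0 (\<lambda>_. pmf_of_set {-1, 1}))"


lemma circulant_mat_mult_vec:
  assumes "z \<in> carrier_vec n" "x \<in> carrier_vec n"
  shows "circulant_mat z *\<^sub>v x = circular_convolution z (x :: 'a::semiring_0 vec)"
proof -
  have *: "(\<Sum>k=1..n. g k) = (\<Sum>k=0..<n. g (Suc k))" for g :: "nat \<Rightarrow> 'a"
    using sum.shift_bounds_cl_Suc_ivl[of g 0 "n - 1"]
    by (cases n) (auto simp: atLeastLessThanSuc_atLeastAtMost)
  show ?thesis
    using assms
    by (intro eq_vecI)
      (auto simp: circulant_mat_def circular_convolution_def Let_def scalar_prod_def entry_def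
        *[unfolded One_nat_def])
qed

lemma restriction_mat_mult_vec:
  fixes x :: "'a::semiring_1 vec"
  assumes "x \<in> carrier_vec n" "\<Omega> \<subseteq> {1..n}"
  shows "restriction_mat n \<Omega> *\<^sub>v x = vec (card \<Omega>) (\<lambda>i. entry x (sorted_list_of_set \<Omega> ! i))"
proof (rule eq_vecI)
  fix i assume "i < dim_vec (vec (card \<Omega>) (\<lambda>i. entry x (sorted_list_of_set \<Omega> ! i)))"
  then have i: "i < card \<Omega>" by simp
  have fin: "finite \<Omega>" using assms(2) finite_subset by blast
  define w where "w = sorted_list_of_set \<Omega> ! i"
  have "w \<in> \<Omega>" using i fin unfolding w_def
    by (metis nth_mem set_sorted_list_of_set length_sorted_list_of_set)
  then have w: "w \<ge> 1" "w \<le> n" using assms(2) by auto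
  have "(restriction_mat n \<Omega> *\<^sub>v x) $ i = (\<Sum>k=0..<n. (if k + 1 = w then 1 else 0) * x $ k)"
    using i assms(1) by (auto simp: restriction_mat_def scalar_prod_def w_def intro!: sum.cong)
  also have "\<dots> = (\<Sum>k=0..<n. if k = w - 1 then x $ k else 0)"
    using w by (intro sum.cong) auto
  also have "\<dots> = entry x w" using w by (auto simp: entry_def)
  finally show "(restriction_mat n \<Omega> *\<^sub>v x) $ i
      = vec (card \<Omega>) (\<lambda>i. entry x (sorted_list_of_set \<Omega> ! i)) $ i"
    using i by (simp add: w_def)
qed (simp add: restriction_mat_def)

lemma norm2_nonneg: "norm2 x \<ge> 0"
  by (simp add: norm2_def)

lemma norm2_sq: "(norm2 x)\<^sup>2 = (\<Sum>j=1..dim_vec x. (cmod (entry x j))\<^sup>2)"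
  by (simp add: norm2_def L2_set_def sum_nonneg)

lemma norm2_mult_mat_vec_bound:
  "\<exists>B. \<forall>x \<in> carrier_vec (dim_col A). (norm2 (A *\<^sub>v x))\<^sup>2 \<le> B * (norm2 x)\<^sup>2"
proof -
  define r :: "nat \<Rightarrow> real" where "r i = (\<Sum>k=0..<dim_col A. cmod (A $$ (i, k)))" for i
  have "(norm2 (A *\<^sub>v x))\<^sup>2 \<le> (\<Sum>j=1..dim_row A. (r (j - 1))\<^sup>2) * (norm2 x)\<^sup>2"
    if x: "x \<in> carrier_vec (dim_col A)" for x
  proof -
    have ent: "cmod (x $ k) \<le> norm2 x" if "k < dim_col A" for k
    proof -
      have "cmod (entry x (k + 1)) \<le> norm2 x" unfolding norm2_def
        by (rule member_le_L2_set) (use that x in auto)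
      then show ?thesis by (simp add: entry_def)
    qed
    have row: "cmod ((A *\<^sub>v x) $ i) \<le> r i * norm2 x" if "i < dim_row A" for i
    proof -
      have "cmod ((A *\<^sub>v x) $ i) = cmod (\<Sum>k=0..<dim_col A. A $$ (i, k) * x $ k)"
        using that x by (simp add: scalar_prod_def)
      also have "\<dots> \<le> (\<Sum>k=0..<dim_col A. cmod (A $$ (i, k)) * cmod (x $ k))"
        using norm_sum[of "\<lambda>k. A $$ (i, k) * x $ k" "{0..<dim_col A}"]
        by (simp only: norm_mult)
      also have "\<dots> \<le> (\<Sum>k=0..<dim_col A. cmod (A $$ (i, k)) * norm2 x)"
        by (intro sum_mono mult_left_mono ent) auto
      finally show ?thesis by (simp add: r_def sum_distrib_right)
    qed
    have "(norm2 (A *\<^sub>v x))\<^sup>2 \<le> (\<Sum>j=1..dim_row A. (r (j - 1) * norm2 x)\<^sup>2)"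
      unfolding norm2_sq dim_mult_mat_vec
      by (intro sum_mono power_mono) (auto simp: entry_def intro!: row)
    then show ?thesis by (simp add: power_mult_distrib sum_distrib_right)
  qed
  then show ?thesis by blast
qed

text \<open>The restricted isometry constant is the smallest admissible number.\<close>

lemma restricted_isometry_constant_least:
  assumes s: "s > 0" and c: "dim_col A > 0"
  shows "restricted_isometry_bound A s (restricted_isometry_constant A s)"
    and "restricted_isometry_bound A s d \<Longrightarrow> restricted_isometry_constant A s \<le> d"
proof -
  define S where "S = {d. restricted_isometry_bound A s d}"
  have up: "e \<in> S" if "d \<in> S" "d \<le> e" for d e
  proof -
    have "(1 - e) * (norm2 x)\<^sup>2 \<le> (1 - d) * (norm2 x)\<^sup>2"
         "(1 + d) * (norm2 x)\<^sup>2 \<le> (1 + e) * (norm2 x)\<^sup>2" for x :: "complex vec"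
      using that(2) by (auto intro!: mult_right_mono)
    with that(1) show ?thesis
      unfolding S_def restricted_isometry_bound_def by (blast intro: order_trans)
  qed
  obtain B where B: "(norm2 (A *\<^sub>v x))\<^sup>2 \<le> B * (norm2 x)\<^sup>2"
    if "x \<in> carrier_vec (dim_col A)" for x
    using norm2_mult_mat_vec_bound[of A] by blast
  have "max 1 B \<in> S"
    unfolding S_def restricted_isometry_bound_def mem_Collect_eq
  proof (intro ballI impI conjI)
    fix x :: "complex vec" assume x: "x \<in> carrier_vec (dim_col A)"
    have "(1 - max 1 B) * (norm2 x)\<^sup>2 \<le> 0" by (intro mult_nonpos_nonneg) auto
    then show "(1 - max 1 B) * (norm2 x)\<^sup>2 \<le> (norm2 (A *\<^sub>v x))\<^sup>2"
      by (rule order_trans) auto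
    have "B * (norm2 x)\<^sup>2 \<le> (1 + max 1 B) * (norm2 x)\<^sup>2"
      by (intro mult_right_mono) auto
    then show "(norm2 (A *\<^sub>v x))\<^sup>2 \<le> (1 + max 1 B) * (norm2 x)\<^sup>2"
      using B[OF x] by linarith
  qed
  then have ne: "S \<noteq> {}" by blast
  have low: "0 \<le> d" if "d \<in> S" for d
  proof -
    define x :: "complex vec" where "x = unit_vec (dim_col A) 0"
    have x: "x \<in> carrier_vec (dim_col A)" by (simp add: x_def)
    have supp: "{j \<in> {1..dim_vec x}. entry x j \<noteq> 0} \<subseteq> {1}"
      using c by (auto simp: x_def entry_def unit_vec_def split: if_splits)
    have sp: "sparse s x" unfolding sparse_def
      using card_mono[OF _ supp] s by simp
    have "cmod (entry x 1) \<le> norm2 x" unfolding norm2_def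
      by (rule member_le_L2_set) (use c in \<open>auto simp: x_def\<close>)
    then have "(norm2 x)\<^sup>2 > 0" using c by (simp add: x_def entry_def)
    moreover have "(1 - d) * (norm2 x)\<^sup>2 \<le> (1 + d) * (norm2 x)\<^sup>2"
      using that x sp unfolding S_def restricted_isometry_bound_def by force
    ultimately show ?thesis by simp
  qed
  then have bdd: "bdd_below S" by (rule bdd_belowI)
  show "restricted_isometry_bound A s d \<Longrightarrow> restricted_isometry_constant A s \<le> d"
    unfolding restricted_isometry_constant_def
    using bdd by (auto simp: S_def intro: cInf_lower)
  have near: "Inf S + e \<in> S" if e: "e > 0" for e
  proof -
    obtain d where "d \<in> S" "d < Inf S + e"
      using cInf_less_iff[OF ne bdd, of "Inf S + e"] e by auto
    then show ?thesis using up by (meson less_imp_le)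
  qed
  have in_S: "d \<in> S \<longleftrightarrow> (\<forall>x \<in> carrier_vec (dim_col A). sparse s x \<longrightarrow>
        (1 - d) * (norm2 x)\<^sup>2 \<le> (norm2 (A *\<^sub>v x))\<^sup>2 \<and>
        (norm2 (A *\<^sub>v x))\<^sup>2 \<le> (1 + d) * (norm2 x)\<^sup>2)" for d
    by (simp add: S_def restricted_isometry_bound_def)
  have "Inf S \<in> S"
    unfolding in_S
  proof (intro ballI impI)
    fix x :: "complex vec" assume x: "x \<in> carrier_vec (dim_col A)" "sparse s x"
    define a b where "a = (norm2 x)\<^sup>2" and "b = (norm2 (A *\<^sub>v x))\<^sup>2"
    have ab: "(1 - (Inf S + e)) * a \<le> b \<and> b \<le> (1 + (Inf S + e)) * a" if "e > 0" for e
      using near[OF that] x unfolding S_def restricted_isometry_bound_def a_def b_def by blast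
    have lim: "((\<lambda>e. (1 - (Inf S + e)) * a) \<longlongrightarrow> (1 - (Inf S + 0)) * a) (at_right 0)"
              "((\<lambda>e. (1 + (Inf S + e)) * a) \<longlongrightarrow> (1 + (Inf S + 0)) * a) (at_right 0)"
      by (intro tendsto_intros)+
    have ev: "eventually (\<lambda>e. e > (0::real)) (at_right 0)"
      by (rule eventually_at_right_less)
    have "(1 - (Inf S + 0)) * a \<le> b"
      by (rule tendsto_upperbound[OF lim(1)]) (use ev ab in \<open>auto elim: eventually_mono\<close>)
    moreover have "b \<le> (1 + (Inf S + 0)) * a"
      by (rule tendsto_lowerbound[OF lim(2)]) (use ev ab in \<open>auto elim: eventually_mono\<close>)
    ultimately show "(1 - Inf S) * (norm2 x)\<^sup>2 \<le> (norm2 (A *\<^sub>v x))\<^sup>2 \<and>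
        (norm2 (A *\<^sub>v x))\<^sup>2 \<le> (1 + Inf S) * (norm2 x)\<^sup>2"
      by (simp add: a_def b_def)
  qed
  then show "restricted_isometry_bound A s (restricted_isometry_constant A s)"
    by (simp add: S_def restricted_isometry_constant_def)
qed

text \<open>
  Every family of independent random signs, on any probability space, has the law
  \<^const>\<open>rademacher_vector\<close>.
\<close>

lemma (in prob_space) prob_rademacher_vector:
  assumes n: "n > 0"
    and ind: "indep_vars (\<lambda>_. borel) X {1..n}"
    and val: "\<And>i \<omega>. i \<in> {1..n} \<Longrightarrow> \<omega> \<in> space M \<Longrightarrow> X i \<omega> \<in> {-1, 1}"
    and half: "\<And>i. i \<in> {1..n} \<Longrightarrow> prob {\<omega> \<in> space M. X i \<omega> = 1} = 1 / 2"
              "\<And>i. i \<in> {1..n} \<Longrightarrow> prob {\<omega> \<in> space M. X i \<omega> = -1} = 1 / 2"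
  shows "prob {\<omega> \<in> space M. vec n (\<lambda>i. X (i + 1) \<omega>) \<in> A}
       = measure_pmf.prob (rademacher_vector n) A"
proof -
  let ?P = "Pi_pmf {1..n} (0::real) (\<lambda>_. pmf_of_set {-1, 1::real})"
  define F where "F = PiE_dflt {1..n} (0::real) (\<lambda>_. {-1, 1::real})"
  define V where "V e = vec n (\<lambda>i. e (i + 1))" for e :: "nat \<Rightarrow> real"
  define G where "G = {e \<in> F. V e \<in> A}"
  define E where "E e = (\<Inter>i\<in>{1..n}. X i -` {e i} \<inter> space M)" for e
  have finF: "finite F" unfolding F_def by (intro finite_PiE_dflt) auto
  then have finG: "finite G" by (simp add: G_def)
  have rv: "random_variable borel (X i)" if "i \<in> {1..n}" for i
    using ind that unfolding indep_vars_def by auto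
  have Emeas: "E e \<in> events" for e
    unfolding E_def using n by (intro sets.finite_INT measurable_sets[OF rv]) auto
  have Eprob: "prob (E e) = (1 / 2) ^ n" if "e \<in> F" for e
  proof -
    have "prob (E e) = (\<Prod>i\<in>{1..n}. prob (X i -` {e i} \<inter> space M))"
      unfolding E_def by (rule indep_varsD[OF ind]) (use n in auto)
    also have "\<dots> = (\<Prod>i\<in>{1..n}. 1 / 2)"
    proof (rule prod.cong[OF refl])
      fix i assume i: "i \<in> {1..n}"
      have "e i = 1 \<or> e i = -1" using that i by (auto simp: F_def PiE_dflt_def)
      moreover have "X i -` {c} \<inter> space M = {\<omega> \<in> space M. X i \<omega> = c}" for c by auto
      ultimately show "prob (X i -` {e i} \<inter> space M) = 1 / 2" using half[OF i] by auto
    qed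
    finally show ?thesis by simp
  qed
  have disj: "disjoint_family_on E G"
  proof (unfold disjoint_family_on_def, intro ballI impI)
    fix e f assume ef: "e \<in> G" "f \<in> G" "e \<noteq> f"
    then obtain i where i: "e i \<noteq> f i" by blast
    then have "i \<in> {1..n}" using ef by (auto simp: G_def F_def PiE_dflt_def)
    then show "E e \<inter> E f = {}" using i by (auto simp: E_def)
  qed
  have "{\<omega> \<in> space M. vec n (\<lambda>i. X (i + 1) \<omega>) \<in> A} = (\<Union>e\<in>G. E e)"
  proof (intro equalityI subsetI)
    fix \<omega> assume w: "\<omega> \<in> {\<omega> \<in> space M. vec n (\<lambda>i. X (i + 1) \<omega>) \<in> A}"
    define e where "e = (\<lambda>i. if i \<in> {1..n} then X i \<omega> else 0)"
    have "e \<in> F" using val w by (auto simp: F_def PiE_dflt_def e_def)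
    moreover have "V e = vec n (\<lambda>i. X (i + 1) \<omega>)" by (auto simp: V_def e_def)
    ultimately have "e \<in> G" using w by (simp add: G_def)
    moreover have "\<omega> \<in> E e" using w n by (auto simp: E_def e_def)
    ultimately show "\<omega> \<in> (\<Union>e\<in>G. E e)" by blast
  next
    fix \<omega> assume "\<omega> \<in> (\<Union>e\<in>G. E e)"
    then obtain e where e: "e \<in> G" "\<omega> \<in> E e" by blast
    have "V e = vec n (\<lambda>i. X (i + 1) \<omega>)" using e(2) by (auto simp: V_def E_def)
    moreover have "\<omega> \<in> space M" using e(2) n by (auto simp: E_def)
    ultimately show "\<omega> \<in> {\<omega> \<in> space M. vec n (\<lambda>i. X (i + 1) \<omega>) \<in> A}"
      using e(1) by (auto simp: G_def)
  qed
  then have "prob {\<omega> \<in> space M. vec n (\<lambda>i. X (i + 1) \<omega>) \<in> A} = (\<Sum>e\<in>G. prob (E e))"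
    using finite_measure_finite_Union[OF finG _ disj] Emeas by auto
  also have "\<dots> = (\<Sum>e\<in>G. (1 / 2) ^ n)"
    by (intro sum.cong) (auto simp: Eprob G_def)
  also have "\<dots> = (\<Sum>e\<in>G. pmf ?P e)"
  proof (intro sum.cong refl)
    fix e assume "e \<in> G"
    then have e: "e \<in> F" by (simp add: G_def)
    have "pmf ?P e = (\<Prod>i\<in>{1..n}. pmf (pmf_of_set {-1, 1::real}) (e i))"
      using e by (intro pmf_Pi') (auto simp: F_def PiE_dflt_def)
    also have "\<dots> = (\<Prod>i\<in>{1..n}. 1 / 2)"
      using e by (intro prod.cong) (auto simp: F_def PiE_dflt_def indicator_def)
    finally show "(1 / 2) ^ n = pmf ?P e" by simp
  qed
  also have "\<dots> = measure_pmf.prob ?P G"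
    by (simp add: measure_measure_pmf_finite finG)
  also have "\<dots> = measure_pmf.prob ?P (V -` A)"
  proof -
    have "set_pmf ?P = F" by (auto simp: set_Pi_pmf F_def PiE_dflt_def)
    then have "G = V -` A \<inter> set_pmf ?P" by (auto simp: G_def)
    then show ?thesis by (metis measure_Int_set_pmf)
  qed
  also have "\<dots> = measure_pmf.prob (rademacher_vector n) A"
    by (simp add: rademacher_vector_def V_def[abs_def])
  finally show ?thesis .
qed

end

theory Submission
  imports Defs
begin

text \<open>
  \<^bold>\<open>Why the theorem is true.\<close>  Fix \<open>\<Omega>\<close> and let \<open>V x\<close> be the matrix with \<open>V x \<epsilon> = \<Phi> x\<close>; convolution
  is commutative, so \<open>V x\<close> is the partial circulant matrix generated by \<open>x\<close>, divided by
  \<open>\<surd>m\<close>.  As \<open>E \<parallel>V x \<epsilon>\<parallel>\<^sup>2 = \<parallel>x\<parallel>\<^sup>2\<close>, the restricted isometry constant is the supremum over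
  the sparse unit vectors \<open>x\<close> of the absolute deviation of \<open>\<parallel>V x \<epsilon>\<parallel>\<^sup>2\<close> from its mean.  Since
  \<open>\<Phi>\<close> is real it suffices to consider real \<open>x\<close>, and since nets
  enter only through the logarithms of their sizes, it suffices to consider vectors whose entries are
  multiples of \<open>n\<^sup>-\<^sup>4\<close>.  So the supremum is over a finite set \<open>T\<close>.

  \<^bold>\<open>The chaos process.\<close>  Let \<open>\<theta>\<epsilon>\<close> be a second, independent sign vector.  Then
  \<open>u = (\<epsilon> + \<theta>\<epsilon>) / 2\<close> and \<open>v = (\<epsilon> - \<theta>\<epsilon>) / 2\<close> have disjoint supports, and
  \<open>\<parallel>V x \<epsilon>\<parallel>\<^sup>2 - \<parallel>V x (\<theta>\<epsilon>)\<parallel>\<^sup>2 = 4 \<langle>V x u, V x v\<rangle>\<close>.  Averaging over \<open>\<theta>\<close> gives the deviation, so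
  this symmetrisation takes the place of a decoupling inequality.  Given \<open>\<theta>\<close>, the signs of \<open>u\<close> and
  of \<open>v\<close> can be resampled independently.  Chaining along nets \<open>p 0 x, p 1 x, \<dots>\<close> of \<open>T\<close> writes
  the bilinear form as a sum of increments, each of which is a sign sum in \<open>u\<close> or in \<open>v\<close>
  with variance at most the squared operator norm of \<open>V (p (r + 1) x) - V (p r x)\<close> times the
  square of \<open>N u\<close> or \<open>N v\<close>, where \<open>N z = max \<parallel>V x z\<parallel>\<close> over \<open>x \<in> T\<close>.  Hoeffding's
  inequality and a union bound over the nets show that, outside a small event,
  \<open>\<bar>\<langle>V x u, V x v\<rangle>\<bar> \<le> \<gamma> (N u + N v)\<close> for all \<open>x\<close>, where \<open>\<gamma>\<close> is the entropy sum of the chain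
  (lemma \<open>sign_mean_bad_le\<close>).  Keeping \<open>N\<close> as a random variable is what makes the bound linear in
  \<open>s\<close>: it is controlled afterwards by the same inequality, because \<open>(N \<epsilon>)\<^sup>2\<close> is at
  most \<open>1\<close> plus the largest deviation (theorem \<open>deviation_tail\<close>).

  \<^bold>\<open>The nets.\<close>  The Fourier transform \<open>F\<close> diagonalises circulant matrices, so the operator norm of
  \<open>V x - V y\<close> is at most \<open>max \<bar>F x f - F y f\<bar> / \<surd>m\<close> (lemma \<open>circ_norm_le\<close>).  Sparse unit vectors
  lie in \<open>\<surd>s\<close> times the \<open>\<ell>\<^sub>1\<close>-ball, and Maurey's argument (lemma \<open>fourier_net\<close>) covers them by
  \<open>(2n)\<^sup>L\<close> balls of radius \<open>O(\<surd>(s ln n / L))\<close> in the maximum of the Fourier coefficients.  With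
  \<open>L\<close> about \<open>4\<^sup>r ln n\<close> at level \<open>r\<close>, every level contributes \<open>O(\<surd>(s/m) ln n)\<close> to \<open>\<gamma>\<close>, and
  after \<open>O(ln s)\<close> levels the whole of \<open>T\<close> is as small as the next net would be.  Hence
  \<open>\<gamma> = O(\<surd>(s/m) ln n ln s)\<close>, which the hypothesis on \<open>m\<close> makes a small multiple of \<open>\<delta>\<close>.  An
  exceptional probability of \<open>exp (- (ln n ln s)\<^sup>2)\<close> costs a further \<open>O(\<surd>(s/m) ln n ln s)\<close>.
\<close>

section \<open>Hoeffding's inequality for product distributions\<close>

text \<open>
  A subgaussian form of Hoeffding's inequality in which \<open>v\<close> only has to dominate the length of
  the vector of half-ranges, and may vanish.
\<close>

lemma Pi_pmf_Hoeffding: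
  fixes X :: "'j \<Rightarrow> 'b \<Rightarrow> real" and b :: "'j \<Rightarrow> real"
  assumes fin: "finite J"
    and bnd: "\<And>j y. j \<in> J \<Longrightarrow> y \<in> set_pmf (p j) \<Longrightarrow> \<bar>X j y\<bar> \<le> b j"
    and v: "(\<Sum>j\<in>J. (b j)\<^sup>2) \<le> v\<^sup>2" and v0: "0 \<le> v" and t0: "0 \<le> \<tau>"
    and mu: "\<mu> = (\<Sum>j\<in>J. measure_pmf.expectation (p j) (X j))"
  shows "measure_pmf.prob (Pi_pmf J d p) {f. \<bar>(\<Sum>j\<in>J. X j (f j)) - \<mu>\<bar> > \<tau> * v}
           \<le> 2 * exp (- \<tau>\<^sup>2 / 2)"
proof (cases "(\<Sum>j\<in>J. (b j)\<^sup>2) = 0")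
  case True
  have b0: "b j = 0" if "j \<in> J" for j
    using True that fin by (simp add: sum_nonneg_eq_0_iff)
  have X0: "X j y = 0" if "j \<in> J" "y \<in> set_pmf (p j)" for j y
    using bnd[OF that] b0[OF that(1)] by simp
  have "\<mu> = 0" unfolding mu
  proof (intro sum.neutral ballI)
    fix j assume "j \<in> J"
    then have "measure_pmf.expectation (p j) (X j) = measure_pmf.expectation (p j) (\<lambda>_. 0)"
      by (intro integral_cong_AE AE_pmfI) (auto simp: X0)
    then show "measure_pmf.expectation (p j) (X j) = 0" by simp
  qed
  have "{f. \<bar>(\<Sum>j\<in>J. X j (f j)) - \<mu>\<bar> > \<tau> * v} \<inter> set_pmf (Pi_pmf J d p) = {}"
  proof -
    have "(\<Sum>j\<in>J. X j (f j)) = 0" if "f \<in> set_pmf (Pi_pmf J d p)" for f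
      using that X0 fin by (auto simp: set_Pi_pmf PiE_dflt_def intro!: sum.neutral)
    then show ?thesis using \<open>\<mu> = 0\<close> mult_nonneg_nonneg[OF t0 v0] by (auto simp: not_less)
  qed
  then have "measure_pmf.prob (Pi_pmf J d p) {f. \<bar>(\<Sum>j\<in>J. X j (f j)) - \<mu>\<bar> > \<tau> * v} = 0"
    by (metis measure_Int_set_pmf measure_empty)
  then show ?thesis by simp
next
  case False
  then have pos: "(\<Sum>j\<in>J. (b j)\<^sup>2) > 0" by (simp add: order_less_le sum_nonneg)
  let ?M = "Pi_pmf J d p"
  have comp: "map_pmf (\<lambda>f. f j) ?M = p j" if "j \<in> J" for j
    using that fin by (simp add: Pi_pmf_component)
  interpret H: Hoeffding_ineq "measure_pmf ?M" J "\<lambda>j f. X j (f j)" "\<lambda>j. - b j" b \<mu>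
  proof unfold_locales
    show "prob_space.indep_vars (measure_pmf ?M) (\<lambda>_. borel) (\<lambda>j f. X j (f j)) J"
      by (rule prob_space.indep_vars_compose2[OF _ indep_vars_Pi_pmf])
        (auto simp: measure_pmf.prob_space_axioms fin)
    show "AE f in measure_pmf ?M. X j (f j) \<in> {- b j..b j}" if "j \<in> J" for j
    proof (rule AE_pmfI)
      fix f assume "f \<in> set_pmf ?M"
      then have "f j \<in> set_pmf (p j)" using fin that by (auto simp: set_Pi_pmf PiE_dflt_def)
      from bnd[OF that this] show "X j (f j) \<in> {- b j..b j}" by auto
    qed
    show "\<mu> \<equiv> \<Sum>j\<in>J. measure_pmf.expectation ?M (\<lambda>f. X j (f j))"
    proof (rule eq_reflection, unfold mu, intro sum.cong refl)
      fix j assume "j \<in> J"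
      then show "measure_pmf.expectation (p j) (X j) = measure_pmf.expectation ?M (\<lambda>f. X j (f j))"
        by (subst comp[symmetric]) simp_all
    qed
  qed (fact fin)
  have four: "(\<Sum>j\<in>J. (b j - - b j)\<^sup>2) = 4 * (\<Sum>j\<in>J. (b j)\<^sup>2)"
    by (simp add: sum_distrib_left power2_eq_square algebra_simps)
  have pos4: "(\<Sum>j\<in>J. (b j - - b j)\<^sup>2) > 0"
    unfolding four using pos by (rule mult_pos_pos[rotated]) simp
  have "measure_pmf.prob ?M {f. \<bar>(\<Sum>j\<in>J. X j (f j)) - \<mu>\<bar> > \<tau> * v}
      \<le> measure_pmf.prob ?M {f \<in> space (measure_pmf ?M). \<bar>(\<Sum>j\<in>J. X j (f j)) - \<mu>\<bar> \<ge> \<tau> * v}"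
    by (intro measure_pmf.finite_measure_mono) auto
  also have "\<dots> \<le> 2 * exp (-2 * (\<tau> * v)\<^sup>2 / (\<Sum>j\<in>J. (b j - - b j)\<^sup>2))"
    using pos4 v0 t0 by (intro H.Hoeffding_ineq_abs_ge) auto
  also have "\<dots> \<le> 2 * exp (- \<tau>\<^sup>2 / 2)"
  proof -
    have "\<tau>\<^sup>2 * (\<Sum>j\<in>J. (b j)\<^sup>2) \<le> \<tau>\<^sup>2 * v\<^sup>2" using v by (intro mult_left_mono) auto
    then show ?thesis unfolding four using pos by (simp add: divide_simps power_mult_distrib)
  qed
  finally show ?thesis .
qed

section \<open>Averages over sign vectors\<close>

text \<open>
  Sign vectors vanish outside the index set, so that they are closed under the pointwise
  product and form a group with neutral element \<open>indicator J\<close>.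
\<close>

definition signs :: "'j set \<Rightarrow> ('j \<Rightarrow> real) set" where
  "signs J = PiE_dflt J 0 (\<lambda>_. {-1, 1})"

definition sign_mean :: "'j set \<Rightarrow> (('j \<Rightarrow> real) \<Rightarrow> real) \<Rightarrow> real" where
  "sign_mean J f = (\<Sum>\<epsilon>\<in>signs J. f \<epsilon>) / real (card (signs J))"

lemma mem_signs_iff: "\<epsilon> \<in> signs J \<longleftrightarrow> (\<forall>j. if j \<in> J then \<epsilon> j = -1 \<or> \<epsilon> j = 1 else \<epsilon> j = 0)"
  by (auto simp: signs_def PiE_dflt_def)

lemma signs_in: "\<epsilon> \<in> signs J \<Longrightarrow> j \<in> J \<Longrightarrow> \<epsilon> j = -1 \<or> \<epsilon> j = 1"
  and signs_out: "\<epsilon> \<in> signs J \<Longrightarrow> j \<notin> J \<Longrightarrow> \<epsilon> j = 0"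
  by (auto simp: mem_signs_iff split: if_splits)

lemma finite_signs: "finite J \<Longrightarrow> finite (signs J)"
  by (auto simp: signs_def)

lemma signs_nonempty: "signs J \<noteq> {}"
  by (auto simp: signs_def)

lemma signs_square: "\<epsilon> \<in> signs J \<Longrightarrow> j \<in> J \<Longrightarrow> \<epsilon> j * \<epsilon> j = 1"
  using signs_in by fastforce

lemma signs_mult: "\<epsilon> \<in> signs J \<Longrightarrow> \<theta> \<in> signs J \<Longrightarrow> (\<lambda>j. \<theta> j * \<epsilon> j) \<in> signs J"
  unfolding mem_signs_iff by (metis mult_1 mult_minus1 mult_zero_left minus_minus)

lemma signs_mult_mult: "\<epsilon> \<in> signs J \<Longrightarrow> \<theta> \<in> signs J \<Longrightarrow> (\<lambda>j. \<theta> j * (\<theta> j * \<epsilon> j)) = \<epsilon>"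
  by (rule ext) (metis mult.assoc mult_1 mult_zero_right signs_out signs_square)

lemma sign_mean_cong: "(\<And>\<epsilon>. \<epsilon> \<in> signs J \<Longrightarrow> f \<epsilon> = g \<epsilon>) \<Longrightarrow> sign_mean J f = sign_mean J g"
  by (simp add: sign_mean_def)

lemma sign_mean_mono:
  "(\<And>\<epsilon>. \<epsilon> \<in> signs J \<Longrightarrow> f \<epsilon> \<le> g \<epsilon>) \<Longrightarrow> sign_mean J f \<le> sign_mean J g"
  by (simp add: sign_mean_def divide_right_mono sum_mono)

lemma sign_mean_const: "finite J \<Longrightarrow> sign_mean J (\<lambda>_. c) = c"
  using signs_nonempty[of J] finite_signs[of J] by (simp add: sign_mean_def)

lemma sign_mean_add: "sign_mean J (\<lambda>\<epsilon>. f \<epsilon> + g \<epsilon>) = sign_mean J f + sign_mean J g"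
  by (simp add: sign_mean_def sum.distrib add_divide_distrib)

lemma sign_mean_diff: "sign_mean J (\<lambda>\<epsilon>. f \<epsilon> - g \<epsilon>) = sign_mean J f - sign_mean J g"
  by (simp add: sign_mean_def sum_subtractf diff_divide_distrib)

lemma sign_mean_cmult: "sign_mean J (\<lambda>\<epsilon>. c * f \<epsilon>) = c * sign_mean J f"
  by (simp add: sign_mean_def sum_distrib_left)

lemma sign_mean_sum: "sign_mean J (\<lambda>\<epsilon>. \<Sum>k\<in>K. f k \<epsilon>) = (\<Sum>k\<in>K. sign_mean J (f k))"
  by (simp add: sign_mean_def sum_divide_distrib sum.swap[of _ K])

lemma sign_mean_swap:
  "sign_mean J (\<lambda>\<epsilon>. sign_mean K (\<lambda>\<theta>. f \<epsilon> \<theta>)) = sign_mean K (\<lambda>\<theta>. sign_mean J (\<lambda>\<epsilon>. f \<epsilon> \<theta>))"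
  by (simp add: sign_mean_def sum_divide_distrib[symmetric] sum.swap[of _ "signs K"] mult.commute)

lemma abs_sign_mean_le: "\<bar>sign_mean J f\<bar> \<le> sign_mean J (\<lambda>\<epsilon>. \<bar>f \<epsilon>\<bar>)"
  by (simp add: sign_mean_def divide_right_mono)

lemma sign_mean_nonneg: "(\<And>\<epsilon>. \<epsilon> \<in> signs J \<Longrightarrow> 0 \<le> f \<epsilon>) \<Longrightarrow> 0 \<le> sign_mean J f"
  by (simp add: sign_mean_def sum_nonneg)

lemma sign_mean_square_le:
  assumes "finite J"
  shows "(sign_mean J f)\<^sup>2 \<le> sign_mean J (\<lambda>\<epsilon>. (f \<epsilon>)\<^sup>2)"
proof -
  let ?m = "sign_mean J f"
  have "0 \<le> sign_mean J (\<lambda>\<epsilon>. (f \<epsilon> - ?m)\<^sup>2)" by (rule sign_mean_nonneg) simp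
  also have "\<dots> = sign_mean J (\<lambda>\<epsilon>. (f \<epsilon>)\<^sup>2 - (2 * ?m) * f \<epsilon> + ?m\<^sup>2)"
    by (intro sign_mean_cong) (simp add: power2_eq_square algebra_simps)
  also have "\<dots> = sign_mean J (\<lambda>\<epsilon>. (f \<epsilon>)\<^sup>2) - (2 * ?m) * ?m + ?m\<^sup>2"
    by (simp only: sign_mean_add sign_mean_diff sign_mean_cmult sign_mean_const[OF assms])
  finally show ?thesis by (simp add: power2_eq_square)
qed

text \<open>Multiplication by a fixed sign vector permutes the sign vectors.\<close>

lemma sign_mean_shift:
  assumes "\<theta> \<in> signs J"
  shows "sign_mean J (\<lambda>\<epsilon>. f (\<lambda>j. \<theta> j * \<epsilon> j)) = sign_mean J f"
proof -
  have "(\<Sum>\<epsilon>\<in>signs J. f (\<lambda>j. \<theta> j * \<epsilon> j)) = (\<Sum>\<epsilon>\<in>signs J. f \<epsilon>)"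
    by (rule sum.reindex_bij_witness[where i = "\<lambda>\<epsilon> j. \<theta> j * \<epsilon> j" and j = "\<lambda>\<epsilon> j. \<theta> j * \<epsilon> j"])
      (auto simp: signs_mult signs_mult_mult assms)
  then show ?thesis by (simp add: sign_mean_def)
qed

lemma sign_mean_shift':
  assumes "\<epsilon> \<in> signs J"
  shows "sign_mean J (\<lambda>\<theta>. f (\<lambda>j. \<theta> j * \<epsilon> j)) = sign_mean J f"
  using sign_mean_shift[OF assms, of f] by (simp add: mult.commute)

lemma sign_mean_eq_expectation:
  assumes "finite J"
  shows "sign_mean J f = measure_pmf.expectation (Pi_pmf J 0 (\<lambda>_. pmf_of_set {-1, 1})) f"
proof -
  have "Pi_pmf J 0 (\<lambda>_. pmf_of_set {-1, 1 :: real}) = pmf_of_set (signs J)"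
    using assms by (simp add: Pi_pmf_of_set signs_def)
  then show ?thesis
    using assms by (simp add: sign_mean_def integral_pmf_of_set finite_signs signs_nonempty)
qed

lemma sign_mean_of_bool_eq_prob:
  assumes "finite J"
  shows "sign_mean J (\<lambda>\<epsilon>. of_bool (P \<epsilon>))
    = measure_pmf.prob (Pi_pmf J 0 (\<lambda>_. pmf_of_set {-1, 1})) {\<epsilon>. P \<epsilon>}"
proof -
  have "sign_mean J (\<lambda>\<epsilon>. of_bool (P \<epsilon>))
      = measure_pmf.expectation (Pi_pmf J 0 (\<lambda>_. pmf_of_set {-1, 1})) (indicator {\<epsilon>. P \<epsilon>})"
    unfolding sign_mean_eq_expectation[OF assms]
    by (intro Bochner_Integration.integral_cong) (auto simp: indicator_def)
  then show ?thesis by simp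
qed

lemma sign_mean_Hoeffding:
  assumes "finite J" "(\<Sum>j\<in>J. (a j)\<^sup>2) \<le> v\<^sup>2" "0 \<le> v" "0 \<le> \<tau>"
  shows "sign_mean J (\<lambda>\<sigma>. of_bool (\<bar>\<Sum>j\<in>J. \<sigma> j * a j\<bar> > \<tau> * v)) \<le> 2 * exp (- \<tau>\<^sup>2 / 2)"
proof -
  have "measure_pmf.prob (Pi_pmf J 0 (\<lambda>_. pmf_of_set {-1, 1}))
      {f. \<bar>(\<Sum>j\<in>J. f j * a j) - 0\<bar> > \<tau> * v} \<le> 2 * exp (- \<tau>\<^sup>2 / 2)"
    by (rule Pi_pmf_Hoeffding[where b = "\<lambda>j. \<bar>a j\<bar>"])
      (use assms in \<open>auto simp: integral_pmf_of_set\<close>)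
  then show ?thesis by (simp add: sign_mean_of_bool_eq_prob assms(1))
qed

lemma sign_mean_product:
  assumes "finite J" "j \<in> J" "k \<in> J"
  shows "sign_mean J (\<lambda>\<epsilon>. \<epsilon> j * \<epsilon> k) = of_bool (j = k)"
proof (cases "j = k")
  case True
  have "sign_mean J (\<lambda>\<epsilon>. \<epsilon> j * \<epsilon> k) = sign_mean J (\<lambda>_. 1)"
    using True assms by (intro sign_mean_cong) (simp add: signs_square)
  then show ?thesis using True assms by (simp add: sign_mean_const)
next
  case False
  \<comment> \<open>Flipping the sign of coordinate \<open>j\<close> alone negates the product.\<close>
  define \<theta> where "\<theta> i = (if i \<in> J then if i = j then -1 else 1 else 0 :: real)" for i
  have "\<theta> \<in> signs J" by (auto simp: mem_signs_iff \<theta>_def)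
  then have "sign_mean J (\<lambda>\<epsilon>. \<epsilon> j * \<epsilon> k) = sign_mean J (\<lambda>\<epsilon>. (\<theta> j * \<epsilon> j) * (\<theta> k * \<epsilon> k))"
    by (rule sign_mean_shift[where f = "\<lambda>\<epsilon>. \<epsilon> j * \<epsilon> k", symmetric])
  also have "\<dots> = - sign_mean J (\<lambda>\<epsilon>. \<epsilon> j * \<epsilon> k)"
    using False assms by (simp add: \<theta>_def sign_mean_cmult[where c = "-1", simplified])
  finally show ?thesis using False by simp
qed

section \<open>Suprema of sign chaos processes\<close>

lemma sign_mean_of_bool_ex_le:
  assumes "finite K"
  shows "sign_mean J (\<lambda>\<epsilon>. of_bool (\<exists>k\<in>K. P k \<epsilon>)) \<le> (\<Sum>k\<in>K. sign_mean J (\<lambda>\<epsilon>. of_bool (P k \<epsilon>)))"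
proof -
  have "of_bool (\<exists>k\<in>K. P k \<epsilon>) \<le> (\<Sum>k\<in>K. of_bool (P k \<epsilon>) :: real)" for \<epsilon>
  proof (cases "\<exists>k\<in>K. P k \<epsilon>")
    case True
    then obtain k where "k \<in> K" "P k \<epsilon>" by blast
    then have "of_bool (P k \<epsilon>) \<le> (\<Sum>k\<in>K. of_bool (P k \<epsilon>) :: real)"
      using assms by (intro member_le_sum) auto
    then show ?thesis using \<open>P k \<epsilon>\<close> True by simp
  qed (simp add: sum_nonneg)
  then show ?thesis unfolding sign_mean_sum[symmetric] by (intro sign_mean_mono)
qed

text \<open>
  A sign vector \<open>\<theta>\<close> splits \<open>\<epsilon>\<close> into two vectors with disjoint supports.  They are
  \<open>(\<epsilon> + \<theta>\<epsilon>) / 2\<close> and \<open>(\<epsilon> - \<theta>\<epsilon>) / 2\<close>.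
\<close>

definition agree_part :: "('j \<Rightarrow> real) \<Rightarrow> ('j \<Rightarrow> real) \<Rightarrow> 'j \<Rightarrow> real" where
  "agree_part \<theta> \<epsilon> j = (1 + \<theta> j) / 2 * \<epsilon> j"

definition differ_part :: "('j \<Rightarrow> real) \<Rightarrow> ('j \<Rightarrow> real) \<Rightarrow> 'j \<Rightarrow> real" where
  "differ_part \<theta> \<epsilon> j = (1 - \<theta> j) / 2 * \<epsilon> j"

lemma abs_agree_part_le:
  assumes "\<theta> \<in> signs J" "\<epsilon> \<in> signs J" "j \<in> J"
  shows "\<bar>agree_part \<theta> \<epsilon> j\<bar> \<le> 1"
  using signs_in[OF assms(1,3)] signs_in[OF assms(2,3)] by (auto simp: agree_part_def)

text \<open>
  Flipping the signs of \<open>\<epsilon>\<close> on the coordinates where \<open>\<theta> = 1\<close> preserves the uniform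
  distribution, multiplies one part by arbitrary signs and leaves the other part alone.
\<close>

lemma sign_mean_resample_agree_part:
  assumes J: "finite J" and th: "\<theta> \<in> signs J"
    and le: "\<And>\<epsilon>. \<epsilon> \<in> signs J \<Longrightarrow>
      sign_mean J (\<lambda>\<sigma>. f (\<lambda>j. \<sigma> j * agree_part \<theta> \<epsilon> j) (differ_part \<theta> \<epsilon>)) \<le> c"
  shows "sign_mean J (\<lambda>\<epsilon>. f (agree_part \<theta> \<epsilon>) (differ_part \<theta> \<epsilon>)) \<le> c"
proof -
  define \<rho> :: "('a \<Rightarrow> real) \<Rightarrow> 'a \<Rightarrow> real"
    where "\<rho> \<sigma> j = (if j \<in> J then if \<theta> j = 1 then \<sigma> j else 1 else 0)" for \<sigma> j
  have rho: "\<rho> \<sigma> \<in> signs J" if "\<sigma> \<in> signs J" for \<sigma>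
    using that by (auto simp: mem_signs_iff \<rho>_def)
  have a: "agree_part \<theta> (\<lambda>j. \<rho> \<sigma> j * \<epsilon> j) = (\<lambda>j. \<sigma> j * agree_part \<theta> \<epsilon> j)"
    if "\<sigma> \<in> signs J" "\<epsilon> \<in> signs J" for \<sigma> \<epsilon>
  proof
    fix j
    show "agree_part \<theta> (\<lambda>j. \<rho> \<sigma> j * \<epsilon> j) j = \<sigma> j * agree_part \<theta> \<epsilon> j"
      using signs_in[OF th, of j] signs_out[OF that(2), of j]
      by (cases "j \<in> J") (auto simp: agree_part_def \<rho>_def)
  qed
  have b: "differ_part \<theta> (\<lambda>j. \<rho> \<sigma> j * \<epsilon> j) = differ_part \<theta> \<epsilon>"
    if "\<sigma> \<in> signs J" "\<epsilon> \<in> signs J" for \<sigma> \<epsilon>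
  proof
    fix j
    show "differ_part \<theta> (\<lambda>j. \<rho> \<sigma> j * \<epsilon> j) j = differ_part \<theta> \<epsilon> j"
      using signs_in[OF th, of j] signs_out[OF that(2), of j]
      by (cases "j \<in> J") (auto simp: differ_part_def \<rho>_def)
  qed
  let ?g = "\<lambda>\<epsilon>. f (agree_part \<theta> \<epsilon>) (differ_part \<theta> \<epsilon>)"
  have "sign_mean J ?g = sign_mean J (\<lambda>\<sigma>. sign_mean J ?g)"
    by (simp add: sign_mean_const[OF J])
  also have "\<dots> = sign_mean J (\<lambda>\<sigma>. sign_mean J (\<lambda>\<epsilon>. ?g (\<lambda>j. \<rho> \<sigma> j * \<epsilon> j)))"
    by (intro sign_mean_cong sign_mean_shift[symmetric] rho)
  also have "\<dots> = sign_mean J (\<lambda>\<epsilon>. sign_mean J (\<lambda>\<sigma>. ?g (\<lambda>j. \<rho> \<sigma> j * \<epsilon> j)))"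
    by (rule sign_mean_swap)
  also have "\<dots> \<le> sign_mean J (\<lambda>\<epsilon>. c)"
  proof (intro sign_mean_mono)
    fix \<epsilon> assume e: "\<epsilon> \<in> signs J"
    have "sign_mean J (\<lambda>\<sigma>. ?g (\<lambda>j. \<rho> \<sigma> j * \<epsilon> j))
        = sign_mean J (\<lambda>\<sigma>. f (\<lambda>j. \<sigma> j * agree_part \<theta> \<epsilon> j) (differ_part \<theta> \<epsilon>))"
      by (intro sign_mean_cong) (simp add: a b e)
    then show "sign_mean J (\<lambda>\<sigma>. ?g (\<lambda>j. \<rho> \<sigma> j * \<epsilon> j)) \<le> c" using le[OF e] by simp
  qed
  finally show ?thesis by (simp add: sign_mean_const[OF J])
qed

text \<open>
  Matrices are functions of a row index in \<open>I\<close> and a column index in \<open>J\<close>.  Operator norms enter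
  only as upper bounds, so \<open>op_bound A d\<close> says that the norm of \<open>A\<close> is at most \<open>d\<close>.
\<close>

locale finite_chaos =
  fixes I :: "'i set" and J :: "'j set"
  assumes finite_rows: "finite I" and finite_cols: "finite J"
begin

definition app :: "('i \<Rightarrow> 'j \<Rightarrow> real) \<Rightarrow> ('j \<Rightarrow> real) \<Rightarrow> 'i \<Rightarrow> real" where
  "app A u i = (\<Sum>j\<in>J. A i j * u j)"

definition ip :: "('i \<Rightarrow> real) \<Rightarrow> ('i \<Rightarrow> real) \<Rightarrow> real" where
  "ip a b = (\<Sum>i\<in>I. a i * b i)"

definition len :: "('i \<Rightarrow> 'j \<Rightarrow> real) \<Rightarrow> ('j \<Rightarrow> real) \<Rightarrow> real" where
  "len A u = L2_set (app A u) I"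

definition op_bound :: "('i \<Rightarrow> 'j \<Rightarrow> real) \<Rightarrow> real \<Rightarrow> bool" where
  "op_bound A d \<longleftrightarrow> (\<forall>u. len A u \<le> d * L2_set u J)"

lemma len_nonneg: "0 \<le> len A u"
  by (simp add: len_def)

lemma len_sq: "(len A u)\<^sup>2 = ip (app A u) (app A u)"
  by (simp add: len_def L2_set_def ip_def power2_eq_square sum_nonneg)

lemma ip_commute: "ip a b = ip b a"
  by (simp add: ip_def mult.commute)

lemma abs_ip_le: "\<bar>ip a b\<bar> \<le> L2_set a I * L2_set b I"
proof -
  have "\<bar>ip a b\<bar> \<le> (\<Sum>i\<in>I. \<bar>a i\<bar> * \<bar>b i\<bar>)"
    unfolding ip_def by (rule order_trans[OF sum_abs]) (simp add: abs_mult)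
  also have "\<dots> \<le> L2_set a I * L2_set b I" by (rule L2_set_mult_ineq)
  finally show ?thesis .
qed

lemma app_diff: "app (\<lambda>i j. A i j - B i j) u i = app A u i - app B u i"
  by (simp add: app_def left_diff_distrib sum_subtractf)

lemma len_half_add_le: "len A (\<lambda>j. (u j + v j) / 2) \<le> (len A u + len A v) / 2"
proof -
  have "app A (\<lambda>j. (u j + v j) / 2) = (\<lambda>i. (1/2) * (app A u i + app A v i))"
    by (rule ext) (simp add: app_def sum_distrib_left sum.distrib[symmetric] field_simps)
  then have "len A (\<lambda>j. (u j + v j) / 2) = (1/2) * L2_set (\<lambda>i. app A u i + app A v i) I"
    by (simp only: len_def L2_set_right_distrib)
  also have "\<dots> \<le> (1/2) * (len A u + len A v)"
    unfolding len_def by (intro mult_left_mono L2_set_triangle_ineq) auto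
  finally show ?thesis by simp
qed

lemma len_uminus: "len A (\<lambda>j. - u j) = len A u"
  by (simp add: len_def L2_set_def app_def sum_negf)

text \<open>
  The operator norm of the transpose of \<open>D\<close> is that of \<open>D\<close>; it bounds the length of the
  coefficient vector of this linear form in the signs.
\<close>

lemma sign_mean_bilinear_tail:
  assumes D: "op_bound D d" and d0: "0 \<le> d" and t0: "0 \<le> \<tau>"
    and u: "\<And>j. j \<in> J \<Longrightarrow> \<bar>u j\<bar> \<le> 1"
  shows "sign_mean J (\<lambda>\<sigma>. of_bool (\<bar>ip (app D (\<lambda>j. \<sigma> j * u j)) w\<bar> > \<tau> * d * L2_set w I))
    \<le> 2 * exp (- \<tau>\<^sup>2 / 2)"
proof -
  define c where "c j = (\<Sum>i\<in>I. D i j * w i)" for j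
  have lin: "ip (app D z) w = (\<Sum>j\<in>J. z j * c j)" for z
    unfolding ip_def app_def c_def
    by (simp add: sum_distrib_left sum_distrib_right sum.swap[of _ I J] mult_ac)
  have c2: "(L2_set c J)\<^sup>2 = ip (app D c) w"
    by (simp add: lin L2_set_def sum_nonneg power2_eq_square)
  also have "\<dots> \<le> len D c * L2_set w I"
    using abs_ip_le[of "app D c" w] by (simp add: len_def)
  also have "\<dots> \<le> (d * L2_set c J) * L2_set w I"
    using D by (intro mult_right_mono) (auto simp: op_bound_def)
  finally have "L2_set c J * L2_set c J \<le> L2_set c J * (d * L2_set w I)"
    by (simp add: power2_eq_square mult_ac)
  then have "L2_set c J \<le> d * L2_set w I"
    using d0 L2_set_nonneg[of c J] L2_set_nonneg[of w I]
    by (cases "L2_set c J = 0") (auto simp: mult_le_cancel_left)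
  then have "(L2_set c J)\<^sup>2 \<le> (d * L2_set w I)\<^sup>2" by (intro power_mono) auto
  then have "(\<Sum>j\<in>J. (c j)\<^sup>2) \<le> (d * L2_set w I)\<^sup>2" by (simp add: L2_set_def sum_nonneg)
  moreover have "(\<Sum>j\<in>J. (u j * c j)\<^sup>2) \<le> (\<Sum>j\<in>J. (c j)\<^sup>2)"
  proof (rule sum_mono)
    fix j assume "j \<in> J"
    then have "(u j)\<^sup>2 * (c j)\<^sup>2 \<le> 1 * (c j)\<^sup>2"
      using u by (intro mult_right_mono) (auto simp: abs_square_le_1)
    then show "(u j * c j)\<^sup>2 \<le> (c j)\<^sup>2" by (simp add: power_mult_distrib)
  qed
  ultimately have "sign_mean J (\<lambda>\<sigma>. of_bool (\<bar>\<Sum>j\<in>J. \<sigma> j * (u j * c j)\<bar> > \<tau> * (d * L2_set w I)))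
      \<le> 2 * exp (- \<tau>\<^sup>2 / 2)"
    using d0 t0 by (intro sign_mean_Hoeffding finite_cols) auto
  then show ?thesis by (simp add: lin mult.assoc)
qed

text \<open>
  One increment of the chain, with the length of the other factor on the right-hand side: the
  part that is not resampled may be treated as a constant.
\<close>

lemma sign_mean_agree_step:
  assumes "\<theta> \<in> signs J" "op_bound D d" "0 \<le> d" "0 \<le> \<tau>"
  shows "sign_mean J (\<lambda>\<epsilon>. of_bool
      (\<bar>ip (app D (agree_part \<theta> \<epsilon>)) (app B (differ_part \<theta> \<epsilon>))\<bar> > \<tau> * d * len B (differ_part \<theta> \<epsilon>)))
    \<le> 2 * exp (- \<tau>\<^sup>2 / 2)"
  unfolding len_def
  by (rule sign_mean_resample_agree_part[OF finite_cols assms(1), where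
      f = "\<lambda>u v. of_bool (\<bar>ip (app D u) (app B v)\<bar> > \<tau> * d * L2_set (app B v) I)"])
    (intro sign_mean_bilinear_tail assms(2-4) abs_agree_part_le[OF assms(1)])

lemma sign_mean_differ_step:
  assumes "\<theta> \<in> signs J" "op_bound D d" "0 \<le> d" "0 \<le> \<tau>"
  shows "sign_mean J (\<lambda>\<epsilon>. of_bool
      (\<bar>ip (app B (agree_part \<theta> \<epsilon>)) (app D (differ_part \<theta> \<epsilon>))\<bar> > \<tau> * d * len B (agree_part \<theta> \<epsilon>)))
    \<le> 2 * exp (- \<tau>\<^sup>2 / 2)"
proof -
  have m: "(\<lambda>j. - \<theta> j) \<in> signs J" using assms(1) unfolding mem_signs_iff
    by (metis minus_minus neg_equal_0_iff_equal)
  have sw: "agree_part (\<lambda>j. - \<theta> j) = differ_part \<theta>" "differ_part (\<lambda>j. - \<theta> j) = agree_part \<theta>"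
    by (auto simp: agree_part_def differ_part_def fun_eq_iff)
  show ?thesis
    using sign_mean_agree_step[OF m assms(2-4), of B] by (simp add: sw ip_commute)
qed

end

text \<open>
  The nets are given as maps \<open>p r\<close> of the index set into itself instead of subsets: the net at level
  \<open>r\<close> is the image of \<open>p r\<close>, and the chain of \<open>x\<close> runs through \<open>p 0 x, \<dots>, p R x = x\<close>.  As the first
  matrix is zero and the last map is the identity, the increments telescope exactly.  The sure bound
  \<open>B\<close> is only ever multiplied by the probability of an exceptional event, so it may be crude.
\<close>

locale chaos_chain = finite_chaos I J for I :: "'i set" and J :: "'j set" +
  fixes T :: "'a set" and M :: "'a \<Rightarrow> 'i \<Rightarrow> 'j \<Rightarrow> real"
    and p :: "nat \<Rightarrow> 'a \<Rightarrow> 'a" and R :: nat and \<Delta> \<tau> :: "nat \<Rightarrow> real"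
    and \<gamma> B :: real
  assumes T: "finite T" "T \<noteq> {}"
    and p_in: "\<And>r x. x \<in> T \<Longrightarrow> r \<le> R \<Longrightarrow> p r x \<in> T"
    and p_last: "\<And>x. x \<in> T \<Longrightarrow> p R x = x"
    and p_first: "\<And>x i j. x \<in> T \<Longrightarrow> i \<in> I \<Longrightarrow> j \<in> J \<Longrightarrow> M (p 0 x) i j = 0"
    and step: "\<And>x r. x \<in> T \<Longrightarrow> r < R \<Longrightarrow>
      op_bound (\<lambda>i j. M (p (Suc r) x) i j - M (p r x) i j) (\<Delta> r)"
    and D0: "\<And>r. 0 \<le> \<Delta> r" and t0: "\<And>r. 0 \<le> \<tau> r"
    and gamma: "(\<Sum>r<R. \<tau> r * \<Delta> r) \<le> \<gamma>"
    and second_moment: "\<And>x. x \<in> T \<Longrightarrow> sign_mean J (\<lambda>\<epsilon>. (len (M x) \<epsilon>)\<^sup>2) \<le> 1"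
    and sure_bound: "\<And>x \<epsilon>. x \<in> T \<Longrightarrow> \<epsilon> \<in> signs J \<Longrightarrow> (len (M x) \<epsilon>)\<^sup>2 \<le> B"
begin

definition max_len :: "('j \<Rightarrow> real) \<Rightarrow> real" where
  "max_len u = Max ((\<lambda>x. len (M x) u) ` T)"

text \<open>
  The union bound over all increments: the factor \<open>4\<close> collects the two tails of the two linear
  forms that belong to each pair of consecutive net points.
\<close>

definition exception_prob :: real where
  "exception_prob = (\<Sum>r<R. 4 * real (card ((\<lambda>x. (p r x, p (Suc r) x)) ` T)) * exp (- (\<tau> r)\<^sup>2 / 2))"

text \<open>The event, for a fixed comparison vector \<open>\<theta>\<close>, that chaining fails to control the bilinear form.\<close>

definition bad :: "('j \<Rightarrow> real) \<Rightarrow> ('j \<Rightarrow> real) \<Rightarrow> bool" where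
  "bad \<theta> \<epsilon> \<longleftrightarrow> (\<exists>x\<in>T. \<bar>ip (app (M x) (agree_part \<theta> \<epsilon>)) (app (M x) (differ_part \<theta> \<epsilon>))\<bar>
      > \<gamma> * (max_len (agree_part \<theta> \<epsilon>) + max_len (differ_part \<theta> \<epsilon>)))"

lemma len_le_max_len: "x \<in> T \<Longrightarrow> len (M x) u \<le> max_len u"
  unfolding max_len_def using T by (intro Max_ge) auto

lemma max_len_le: "(\<And>x. x \<in> T \<Longrightarrow> len (M x) u \<le> c) \<Longrightarrow> max_len u \<le> c"
  unfolding max_len_def using T by (subst Max_le_iff) auto

lemma max_len_nonneg: "0 \<le> max_len u"
proof -
  obtain x where "x \<in> T" using T by blast
  then show ?thesis using len_le_max_len[of x u] len_nonneg[of "M x" u] by linarith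
qed

lemma max_len_attained: obtains x where "x \<in> T" "max_len u = len (M x) u"
proof -
  have "max_len u \<in> (\<lambda>x. len (M x) u) ` T"
    unfolding max_len_def using T by (intro Max_in) auto
  then show ?thesis using that by blast
qed

text \<open>
  Both parts are averages of two sign vectors, so a convex function of them is controlled by its
  values at sign vectors.
\<close>

lemma max_len_parts_le:
  "max_len (agree_part \<theta> \<epsilon>) + max_len (differ_part \<theta> \<epsilon>) \<le> max_len \<epsilon> + max_len (\<lambda>j. \<theta> j * \<epsilon> j)"
proof -
  have "max_len (agree_part \<theta> \<epsilon>) \<le> (max_len \<epsilon> + max_len (\<lambda>j. \<theta> j * \<epsilon> j)) / 2"
  proof (rule max_len_le)
    fix x assume x: "x \<in> T"
    have "agree_part \<theta> \<epsilon> = (\<lambda>j. (\<epsilon> j + \<theta> j * \<epsilon> j) / 2)"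
      by (auto simp: agree_part_def algebra_simps add_divide_distrib)
    then have "len (M x) (agree_part \<theta> \<epsilon>) \<le> (len (M x) \<epsilon> + len (M x) (\<lambda>j. \<theta> j * \<epsilon> j)) / 2"
      by (metis len_half_add_le)
    also have "\<dots> \<le> (max_len \<epsilon> + max_len (\<lambda>j. \<theta> j * \<epsilon> j)) / 2"
      by (intro divide_right_mono add_mono len_le_max_len x) simp
    finally show "len (M x) (agree_part \<theta> \<epsilon>) \<le> (max_len \<epsilon> + max_len (\<lambda>j. \<theta> j * \<epsilon> j)) / 2" .
  qed
  moreover have "max_len (differ_part \<theta> \<epsilon>) \<le> (max_len \<epsilon> + max_len (\<lambda>j. \<theta> j * \<epsilon> j)) / 2"
  proof (rule max_len_le)
    fix x assume x: "x \<in> T"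
    have "differ_part \<theta> \<epsilon> = (\<lambda>j. (\<epsilon> j + - (\<theta> j * \<epsilon> j)) / 2)"
      by (auto simp: differ_part_def algebra_simps diff_divide_distrib)
    then have "len (M x) (differ_part \<theta> \<epsilon>) \<le> (len (M x) \<epsilon> + len (M x) (\<lambda>j. - (\<theta> j * \<epsilon> j))) / 2"
      by (metis len_half_add_le)
    then show "len (M x) (differ_part \<theta> \<epsilon>) \<le> (max_len \<epsilon> + max_len (\<lambda>j. \<theta> j * \<epsilon> j)) / 2"
      using len_le_max_len[OF x, of \<epsilon>] len_le_max_len[OF x, of "\<lambda>j. \<theta> j * \<epsilon> j"]
      by (simp add: len_uminus)
  qed
  ultimately show ?thesis by (simp add: field_simps)
qed

text \<open>
  The chaining step.  Along the chain, the bilinear form telescopes into increments that are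
  linear in one of the two parts; with the other part fixed, Hoeffding's inequality applies
  with variance proxy \<open>\<Delta>\<^sup>2\<close> times a squared length that \<^const>\<open>max_len\<close> controls.  It is
  important that this length is kept as a random variable.
\<close>

lemma sign_mean_bad_le:
  assumes th: "\<theta> \<in> signs J"
  shows "sign_mean J (\<lambda>\<epsilon>. of_bool (bad \<theta> \<epsilon>)) \<le> exception_prob"
proof -
  define P where "P r = (\<lambda>x. (p r x, p (Suc r) x)) ` T" for r
  define diff where "diff a b = (\<lambda>i j. M b i j - M a i j)" for a b
  let ?u = "agree_part \<theta>" and ?v = "differ_part \<theta>"
  define E1 where "E1 r ab \<epsilon> \<longleftrightarrow>
    \<bar>ip (app (diff (fst ab) (snd ab)) (?u \<epsilon>)) (app (M (snd ab)) (?v \<epsilon>))\<bar>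
      > \<tau> r * \<Delta> r * len (M (snd ab)) (?v \<epsilon>)" for r ab \<epsilon>
  define E2 where "E2 r ab \<epsilon> \<longleftrightarrow>
    \<bar>ip (app (M (fst ab)) (?u \<epsilon>)) (app (diff (fst ab) (snd ab)) (?v \<epsilon>))\<bar>
      > \<tau> r * \<Delta> r * len (M (fst ab)) (?u \<epsilon>)" for r ab \<epsilon>
  have finP: "finite (P r)" for r using T by (simp add: P_def)
  have good: "\<not> bad \<theta> \<epsilon>"
    if no: "\<And>r ab. r < R \<Longrightarrow> ab \<in> P r \<Longrightarrow> \<not> E1 r ab \<epsilon> \<and> \<not> E2 r ab \<epsilon>" for \<epsilon>
  proof -
    have "\<forall>x\<in>T. \<bar>ip (app (M x) (?u \<epsilon>)) (app (M x) (?v \<epsilon>))\<bar>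
        \<le> \<gamma> * (max_len (?u \<epsilon>) + max_len (?v \<epsilon>))"
    proof (intro ballI)
      fix x assume x: "x \<in> T"
      let ?N = "max_len (?u \<epsilon>) + max_len (?v \<epsilon>)"
      define b where "b r = ip (app (M (p r x)) (?u \<epsilon>)) (app (M (p r x)) (?v \<epsilon>))" for r
      have inc: "\<bar>b (Suc r) - b r\<bar> \<le> \<tau> r * \<Delta> r * ?N" if r: "r < R" for r
      proof -
        let ?D = "diff (p r x) (p (Suc r) x)"
        have "(p r x, p (Suc r) x) \<in> P r" using x by (auto simp: P_def)
        from no[OF r this]
        have 1: "\<bar>ip (app ?D (?u \<epsilon>)) (app (M (p (Suc r) x)) (?v \<epsilon>))\<bar>
                 \<le> \<tau> r * \<Delta> r * len (M (p (Suc r) x)) (?v \<epsilon>)"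
          and 2: "\<bar>ip (app (M (p r x)) (?u \<epsilon>)) (app ?D (?v \<epsilon>))\<bar> \<le> \<tau> r * \<Delta> r * len (M (p r x)) (?u \<epsilon>)"
          by (auto simp: E1_def E2_def)
        have "b (Suc r) - b r = ip (app ?D (?u \<epsilon>)) (app (M (p (Suc r) x)) (?v \<epsilon>))
            + ip (app (M (p r x)) (?u \<epsilon>)) (app ?D (?v \<epsilon>))"
          unfolding b_def ip_def diff_def app_diff sum.distrib[symmetric] sum_subtractf[symmetric]
          by (intro sum.cong) (auto simp: algebra_simps)
        then have "\<bar>b (Suc r) - b r\<bar>
            \<le> \<tau> r * \<Delta> r * len (M (p (Suc r) x)) (?v \<epsilon>) + \<tau> r * \<Delta> r * len (M (p r x)) (?u \<epsilon>)"
          using 1 2 by linarith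
        also have "\<dots> \<le> \<tau> r * \<Delta> r * max_len (?v \<epsilon>) + \<tau> r * \<Delta> r * max_len (?u \<epsilon>)"
          using x r D0 t0 by (intro add_mono mult_left_mono len_le_max_len p_in) auto
        finally show ?thesis by (simp add: algebra_simps)
      qed
      have "b 0 = 0"
        unfolding b_def ip_def app_def using p_first[OF x] by (intro sum.neutral) auto
      then have "\<bar>b R\<bar> = \<bar>\<Sum>r<R. b (Suc r) - b r\<bar>" by (simp add: sum_lessThan_telescope)
      also have "\<dots> \<le> (\<Sum>r<R. \<tau> r * \<Delta> r * ?N)"
        by (rule order_trans[OF sum_abs]) (intro sum_mono inc, simp)
      also have "\<dots> = (\<Sum>r<R. \<tau> r * \<Delta> r) * ?N" by (simp add: sum_distrib_right)
      also have "\<dots> \<le> \<gamma> * ?N"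
        using gamma max_len_nonneg by (intro mult_right_mono add_nonneg_nonneg) auto
      finally show "\<bar>ip (app (M x) (?u \<epsilon>)) (app (M x) (?v \<epsilon>))\<bar> \<le> \<gamma> * ?N"
        by (simp add: b_def p_last x)
    qed
    then show ?thesis by (force simp: bad_def not_less)
  qed
  have "sign_mean J (\<lambda>\<epsilon>. of_bool (bad \<theta> \<epsilon>))
      \<le> sign_mean J (\<lambda>\<epsilon>. of_bool (\<exists>r\<in>{..<R}. \<exists>ab\<in>P r. E1 r ab \<epsilon>)
                        + of_bool (\<exists>r\<in>{..<R}. \<exists>ab\<in>P r. E2 r ab \<epsilon>))"
    using good by (intro sign_mean_mono) (auto simp: of_bool_def)
  also have "\<dots> \<le> (\<Sum>r<R. \<Sum>ab\<in>P r. 2 * exp (- (\<tau> r)\<^sup>2 / 2)) + (\<Sum>r<R. \<Sum>ab\<in>P r. 2 * exp (- (\<tau> r)\<^sup>2 / 2))"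
    unfolding sign_mean_add
  proof (intro add_mono)
    show "sign_mean J (\<lambda>\<epsilon>. of_bool (\<exists>r\<in>{..<R}. \<exists>ab\<in>P r. E1 r ab \<epsilon>))
        \<le> (\<Sum>r<R. \<Sum>ab\<in>P r. 2 * exp (- (\<tau> r)\<^sup>2 / 2))"
    proof (intro order_trans[OF sign_mean_of_bool_ex_le] finite_lessThan sum_mono finP)
      fix r ab assume "r \<in> {..<R}" "ab \<in> P r"
      then show "sign_mean J (\<lambda>\<epsilon>. of_bool (E1 r ab \<epsilon>)) \<le> 2 * exp (- (\<tau> r)\<^sup>2 / 2)"
        unfolding E1_def using step D0 t0
        by (intro sign_mean_agree_step th) (auto simp: P_def diff_def)
    qed
    show "sign_mean J (\<lambda>\<epsilon>. of_bool (\<exists>r\<in>{..<R}. \<exists>ab\<in>P r. E2 r ab \<epsilon>))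
        \<le> (\<Sum>r<R. \<Sum>ab\<in>P r. 2 * exp (- (\<tau> r)\<^sup>2 / 2))"
    proof (intro order_trans[OF sign_mean_of_bool_ex_le] finite_lessThan sum_mono finP)
      fix r ab assume "r \<in> {..<R}" "ab \<in> P r"
      then show "sign_mean J (\<lambda>\<epsilon>. of_bool (E2 r ab \<epsilon>)) \<le> 2 * exp (- (\<tau> r)\<^sup>2 / 2)"
        unfolding E2_def using step D0 t0
        by (intro sign_mean_differ_step th) (auto simp: P_def diff_def)
    qed
  qed
  also have "\<dots> = exception_prob"
    by (simp add: exception_prob_def P_def sum.distrib[symmetric] mult_ac)
  finally show ?thesis .
qed

text \<open>
  Comparing \<open>\<epsilon>\<close> with an independent copy \<open>\<theta>\<epsilon>\<close> turns the centred quadratic form into the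
  bilinear form of the two parts, because \<open>\<parallel>a\<parallel>\<^sup>2 - \<parallel>b\<parallel>\<^sup>2 = \<langle>a + b, a - b\<rangle>\<close>.
\<close>

lemma len_sq_diff_eq:
  "(len A \<epsilon>)\<^sup>2 - (len A (\<lambda>j. \<theta> j * \<epsilon> j))\<^sup>2 = 4 * ip (app A (agree_part \<theta> \<epsilon>)) (app A (differ_part \<theta> \<epsilon>))"
proof -
  have a: "app A (agree_part \<theta> \<epsilon>) i = (app A \<epsilon> i + app A (\<lambda>j. \<theta> j * \<epsilon> j) i) / 2" for i
    by (simp add: app_def agree_part_def sum_divide_distrib sum.distrib[symmetric] algebra_simps
        add_divide_distrib)
  have d: "app A (differ_part \<theta> \<epsilon>) i = (app A \<epsilon> i - app A (\<lambda>j. \<theta> j * \<epsilon> j) i) / 2" for i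
    by (simp add: app_def differ_part_def sum_divide_distrib sum_subtractf[symmetric] algebra_simps
        diff_divide_distrib)
  show ?thesis
    unfolding len_sq ip_def a d sum_distrib_left sum_subtractf[symmetric]
    by (intro sum.cong) (auto simp: field_simps)
qed

text \<open>
  Averaging over \<open>\<theta>\<close> replaces \<open>max_len (\<theta>\<epsilon>)\<close> by the mean of \<^const>\<open>max_len\<close>.  For those \<open>\<theta>\<close> for
  which chaining fails, only the sure bound \<open>B\<close> is available.
\<close>

lemma deviation_le:
  assumes e: "\<epsilon> \<in> signs J" and x: "x \<in> T" and g0: "0 \<le> \<gamma>"
  shows "\<bar>(len (M x) \<epsilon>)\<^sup>2 - sign_mean J (\<lambda>\<epsilon>. (len (M x) \<epsilon>)\<^sup>2)\<bar>
    \<le> 4 * \<gamma> * (max_len \<epsilon> + sign_mean J max_len) + B * sign_mean J (\<lambda>\<theta>. of_bool (bad \<theta> \<epsilon>))"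
proof -
  let ?q = "\<lambda>\<epsilon>. (len (M x) \<epsilon>)\<^sup>2"
  have "?q \<epsilon> - sign_mean J ?q = sign_mean J (\<lambda>\<theta>. ?q \<epsilon> - ?q (\<lambda>j. \<theta> j * \<epsilon> j))"
    by (simp add: sign_mean_diff sign_mean_const finite_cols sign_mean_shift'[OF e, of ?q])
  then have "\<bar>?q \<epsilon> - sign_mean J ?q\<bar> \<le> sign_mean J (\<lambda>\<theta>. \<bar>?q \<epsilon> - ?q (\<lambda>j. \<theta> j * \<epsilon> j)\<bar>)"
    by (simp add: abs_sign_mean_le)
  also have "\<dots> \<le> sign_mean J (\<lambda>\<theta>. 4 * \<gamma> * (max_len \<epsilon> + max_len (\<lambda>j. \<theta> j * \<epsilon> j)) + B * of_bool (bad \<theta> \<epsilon>))"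
  proof (intro sign_mean_mono)
    fix \<theta> assume th: "\<theta> \<in> signs J"
    have nn: "0 \<le> 4 * \<gamma> * (max_len \<epsilon> + max_len (\<lambda>j. \<theta> j * \<epsilon> j))"
      using g0 max_len_nonneg by simp
    show "\<bar>?q \<epsilon> - ?q (\<lambda>j. \<theta> j * \<epsilon> j)\<bar>
        \<le> 4 * \<gamma> * (max_len \<epsilon> + max_len (\<lambda>j. \<theta> j * \<epsilon> j)) + B * of_bool (bad \<theta> \<epsilon>)"
    proof (cases "bad \<theta> \<epsilon>")
      case True
      have "\<bar>?q \<epsilon> - ?q (\<lambda>j. \<theta> j * \<epsilon> j)\<bar> \<le> B"
        using sure_bound[OF x e] sure_bound[OF x signs_mult[OF e th]]
          zero_le_power2[of "len (M x) \<epsilon>"] zero_le_power2[of "len (M x) (\<lambda>j. \<theta> j * \<epsilon> j)"]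
        by linarith
      then show ?thesis using nn True by simp
    next
      case False
      then have "\<bar>ip (app (M x) (agree_part \<theta> \<epsilon>)) (app (M x) (differ_part \<theta> \<epsilon>))\<bar>
          \<le> \<gamma> * (max_len (agree_part \<theta> \<epsilon>) + max_len (differ_part \<theta> \<epsilon>))"
        using x by (force simp: bad_def not_less)
      also have "\<dots> \<le> \<gamma> * (max_len \<epsilon> + max_len (\<lambda>j. \<theta> j * \<epsilon> j))"
        using g0 by (intro mult_left_mono max_len_parts_le)
      finally show ?thesis using False by (simp add: len_sq_diff_eq abs_mult)
    qed
  qed
  also have "\<dots> = 4 * \<gamma> * (max_len \<epsilon> + sign_mean J max_len) + B * sign_mean J (\<lambda>\<theta>. of_bool (bad \<theta> \<epsilon>))"
    by (simp only: sign_mean_add sign_mean_cmult sign_mean_const[OF finite_cols]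
        sign_mean_shift'[OF e, of max_len])
  finally show ?thesis .
qed

text \<open>
  The bound on the deviation contains the maximal length itself, and the square of the maximal
  length is at most \<open>1\<close> plus the largest deviation.  For small \<open>\<gamma>\<close> this inequality
  closes up, first in the mean and then outside a small exceptional set.
\<close>

theorem deviation_tail:
  assumes g: "0 < \<gamma>" "\<gamma> \<le> 1 / 16" and Bq: "B * exception_prob \<le> 1"
  shows "sign_mean J (\<lambda>\<epsilon>. of_bool
      (\<exists>x\<in>T. \<bar>(len (M x) \<epsilon>)\<^sup>2 - sign_mean J (\<lambda>\<epsilon>. (len (M x) \<epsilon>)\<^sup>2)\<bar> > 17 * \<gamma>))
    \<le> B * exception_prob / \<gamma>"
proof -
  define \<mu> where "\<mu> = sign_mean J max_len"
  define \<beta> where "\<beta> \<epsilon> = B * sign_mean J (\<lambda>\<theta>. of_bool (bad \<theta> \<epsilon>))" for \<epsilon>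
  have B0: "0 \<le> B"
  proof -
    obtain x \<epsilon> where "x \<in> T" "\<epsilon> \<in> signs J" using T signs_nonempty by blast
    then show ?thesis using sure_bound by (meson order_trans zero_le_power2)
  qed
  have mean_beta: "sign_mean J \<beta> \<le> B * exception_prob"
  proof -
    have "sign_mean J \<beta> = B * sign_mean J (\<lambda>\<epsilon>. sign_mean J (\<lambda>\<theta>. of_bool (bad \<theta> \<epsilon>)))"
      by (simp only: \<beta>_def[abs_def] sign_mean_cmult)
    also have "\<dots> = B * sign_mean J (\<lambda>\<theta>. sign_mean J (\<lambda>\<epsilon>. of_bool (bad \<theta> \<epsilon>)))"
      by (subst sign_mean_swap) (rule refl)
    also have "\<dots> \<le> B * sign_mean J (\<lambda>\<theta>. exception_prob)"
      by (intro mult_left_mono sign_mean_mono sign_mean_bad_le B0)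
    finally show ?thesis by (simp add: sign_mean_const finite_cols)
  qed
  have dev: "\<bar>(len (M x) \<epsilon>)\<^sup>2 - sign_mean J (\<lambda>\<epsilon>. (len (M x) \<epsilon>)\<^sup>2)\<bar>
      \<le> 4 * \<gamma> * (max_len \<epsilon> + \<mu>) + \<beta> \<epsilon>" if "\<epsilon> \<in> signs J" "x \<in> T" for x \<epsilon>
    using deviation_le[OF that] g by (simp add: \<mu>_def \<beta>_def)
  have self: "(max_len \<epsilon>)\<^sup>2 \<le> 1 + 4 * \<gamma> * (max_len \<epsilon> + \<mu>) + \<beta> \<epsilon>" if "\<epsilon> \<in> signs J" for \<epsilon>
  proof -
    obtain x where "x \<in> T" "max_len \<epsilon> = len (M x) \<epsilon>" by (rule max_len_attained)
    then show ?thesis using dev[OF that, of x] second_moment[of x] by simp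
  qed
  have mu0: "0 \<le> \<mu>" unfolding \<mu>_def by (intro sign_mean_nonneg max_len_nonneg)
  \<comment> \<open>The means of both sides of \<open>self\<close> give \<open>\<mu>\<^sup>2 \<le> 2 + \<mu> / 2\<close>.\<close>
  have mu2: "\<mu> \<le> 2"
  proof (rule ccontr)
    assume "\<not> \<mu> \<le> 2"
    then have "2 * \<mu> < \<mu>\<^sup>2" by (simp add: power2_eq_square)
    also have "\<mu>\<^sup>2 \<le> sign_mean J (\<lambda>\<epsilon>. (max_len \<epsilon>)\<^sup>2)"
      unfolding \<mu>_def by (rule sign_mean_square_le[OF finite_cols])
    also have "\<dots> \<le> sign_mean J (\<lambda>\<epsilon>. 1 + 4 * \<gamma> * (max_len \<epsilon> + \<mu>) + \<beta> \<epsilon>)"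
      by (intro sign_mean_mono self)
    also have "\<dots> = 1 + 4 * \<gamma> * (\<mu> + \<mu>) + sign_mean J \<beta>"
      by (simp only: sign_mean_add sign_mean_cmult sign_mean_const[OF finite_cols] \<mu>_def)
    also have "\<dots> \<le> 1 + 4 * (1 / 16) * (\<mu> + \<mu>) + 1"
      using mean_beta Bq g mu0 by (intro add_mono mult_right_mono) auto
    finally show False using \<open>\<not> \<mu> \<le> 2\<close> by simp
  qed
  have good: "\<bar>(len (M x) \<epsilon>)\<^sup>2 - sign_mean J (\<lambda>\<epsilon>. (len (M x) \<epsilon>)\<^sup>2)\<bar> \<le> 17 * \<gamma>"
    if e: "\<epsilon> \<in> signs J" and x: "x \<in> T" and b: "\<beta> \<epsilon> \<le> \<gamma>" for x \<epsilon>
  proof -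
    have gm: "4 * \<gamma> * (max_len \<epsilon> + \<mu>) \<le> 4 * (1 / 16) * (max_len \<epsilon> + 2)"
      using g mu2 mu0 max_len_nonneg by (intro mult_mono) auto
    have m2: "max_len \<epsilon> \<le> 2"
    proof (rule ccontr)
      assume "\<not> max_len \<epsilon> \<le> 2"
      then have "2 * max_len \<epsilon> < (max_len \<epsilon>)\<^sup>2" by (simp add: power2_eq_square)
      also have "(max_len \<epsilon>)\<^sup>2 \<le> 1 + 4 * (1 / 16) * (max_len \<epsilon> + 2) + 1 / 16"
        using self[OF e] gm b g by (meson add_mono order_refl order_trans)
      finally show False using \<open>\<not> max_len \<epsilon> \<le> 2\<close> by (simp add: field_simps)
    qed
    have "4 * \<gamma> * (max_len \<epsilon> + \<mu>) \<le> 4 * \<gamma> * (2 + 2)"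
      using m2 mu2 g by (intro mult_left_mono add_mono) auto
    with b have "4 * \<gamma> * (max_len \<epsilon> + \<mu>) + \<beta> \<epsilon> \<le> 4 * \<gamma> * (2 + 2) + \<gamma>" by (intro add_mono)
    then show ?thesis using order_trans[OF dev[OF e x]] by simp
  qed
  \<comment> \<open>Markov's inequality for \<open>\<beta>\<close>.\<close>
  have "sign_mean J (\<lambda>\<epsilon>. of_bool
      (\<exists>x\<in>T. \<bar>(len (M x) \<epsilon>)\<^sup>2 - sign_mean J (\<lambda>\<epsilon>. (len (M x) \<epsilon>)\<^sup>2)\<bar> > 17 * \<gamma>))
      \<le> sign_mean J (\<lambda>\<epsilon>. (1 / \<gamma>) * \<beta> \<epsilon>)"
  proof (intro sign_mean_mono)
    fix \<epsilon> assume e: "\<epsilon> \<in> signs J"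
    have "0 \<le> \<beta> \<epsilon>" unfolding \<beta>_def using B0 by (intro mult_nonneg_nonneg sign_mean_nonneg) auto
    then show "of_bool (\<exists>x\<in>T. \<bar>(len (M x) \<epsilon>)\<^sup>2 - sign_mean J (\<lambda>\<epsilon>. (len (M x) \<epsilon>)\<^sup>2)\<bar> > 17 * \<gamma>)
        \<le> (1 / \<gamma>) * \<beta> \<epsilon>"
      using good[OF e] g by (cases "\<beta> \<epsilon> \<le> \<gamma>") (force simp: not_less field_simps)+
  qed
  also have "\<dots> \<le> (1 / \<gamma>) * (B * exception_prob)"
    unfolding sign_mean_cmult using g mean_beta by (intro mult_left_mono) auto
  finally show ?thesis by simp
qed

end

section \<open>The discrete Fourier transform and circulant matrices\<close>

definition root_power :: "nat \<Rightarrow> int \<Rightarrow> complex" where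
  "root_power n t = cis (2 * pi * real_of_int t / real n)"

definition fourier :: "nat \<Rightarrow> (nat \<Rightarrow> real) \<Rightarrow> nat \<Rightarrow> complex" where
  "fourier n x f = (\<Sum>k<n. complex_of_real (x k) * root_power n (int f * int k))"

lemma root_power_add: "root_power n (a + b) = root_power n a * root_power n b"
  by (simp add: root_power_def cis_mult algebra_simps add_divide_distrib)

lemma root_power_multiple: "n > 0 \<Longrightarrow> root_power n (int n * t) = 1"
  using cis_multiple_2pi[of "real_of_int t"] by (simp add: root_power_def mult_ac)

lemma root_power_mod_mult:
  assumes "n > 0"
  shows "root_power n (a * (b mod int n)) = root_power n (a * b)"
proof -
  have "b = int n * (b div int n) + b mod int n" by simp
  then have "a * b = int n * (a * (b div int n)) + a * (b mod int n)"
    by (metis distrib_left mult.left_commute)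
  then show ?thesis by (metis assms root_power_add root_power_multiple mult_1)
qed

lemma norm_root_power [simp]: "cmod (root_power n t) = 1"
  by (simp add: root_power_def)

lemma cnj_root_power: "cnj (root_power n t) = root_power n (- t)"
  by (simp add: root_power_def cis_cnj)

lemma root_power_mult_nat: "root_power n (int f * t) = root_power n t ^ f"
proof -
  have "2 * pi * real_of_int (int f * t) / real n = real f * (2 * pi * real_of_int t / real n)"
    by simp
  then show ?thesis unfolding root_power_def Complex.DeMoivre by (rule arg_cong)
qed

lemma sum_root_power:
  assumes n: "n > 0"
  shows "(\<Sum>f<n. root_power n (int f * t)) = (if int n dvd t then of_nat n else 0)"
proof (cases "int n dvd t")
  case True
  then obtain q where "t = int n * q" by (elim dvdE)
  then have "root_power n (int f * t) = 1" for f
    using root_power_multiple[OF n, of "int f * q"] by (simp add: mult_ac)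
  then show ?thesis using True by simp
next
  case False
  have "root_power n t \<noteq> 1"
  proof
    assume "root_power n t = 1"
    then have "cos (2 * pi * real_of_int t / real n) = 1"
      by (metis root_power_def cis.sel(1) one_complex.sel(1))
    then obtain q :: int where "2 * pi * real_of_int t / real n = of_int q * 2 * pi"
      unfolding cos_one_2pi_int by blast
    then have "real_of_int t = of_int (int n * q)" using n by (simp add: field_simps)
    then have "t = int n * q" by linarith
    then show False using False by simp
  qed
  moreover have "root_power n t ^ n = 1"
    unfolding root_power_mult_nat[symmetric] by (rule root_power_multiple[OF n])
  ultimately show ?thesis
    using False by (simp add: root_power_mult_nat sum_gp_strict)
qed

text \<open>Parseval's identity, for a system of residues modulo \<open>n\<close>.\<close>

lemma parseval:
  fixes v :: "nat \<Rightarrow> real"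
  assumes n: "n > 0" and K: "finite K"
    and inj: "\<And>j k. j \<in> K \<Longrightarrow> k \<in> K \<Longrightarrow> int n dvd int j - int k \<Longrightarrow> j = k"
  shows "(\<Sum>f<n. (cmod (\<Sum>j\<in>K. complex_of_real (v j) * root_power n (int f * int j)))\<^sup>2)
    = real n * (\<Sum>j\<in>K. (v j)\<^sup>2)"
proof -
  let ?S = "\<lambda>f. \<Sum>j\<in>K. complex_of_real (v j) * root_power n (int f * int j)"
  have "complex_of_real (\<Sum>f<n. (cmod (?S f))\<^sup>2) = (\<Sum>f<n. ?S f * cnj (?S f))"
    by (simp only: complex_norm_square of_real_sum)
  also have "\<dots> = (\<Sum>f<n. \<Sum>j\<in>K. \<Sum>k\<in>K.
      complex_of_real (v j * v k) * root_power n (int f * (int j - int k)))"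
  proof (intro sum.cong refl)
    fix f
    have "?S f * cnj (?S f) = (\<Sum>j\<in>K. \<Sum>k\<in>K. (complex_of_real (v j) * root_power n (int f * int j)) *
        (complex_of_real (v k) * root_power n (- (int f * int k))))"
      by (simp add: cnj_root_power sum_product)
    also have "\<dots> = (\<Sum>j\<in>K. \<Sum>k\<in>K.
        complex_of_real (v j * v k) * root_power n (int f * (int j - int k)))"
    proof (intro sum.cong refl)
      fix j k
      have "root_power n (int f * (int j - int k))
          = root_power n (int f * int j) * root_power n (- (int f * int k))"
        by (simp add: root_power_add[symmetric] algebra_simps)
      then show "(complex_of_real (v j) * root_power n (int f * int j)) *
          (complex_of_real (v k) * root_power n (- (int f * int k)))
          = complex_of_real (v j * v k) * root_power n (int f * (int j - int k))"
        by simp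
    qed
    finally show "?S f * cnj (?S f) = (\<Sum>j\<in>K. \<Sum>k\<in>K.
        complex_of_real (v j * v k) * root_power n (int f * (int j - int k)))" .
  qed
  also have "\<dots> = (\<Sum>j\<in>K. \<Sum>k\<in>K. \<Sum>f<n.
      complex_of_real (v j * v k) * root_power n (int f * (int j - int k)))"
    by (subst sum.swap) (intro sum.cong refl sum.swap)
  also have "\<dots> = (\<Sum>j\<in>K. \<Sum>k\<in>K. if k = j then complex_of_real (real n * (v j)\<^sup>2) else 0)"
    unfolding sum_distrib_left[symmetric] sum_root_power[OF n]
    by (intro sum.cong refl) (auto dest: inj simp: power2_eq_square)
  also have "\<dots> = complex_of_real (real n * (\<Sum>j\<in>K. (v j)\<^sup>2))"
    using K by (simp add: sum_distrib_left)
  finally show ?thesis by (simp only: of_real_eq_iff)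
qed

lemma residues_eq_if_dvd:
  assumes "j < n" "k < n" "int n dvd int j - int k"
  shows "j = k"
  using assms by (metis mod_eq_dvd_iff mod_less of_nat_eq_iff zmod_int)

lemma residues_1_eq_if_dvd:
  assumes "j \<in> {1..n}" "k \<in> {1..n}" "int n dvd int j - int k"
  shows "j = k"
proof -
  have "int n dvd int (j - 1) - int (k - 1)" using assms by (simp add: of_nat_diff)
  then have "j - 1 = k - 1" using assms by (intro residues_eq_if_dvd[of _ n]) auto
  then show ?thesis using assms by auto
qed

text \<open>
  Reindexing a sum over residues by \<open>j \<mapsto> c \<plusminus> j\<close>, in the two forms needed for the columns
  \<open>0, \<dots>, n - 1\<close> and the rows \<open>1, \<dots>, n\<close> of a circulant matrix.
\<close>

lemma bij_betw_residues:
  assumes n: "n > 0" and card: "card K = n" and s: "\<And>j. s j = c + e * int j" and e: "e = 1 \<or> e = -1"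
    and inj: "\<And>j k. j \<in> K \<Longrightarrow> k \<in> K \<Longrightarrow> int n dvd int j - int k \<Longrightarrow> j = k"
  shows "bij_betw (\<lambda>j. nat (s j mod int n)) K {..<n}"
proof -
  have "inj_on (\<lambda>j. nat (s j mod int n)) K"
  proof (rule inj_onI)
    fix j k assume jk: "j \<in> K" "k \<in> K" and "nat (s j mod int n) = nat (s k mod int n)"
    then have "s j mod int n = s k mod int n" using n by (simp add: eq_nat_nat_iff)
    then have "int n dvd e * (int j - int k)" by (simp add: mod_eq_dvd_iff s algebra_simps)
    then have "int n dvd int j - int k" using e by (auto simp: dvd_diff_commute)
    then show "j = k" by (rule inj[OF jk])
  qed
  moreover from this have "(\<lambda>j. nat (s j mod int n)) ` K = {..<n}"
    using n card by (intro card_subset_eq) (auto simp: nat_less_iff card_image)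
  ultimately show ?thesis by (simp add: bij_betw_def)
qed

lemma sum_residues_row:
  assumes "n > 0"
  shows "(\<Sum>l<n. g (nat ((a - int l) mod int n))) = (\<Sum>k<n. g k)"
  using assms
  by (intro sum.reindex_bij_betw bij_betw_residues[where c = a and e = "-1"])
    (auto dest: residues_eq_if_dvd)

lemma sum_residues_column:
  assumes "n > 0"
  shows "(\<Sum>j=1..n. g (nat ((int j - a) mod int n))) = (\<Sum>k<n. g k)"
  using assms
  by (intro sum.reindex_bij_betw bij_betw_residues[where c = "-a" and e = 1])
    (auto intro: residues_1_eq_if_dvd)

text \<open>
  The rows are numbered \<open>1, \<dots>, n\<close> and the columns \<open>0, \<dots>, n - 1\<close>, which
  accounts for the shift by \<open>2\<close>: in terms of the 1-based index \<open>l + 1\<close>, the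
  0-based position of entry \<open>j \<ominus> (l + 1)\<close> is \<open>j - l - 2\<close> modulo \<open>n\<close>.
\<close>

definition circ :: "nat \<Rightarrow> (nat \<Rightarrow> real) \<Rightarrow> nat \<Rightarrow> nat \<Rightarrow> real" where
  "circ n x j l = x (nat ((int j - 2 - int l) mod int n))"

text \<open>
  The Fourier transform diagonalises convolution, so the operator norm of a circulant matrix is
  at most the largest Fourier coefficient of its generator.
\<close>

lemma circ_norm_le:
  assumes n: "n > 0" and D: "\<And>f. f < n \<Longrightarrow> cmod (fourier n x f) \<le> D"
  shows "(\<Sum>j=1..n. (\<Sum>l<n. circ n x j l * u l)\<^sup>2) \<le> D\<^sup>2 * (\<Sum>l<n. (u l)\<^sup>2)"
proof -
  define y where "y j = (\<Sum>l<n. circ n x j l * u l)" for j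
  let ?Y = "\<lambda>f. \<Sum>j=1..n. complex_of_real (y j) * root_power n (int f * int j)"
  have conv: "?Y f = fourier n x f * root_power n (int f * 2) * fourier n u f" for f
  proof -
    have "?Y f = (\<Sum>l<n. \<Sum>j=1..n. complex_of_real (circ n x j l) * complex_of_real (u l)
        * root_power n (int f * int j))"
      unfolding y_def by (subst sum.swap) (simp add: sum_distrib_right)
    also have "\<dots> = (\<Sum>l<n. complex_of_real (u l) * root_power n (int f * int l) *
        (fourier n x f * root_power n (int f * 2)))"
    proof (intro sum.cong refl)
      fix l
      define g where "g k = complex_of_real (x k) * root_power n (int f * int k)" for k
      have "(\<Sum>j=1..n. complex_of_real (circ n x j l) * complex_of_real (u l) * root_power n (int f * int j))
         = (\<Sum>j=1..n. complex_of_real (u l) * root_power n (int f * (2 + int l)) *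
              g (nat ((int j - (2 + int l)) mod int n)))"
      proof (intro sum.cong refl)
        fix j
        let ?k = "(int j - (2 + int l)) mod int n"
        have "int j - 2 - int l = int j - (2 + int l)" by simp
        then have c: "circ n x j l = x (nat ?k)" by (simp only: circ_def)
        have "root_power n (int f * int (nat ?k)) = root_power n (int f * (int j - (2 + int l)))"
          using n root_power_mod_mult[OF n] by simp
        then have "root_power n (int f * (2 + int l)) * root_power n (int f * int (nat ?k))
            = root_power n (int f * int j)"
          by (simp add: root_power_add[symmetric] algebra_simps)
        then show "complex_of_real (circ n x j l) * complex_of_real (u l) * root_power n (int f * int j)
            = complex_of_real (u l) * root_power n (int f * (2 + int l)) * g (nat ?k)"
          by (simp add: c g_def mult_ac)
      qed
      also have "\<dots> = complex_of_real (u l) * root_power n (int f * (2 + int l)) * (\<Sum>k<n. g k)"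
        by (simp only: sum_distrib_left[symmetric] sum_residues_column[OF n])
      also have "(\<Sum>k<n. g k) = fourier n x f" by (simp add: g_def fourier_def)
      finally show "(\<Sum>j=1..n. complex_of_real (circ n x j l) * complex_of_real (u l) *
            root_power n (int f * int j))
          = complex_of_real (u l) * root_power n (int f * int l) *
            (fourier n x f * root_power n (int f * 2))"
        by (simp add: distrib_left root_power_add mult_ac)
    qed
    also have "\<dots> = fourier n u f * (fourier n x f * root_power n (int f * 2))"
      by (simp add: fourier_def sum_distrib_right)
    finally show ?thesis by (simp add: mult_ac)
  qed
  have "real n * (\<Sum>j=1..n. (y j)\<^sup>2) = (\<Sum>f<n. (cmod (?Y f))\<^sup>2)"
    by (rule parseval[OF n finite_atLeastAtMost residues_1_eq_if_dvd, symmetric])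
  also have "\<dots> = (\<Sum>f<n. (cmod (fourier n x f))\<^sup>2 * (cmod (fourier n u f))\<^sup>2)"
    by (simp only: conv norm_mult power_mult_distrib norm_root_power power_one mult_1_right)
  also have "\<dots> \<le> (\<Sum>f<n. D\<^sup>2 * (cmod (fourier n u f))\<^sup>2)"
    using D by (intro sum_mono mult_right_mono power_mono) auto
  also have "\<dots> = D\<^sup>2 * (real n * (\<Sum>l<n. (u l)\<^sup>2))"
    unfolding sum_distrib_left[symmetric] fourier_def
    by (subst parseval[OF n]) (auto dest: residues_eq_if_dvd)
  finally show ?thesis using n by (simp add: y_def mult.left_commute)
qed

lemma fourier_diff: "fourier n (\<lambda>k. x k - y k) f = fourier n x f - fourier n y f"
  by (simp add: fourier_def left_diff_distrib sum_subtractf)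

lemma norm_fourier_le: "cmod (fourier n x f) \<le> (\<Sum>k<n. \<bar>x k\<bar>)"
  unfolding fourier_def by (rule order_trans[OF norm_sum]) (simp add: norm_mult)

section \<open>Maurey's empirical method\<close>

text \<open>
  A vector of \<open>\<ell>\<^sub>1\<close>-norm at most \<open>a\<close> is \<open>a\<close> times the mean of a random signed
  coordinate vector.  The spare mass \<open>1 - \<parallel>x\<parallel>\<^sub>1 / a\<close> is spread evenly over all signed
  coordinates, where it cancels.
\<close>

lemma signed_coordinate_pmf:
  fixes x :: "nat \<Rightarrow> real"
  assumes n: "n > 0" and a: "a > 0" and x: "(\<Sum>k<n. \<bar>x k\<bar>) \<le> a"
  obtains p :: "(real \<times> nat) pmf" where
    "set_pmf p \<subseteq> {-1, 1} \<times> {..<n}"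
    "\<And>\<phi>. measure_pmf.expectation p (\<lambda>y. fst y * \<phi> (snd y)) = (\<Sum>k<n. x k * \<phi> k) / a"
proof -
  let ?A = "{-1, 1 :: real} \<times> {..<n}"
  define \<beta> where "\<beta> k = \<bar>x k\<bar> / a + (1 - (\<Sum>k<n. \<bar>x k\<bar>) / a) / n" for k
  define w where "w y = (if y \<in> ?A then (\<beta> (snd y) + fst y * x (snd y) / a) / 2 else 0)" for y
  have spare: "0 \<le> 1 - (\<Sum>k<n. \<bar>x k\<bar>) / a" using x a by (simp add: field_simps)
  have beta_sum: "(\<Sum>k<n. \<beta> k) = 1"
    using n a by (simp add: \<beta>_def sum.distrib sum_divide_distrib[symmetric])
  have beta_ge: "\<bar>x k\<bar> / a \<le> \<beta> k" for k
    using spare n unfolding \<beta>_def by simp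
  have split: "(\<Sum>y\<in>?A. h y) = (\<Sum>k<n. h (-1, k) + h (1, k))" for h :: "real \<times> nat \<Rightarrow> real"
    using sum.cartesian_product[of "\<lambda>i k. h (i, k)" "{..<n}" "{-1, 1}"]
    by (simp add: sum.distrib case_prod_unfold)
  have w0: "0 \<le> w y" for y
  proof (cases "y \<in> ?A")
    case True
    then have "\<bar>fst y * x (snd y) / a\<bar> = \<bar>x (snd y)\<bar> / a" using a by (auto simp: abs_mult)
    then have "- (fst y * x (snd y) / a) \<le> \<beta> (snd y)"
      using beta_ge[of "snd y"] by linarith
    then show ?thesis using True by (simp add: w_def)
  qed (auto simp: w_def)
  have w1: "(\<Sum>y\<in>?A. w y) = 1"
  proof -
    have "(\<Sum>y\<in>?A. w y) = (\<Sum>k<n. \<beta> k)"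
      unfolding split by (intro sum.cong) (auto simp: w_def field_simps)
    then show ?thesis using beta_sum by simp
  qed
  have nn: "(\<integral>\<^sup>+ y. ennreal (w y) \<partial>count_space UNIV) = 1"
  proof -
    have "(\<integral>\<^sup>+ y. ennreal (w y) \<partial>count_space UNIV) = (\<Sum>y\<in>?A. ennreal (w y))"
      by (intro nn_integral_count_space') (auto simp: w_def)
    also have "\<dots> = ennreal (\<Sum>y\<in>?A. w y)" by (rule sum_ennreal) (rule w0)
    finally show ?thesis by (simp add: w1)
  qed
  define p where "p = embed_pmf w"
  have pmf_p: "pmf p y = w y" for y unfolding p_def by (rule pmf_embed_pmf[OF w0 nn])
  have set_p: "set_pmf p \<subseteq> ?A" by (auto simp: set_pmf_eq pmf_p w_def split: if_splits)
  show ?thesis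
  proof (rule that[OF set_p])
    fix \<phi> :: "nat \<Rightarrow> real"
    have "measure_pmf.expectation p (\<lambda>y. fst y * \<phi> (snd y)) = (\<Sum>y\<in>?A. fst y * \<phi> (snd y) * pmf p y)"
      using set_p by (intro integral_measure_pmf_real) auto
    also have "\<dots> = (\<Sum>k<n. x k * \<phi> k / a)"
      unfolding split pmf_p by (intro sum.cong) (auto simp: w_def field_simps)
    finally show "measure_pmf.expectation p (\<lambda>y. fst y * \<phi> (snd y)) = (\<Sum>k<n. x k * \<phi> k) / a"
      by (simp add: sum_divide_distrib)
  qed
qed

text \<open>
  The average of \<open>L\<close> independent samples is close to \<open>x\<close> in each functional of \<open>F\<close> by Hoeffding's
  inequality; by the union bound some outcome is close in all of them.
\<close>

lemma maurey:
  fixes x :: "nat \<Rightarrow> real" and F :: "(nat \<Rightarrow> real) set" and L :: nat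
  assumes n: "n > 0" and a: "a > 0" and x: "(\<Sum>k<n. \<bar>x k\<bar>) \<le> a"
    and F: "finite F" "\<And>\<phi> k. \<phi> \<in> F \<Longrightarrow> k < n \<Longrightarrow> \<bar>\<phi> k\<bar> \<le> 1"
    and L: "L > 0" and t: "0 \<le> \<tau>" and union: "real (card F) * (2 * exp (- \<tau>\<^sup>2 / 2)) < 1"
  shows "\<exists>g \<in> PiE_dflt {..<L} undefined (\<lambda>_. {-1, 1 :: real} \<times> {..<n}). \<forall>\<phi>\<in>F.
    \<bar>(\<Sum>k<n. x k * \<phi> k) - a / L * (\<Sum>l<L. fst (g l) * \<phi> (snd (g l)))\<bar> \<le> \<tau> * a / sqrt L"
proof -
  obtain p where set_p: "set_pmf p \<subseteq> {-1, 1 :: real} \<times> {..<n}"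
    and mean: "\<And>\<phi>. measure_pmf.expectation p (\<lambda>y. fst y * \<phi> (snd y)) = (\<Sum>k<n. x k * \<phi> k) / a"
    using signed_coordinate_pmf[OF n a x] by metis
  let ?P = "Pi_pmf {..<L} undefined (\<lambda>_. p)"
  define E where "E \<phi> = {g. \<bar>(\<Sum>l<L. fst (g l) * \<phi> (snd (g l))) - L * ((\<Sum>k<n. x k * \<phi> k) / a)\<bar>
      > \<tau> * sqrt L}" for \<phi>
  have E: "measure_pmf.prob ?P (E \<phi>) \<le> 2 * exp (- \<tau>\<^sup>2 / 2)" if "\<phi> \<in> F" for \<phi>
    unfolding E_def
  proof (rule Pi_pmf_Hoeffding[where b = "\<lambda>_. 1"])
    show "\<bar>fst y * \<phi> (snd y)\<bar> \<le> 1" if "y \<in> set_pmf p" for y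
      using that set_p F(2)[OF \<open>\<phi> \<in> F\<close>] by (auto simp: abs_mult)
  qed (use t in \<open>auto simp: mean\<close>)
  have "measure_pmf.prob ?P (\<Union>\<phi>\<in>F. E \<phi>) \<le> (\<Sum>\<phi>\<in>F. measure_pmf.prob ?P (E \<phi>))"
    by (intro measure_pmf.finite_measure_subadditive_finite F) auto
  also have "\<dots> \<le> (\<Sum>\<phi>\<in>F. 2 * exp (- \<tau>\<^sup>2 / 2))" by (intro sum_mono E)
  also have "\<dots> < 1" using union by simp
  finally have less: "measure_pmf.prob ?P (\<Union>\<phi>\<in>F. E \<phi>) < 1" .
  have "\<not> set_pmf ?P \<subseteq> (\<Union>\<phi>\<in>F. E \<phi>)"
  proof
    assume "set_pmf ?P \<subseteq> (\<Union>\<phi>\<in>F. E \<phi>)"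
    then have "measure_pmf.prob ?P (\<Union>\<phi>\<in>F. E \<phi>) = 1"
      by (intro measure_pmf.prob_eq_1[THEN iffD2]) (auto simp: AE_measure_pmf_iff)
    then show False using less by simp
  qed
  then obtain g where g: "g \<in> set_pmf ?P" "\<And>\<phi>. \<phi> \<in> F \<Longrightarrow> g \<notin> E \<phi>" by blast
  have "g \<in> PiE_dflt {..<L} undefined (\<lambda>_. {-1, 1} \<times> {..<n})"
    using g(1) set_p by (auto simp: set_Pi_pmf PiE_dflt_def)
  moreover have "\<bar>(\<Sum>k<n. x k * \<phi> k) - a / L * (\<Sum>l<L. fst (g l) * \<phi> (snd (g l)))\<bar> \<le> \<tau> * a / sqrt L"
    if "\<phi> \<in> F" for \<phi>
  proof -
    define X where "X = (\<Sum>k<n. x k * \<phi> k)"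
    define Y where "Y = (\<Sum>l<L. fst (g l) * \<phi> (snd (g l)))"
    have "\<bar>Y - L * (X / a)\<bar> \<le> \<tau> * sqrt L"
      using g(2)[OF that] by (simp add: E_def X_def Y_def not_less)
    then have "a / L * \<bar>Y - L * (X / a)\<bar> \<le> a / L * (\<tau> * sqrt L)"
      using a by (intro mult_left_mono) auto
    moreover have "a / L * \<bar>Y - L * (X / a)\<bar> = \<bar>X - a / L * Y\<bar>"
    proof -
      have "a / L * \<bar>Y - L * (X / a)\<bar> = \<bar>a / L * (Y - L * (X / a))\<bar>"
        using a by (simp add: abs_mult)
      also have "a / L * (Y - L * (X / a)) = - (X - a / L * Y)"
        using a L by (simp add: field_simps)
      finally show ?thesis by (simp only: abs_minus_cancel)
    qed
    moreover have "a / L * (\<tau> * sqrt L) = \<tau> * a / sqrt L"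
    proof -
      have "real L = sqrt L * sqrt L" by simp
      then show ?thesis using L by (simp add: divide_simps del: real_sqrt_mult_self)
    qed
    ultimately show ?thesis by (simp add: X_def Y_def)
  qed
  ultimately show ?thesis by blast
qed

text \<open>
  The functionals are the real and imaginary parts of the \<open>n\<close> Fourier coefficients.  With
  \<open>\<tau>\<^sup>2 = 8 ln n\<close> the tail of each is \<open>2 n\<^sup>-\<^sup>4\<close>, small enough for the union bound over \<open>2n\<close> of
  them.
\<close>

lemma fourier_covering:
  assumes n: "n \<ge> 2" and a: "a > 0" and L: "L > 0"
  obtains G :: "(nat \<Rightarrow> complex) set" where "finite G" "card G \<le> (2 * n) ^ L"
    "\<And>x :: nat \<Rightarrow> real. (\<Sum>k<n. \<bar>x k\<bar>) \<le> a \<Longrightarrow>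
      \<exists>z\<in>G. \<forall>f<n. cmod (fourier n x f - z f) \<le> 6 * a * sqrt (ln n / L)"
proof -
  define \<Gamma> where "\<Gamma> = PiE_dflt {..<L} undefined (\<lambda>_. {-1, 1 :: real} \<times> {..<n})"
  define z where "z g f = of_real (a / L) * (\<Sum>l<L. of_real (fst (g l)) * root_power n (int f * int (snd (g l))))"
    for g :: "nat \<Rightarrow> real \<times> nat" and f
  define F where "F = (\<lambda>f k. Re (root_power n (int f * int k))) ` {..<n}
      \<union> (\<lambda>f k. Im (root_power n (int f * int k))) ` {..<n}"
  define \<tau> where "\<tau> = sqrt (8 * ln n)"
  have ln0: "0 < ln n" using n by simp
  have finF: "finite F" by (simp add: F_def)
  have cardF: "card F \<le> 2 * n"
    unfolding F_def
    by (rule order_trans[OF card_Un_le]) (simp add: mult_2 add_mono card_image_le[THEN order_trans])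
  have bndF: "\<bar>\<phi> k\<bar> \<le> 1" if "\<phi> \<in> F" for \<phi> k
    using that abs_Re_le_cmod[of "root_power n t" for t] abs_Im_le_cmod[of "root_power n t" for t]
    by (auto simp: F_def)
  have union: "real (card F) * (2 * exp (- \<tau>\<^sup>2 / 2)) < 1"
  proof -
    have "exp (- \<tau>\<^sup>2 / 2) = 1 / real n ^ 4"
      using ln0 n by (simp add: \<tau>_def exp_minus inverse_eq_divide exp_of_nat_mult[of 4, simplified])
    then have "real (card F) * (2 * exp (- \<tau>\<^sup>2 / 2)) \<le> (2 * real n) * (2 * (1 / real n ^ 4))"
      using cardF by (simp only:) (intro mult_right_mono, auto)
    also have "\<dots> = 4 / real n ^ 3" using n by (simp add: field_simps eval_nat_numeral)
    also have "\<dots> < 1" using power_mono[of 2 "real n" 3] n by simp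
    finally show ?thesis .
  qed
  show ?thesis
  proof (rule that[of "z ` \<Gamma>"])
    show "finite (z ` \<Gamma>)" unfolding \<Gamma>_def by (intro finite_imageI finite_PiE_dflt) auto
    have "card (z ` \<Gamma>) \<le> card \<Gamma>" unfolding \<Gamma>_def by (intro card_image_le finite_PiE_dflt) auto
    also have "\<dots> = (2 * n) ^ L"
    proof -
      have "card ({-1, 1 :: real} \<times> {..<n}) = 2 * n" by (simp add: card_cartesian_product)
      moreover have "card \<Gamma> = (\<Prod>l<L. card ({-1, 1 :: real} \<times> {..<n}))"
        unfolding \<Gamma>_def by (rule card_PiE_dflt) auto
      ultimately show ?thesis by (simp only: prod_constant card_lessThan)
    qed
    finally show "card (z ` \<Gamma>) \<le> (2 * n) ^ L" .
    fix x :: "nat \<Rightarrow> real" assume x: "(\<Sum>k<n. \<bar>x k\<bar>) \<le> a"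
    obtain g where g: "g \<in> \<Gamma>" and close: "\<And>\<phi>. \<phi> \<in> F \<Longrightarrow>
        \<bar>(\<Sum>k<n. x k * \<phi> k) - a / L * (\<Sum>l<L. fst (g l) * \<phi> (snd (g l)))\<bar> \<le> \<tau> * a / sqrt L"
    proof -
      have "n > 0" "0 \<le> \<tau>" using n ln0 by (auto simp: \<tau>_def)
      then have "\<exists>g\<in>\<Gamma>. \<forall>\<phi>\<in>F. \<bar>(\<Sum>k<n. x k * \<phi> k) - a / L * (\<Sum>l<L. fst (g l) * \<phi> (snd (g l)))\<bar>
          \<le> \<tau> * a / sqrt L"
        unfolding \<Gamma>_def by (intro maurey a x finF L union) (auto intro: bndF)
      then show ?thesis using that by blast
    qed
    have "cmod (fourier n x f - z g f) \<le> 6 * a * sqrt (ln n / L)" if f: "f < n" for f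
    proof -
      have re: "Re (fourier n x f - z g f) = (\<Sum>k<n. x k * Re (root_power n (int f * int k)))
          - a / L * (\<Sum>l<L. fst (g l) * Re (root_power n (int f * int (snd (g l)))))"
        by (simp add: fourier_def z_def)
      have im: "Im (fourier n x f - z g f) = (\<Sum>k<n. x k * Im (root_power n (int f * int k)))
          - a / L * (\<Sum>l<L. fst (g l) * Im (root_power n (int f * int (snd (g l)))))"
        by (simp add: fourier_def z_def)
      have "(\<lambda>k. Re (root_power n (int f * int k))) \<in> F" "(\<lambda>k. Im (root_power n (int f * int k))) \<in> F"
        using f by (auto simp: F_def)
      from close[OF this(1)] close[OF this(2)]
      have "\<bar>Re (fourier n x f - z g f)\<bar> \<le> \<tau> * a / sqrt L" "\<bar>Im (fourier n x f - z g f)\<bar> \<le> \<tau> * a / sqrt L"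
        unfolding re im by this+
      then have "cmod (fourier n x f - z g f) \<le> 2 * (\<tau> * a / sqrt L)"
        using cmod_le[of "fourier n x f - z g f"] by linarith
      also have "\<dots> = 2 * sqrt 8 * (a * sqrt (ln n / L))"
        by (simp add: \<tau>_def real_sqrt_mult real_sqrt_divide)
      also have "\<dots> \<le> 6 * (a * sqrt (ln n / L))"
        using a ln0 by (intro mult_right_mono) (auto intro!: real_le_lsqrt simp: field_simps)
      finally show ?thesis by simp
    qed
    then show "\<exists>y\<in>z ` \<Gamma>. \<forall>f<n. cmod (fourier n x f - y f) \<le> 6 * a * sqrt (ln n / L)"
      using g by blast
  qed
qed

text \<open>The centres of the covering are replaced by points of \<open>T\<close>, at the price of a factor two.\<close>

lemma fourier_net:
  assumes n: "n \<ge> 2" and a: "a > 0" and L: "L > 0"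
    and T: "\<And>x. x \<in> T \<Longrightarrow> (\<Sum>k<n. \<bar>x k\<bar>) \<le> a"
  obtains p :: "(nat \<Rightarrow> real) \<Rightarrow> (nat \<Rightarrow> real)" where
    "\<And>x. x \<in> T \<Longrightarrow> p x \<in> T"
    "\<And>x f. x \<in> T \<Longrightarrow> f < n \<Longrightarrow> cmod (fourier n x f - fourier n (p x) f) \<le> 12 * a * sqrt (ln n / L)"
    "card (p ` T) \<le> (2 * n) ^ L"
proof -
  obtain G :: "(nat \<Rightarrow> complex) set" where G: "finite G" "card G \<le> (2 * n) ^ L"
    and cover: "\<And>x :: nat \<Rightarrow> real. (\<Sum>k<n. \<bar>x k\<bar>) \<le> a \<Longrightarrow>
      \<exists>z\<in>G. \<forall>f<n. cmod (fourier n x f - z f) \<le> 6 * a * sqrt (ln n / L)"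
    using fourier_covering[OF n a L] by metis
  let ?near = "\<lambda>x z. \<forall>f<n. cmod (fourier n x f - z f) \<le> 6 * a * sqrt (ln n / L)"
  obtain c where c: "\<And>x. x \<in> T \<Longrightarrow> c x \<in> G \<and> ?near x (c x)"
    using cover T by metis
  define q where "q z = (SOME y. y \<in> T \<and> ?near y z)" for z
  have q: "q (c x) \<in> T \<and> ?near (q (c x)) (c x)" if "x \<in> T" for x
    unfolding q_def using someI[of "\<lambda>y. y \<in> T \<and> ?near y (c x)" x] c[OF that] that by blast
  show ?thesis
  proof (rule that[of "\<lambda>x. q (c x)"])
    show "q (c x) \<in> T" if "x \<in> T" for x using q[OF that] by blast
    show "cmod (fourier n x f - fourier n (q (c x)) f) \<le> 12 * a * sqrt (ln n / L)"
      if "x \<in> T" "f < n" for x f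
    proof -
      have "cmod (fourier n x f - c x f) \<le> 6 * a * sqrt (ln n / L)"
        "cmod (fourier n (q (c x)) f - c x f) \<le> 6 * a * sqrt (ln n / L)"
        using q c that by blast+
      then show ?thesis
        using norm_triangle_ineq4[of "fourier n x f - c x f" "fourier n (q (c x)) f - c x f"] by simp
    qed
    have "card ((\<lambda>x. q (c x)) ` T) \<le> card (q ` G)"
      using c G by (intro card_mono) auto
    also have "\<dots> \<le> card G" using G by (intro card_image_le)
    finally show "card ((\<lambda>x. q (c x)) ` T) \<le> (2 * n) ^ L" using G by simp
  qed
qed

section \<open>Moments and norms of partial circulant matrices\<close>

context finite_chaos begin

lemma sign_mean_len_sq: "sign_mean J (\<lambda>\<epsilon>. (len A \<epsilon>)\<^sup>2) = (\<Sum>i\<in>I. \<Sum>j\<in>J. (A i j)\<^sup>2)"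
proof -
  have "sign_mean J (\<lambda>\<epsilon>. (len A \<epsilon>)\<^sup>2)
      = sign_mean J (\<lambda>\<epsilon>. \<Sum>i\<in>I. \<Sum>j\<in>J. \<Sum>k\<in>J. (A i j * A i k) * (\<epsilon> j * \<epsilon> k))"
    by (intro sign_mean_cong) (simp add: len_sq ip_def app_def sum_product mult_ac)
  also have "\<dots> = (\<Sum>i\<in>I. \<Sum>j\<in>J. \<Sum>k\<in>J. (A i j * A i k) * of_bool (j = k))"
    by (simp add: sign_mean_sum sign_mean_cmult sign_mean_product finite_cols)
  also have "\<dots> = (\<Sum>i\<in>I. \<Sum>j\<in>J. (A i j)\<^sup>2)"
    using finite_cols by (simp add: power2_eq_square sum.delta' if_distrib of_bool_def cong: if_cong)
  finally show ?thesis .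
qed

end

lemma circ_diff: "circ n (\<lambda>k. x k - y k) j l = circ n x j l - circ n y j l"
  by (simp add: circ_def)

lemma sum_circ_row_sq: "n > 0 \<Longrightarrow> (\<Sum>l<n. (circ n x j l)\<^sup>2) = (\<Sum>k<n. (x k)\<^sup>2)"
  unfolding circ_def by (rule sum_residues_row[where g = "\<lambda>k. (x k)\<^sup>2"])

lemma abs_circ_row_le:
  assumes n: "n > 0" and e: "\<epsilon> \<in> signs {..<n}"
  shows "\<bar>\<Sum>l<n. circ n x j l * \<epsilon> l\<bar> \<le> (\<Sum>k<n. \<bar>x k\<bar>)"
proof -
  have "\<bar>\<Sum>l<n. circ n x j l * \<epsilon> l\<bar> \<le> (\<Sum>l<n. \<bar>circ n x j l\<bar>)"
  proof (rule order_trans[OF sum_abs], rule sum_mono)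
    fix l assume "l \<in> {..<n}"
    then show "\<bar>circ n x j l * \<epsilon> l\<bar> \<le> \<bar>circ n x j l\<bar>"
      using signs_in[OF e, of l] by auto
  qed
  also have "\<dots> = (\<Sum>k<n. \<bar>x k\<bar>)"
    unfolding circ_def by (rule sum_residues_row[where g = "\<lambda>k. \<bar>x k\<bar>", OF n])
  finally show ?thesis .
qed

locale circulant_rows =
  fixes n m :: nat and \<Omega> :: "nat set"
  assumes Omega: "\<Omega> \<subseteq> {1..n}" and card_Omega: "card \<Omega> = m" and m: "m > 0"
begin

lemma n_pos: "n > 0"
  using Omega card_Omega m by (cases "n = 0") auto

lemma finite_Omega: "finite \<Omega>"
  using Omega finite_subset by blast

lemma m_le_n: "m \<le> n"
  using card_mono[OF _ Omega] card_Omega by simp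

sublocale finite_chaos \<Omega> "{..<n}"
  by unfold_locales (auto simp: finite_Omega)

text \<open>The matrix \<open>V x\<close> with \<open>V x \<epsilon> = \<Phi> x\<close>.\<close>

definition rip_mat :: "(nat \<Rightarrow> real) \<Rightarrow> nat \<Rightarrow> nat \<Rightarrow> real" where
  "rip_mat x j l = circ n x j l / sqrt m"

lemma app_rip_mat: "app (rip_mat x) u j = (\<Sum>l<n. circ n x j l * u l) / sqrt m"
  by (simp add: app_def rip_mat_def sum_divide_distrib)

lemma len_rip_mat_sq: "(len (rip_mat x) u)\<^sup>2 = (\<Sum>j\<in>\<Omega>. (\<Sum>l<n. circ n x j l * u l)\<^sup>2) / m"
proof -
  have "(len (rip_mat x) u)\<^sup>2 = (\<Sum>j\<in>\<Omega>. ((\<Sum>l<n. circ n x j l * u l) / sqrt m)\<^sup>2)"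
    unfolding len_sq ip_def app_rip_mat by (simp only: power2_eq_square)
  also have "\<dots> = (\<Sum>j\<in>\<Omega>. (\<Sum>l<n. circ n x j l * u l)\<^sup>2 / m)"
    by (simp only: power_divide real_sqrt_pow2[OF of_nat_0_le_iff])
  finally show ?thesis by (simp only: sum_divide_distrib)
qed

lemma sign_mean_rip_mat: "sign_mean {..<n} (\<lambda>\<epsilon>. (len (rip_mat x) \<epsilon>)\<^sup>2) = (\<Sum>k<n. (x k)\<^sup>2)"
  using m by (simp add: sign_mean_len_sq rip_mat_def power_divide sum_divide_distrib[symmetric]
      sum_circ_row_sq n_pos card_Omega)

lemma op_bound_rip_mat:
  assumes D: "\<And>f. f < n \<Longrightarrow> cmod (fourier n x f - fourier n y f) \<le> D"
  shows "op_bound (\<lambda>j l. rip_mat x j l - rip_mat y j l) (D / sqrt m)"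
  unfolding op_bound_def
proof
  fix u :: "nat \<Rightarrow> real"
  have D0: "0 \<le> D" using D[OF n_pos] norm_ge_zero order_trans by blast
  let ?d = "\<lambda>k. x k - y k"
  have "(\<lambda>j l. rip_mat x j l - rip_mat y j l) = rip_mat ?d"
    by (simp add: fun_eq_iff rip_mat_def circ_diff diff_divide_distrib)
  moreover have "(len (rip_mat ?d) u)\<^sup>2 \<le> (D / sqrt m * L2_set u {..<n})\<^sup>2"
  proof -
    have "(\<Sum>j\<in>\<Omega>. (\<Sum>l<n. circ n ?d j l * u l)\<^sup>2) \<le> (\<Sum>j=1..n. (\<Sum>l<n. circ n ?d j l * u l)\<^sup>2)"
      using Omega by (intro sum_mono2) auto
    also have "\<dots> \<le> D\<^sup>2 * (\<Sum>l<n. (u l)\<^sup>2)"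
      by (rule circ_norm_le[OF n_pos]) (simp add: fourier_diff D)
    finally show ?thesis
      using m by (simp add: len_rip_mat_sq power_mult_distrib power_divide L2_set_def sum_nonneg
          divide_right_mono)
  qed
  then have "len (rip_mat ?d) u \<le> D / sqrt m * L2_set u {..<n}"
    by (rule power2_le_imp_le) (use D0 in auto)
  ultimately show "len (\<lambda>j l. rip_mat x j l - rip_mat y j l) u \<le> D / sqrt m * L2_set u {..<n}"
    by simp
qed

lemma len_rip_mat_sq_le:
  assumes e: "\<epsilon> \<in> signs {..<n}"
  shows "(len (rip_mat x) \<epsilon>)\<^sup>2 \<le> (\<Sum>k<n. \<bar>x k\<bar>)\<^sup>2"
proof -
  have "(\<Sum>j\<in>\<Omega>. (\<Sum>l<n. circ n x j l * \<epsilon> l)\<^sup>2) \<le> (\<Sum>j\<in>\<Omega>. (\<Sum>k<n. \<bar>x k\<bar>)\<^sup>2)"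
    using abs_circ_row_le[OF n_pos e] by (intro sum_mono) (simp add: abs_le_square_iff[symmetric] sum_nonneg)
  then show ?thesis using m by (simp add: len_rip_mat_sq card_Omega divide_simps mult.commute)
qed

end

section \<open>A finite grid of sparse vectors\<close>

definition sparse_ball :: "nat \<Rightarrow> nat \<Rightarrow> (nat \<Rightarrow> real) set" where
  "sparse_ball n s = {x. (\<forall>k\<ge>n. x k = 0) \<and> card {k. x k \<noteq> 0} \<le> s \<and> (\<Sum>k<n. (x k)\<^sup>2) \<le> 1}"

definition sparse_grid :: "nat \<Rightarrow> nat \<Rightarrow> nat \<Rightarrow> (nat \<Rightarrow> real) set" where
  "sparse_grid n s K = {x \<in> sparse_ball n s. \<forall>k. \<exists>i::int. x k = i / K}"

lemma sparse_ball_support: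
  assumes "x \<in> sparse_ball n s"
  shows "{k. x k \<noteq> 0} \<subseteq> {..<n}" "finite {k. x k \<noteq> 0}"
proof -
  show "{k. x k \<noteq> 0} \<subseteq> {..<n}" using assms by (auto simp: sparse_ball_def) (meson not_less)
  then show "finite {k. x k \<noteq> 0}" using finite_subset by blast
qed

lemma sparse_ball_abs_le_1:
  assumes "x \<in> sparse_ball n s"
  shows "\<bar>x k\<bar> \<le> 1"
proof (cases "k < n")
  case True
  then have "(x k)\<^sup>2 \<le> (\<Sum>k<n. (x k)\<^sup>2)" by (intro member_le_sum) auto
  also have "\<dots> \<le> 1" using assms by (simp add: sparse_ball_def)
  finally show ?thesis by (simp add: abs_square_le_1)
qed (use assms in \<open>simp add: sparse_ball_def\<close>)

lemma sum_restrict_support: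
  assumes "x \<in> sparse_ball n s" "\<And>k. x k = 0 \<Longrightarrow> g k = (0::real)"
  shows "(\<Sum>k<n. g k) = (\<Sum>k\<in>{k. x k \<noteq> 0}. g k)"
  using sparse_ball_support[OF assms(1)] assms(2) by (intro sum.mono_neutral_right) auto

lemma sparse_ball_l1_le:
  assumes x: "x \<in> sparse_ball n s"
  shows "(\<Sum>k<n. \<bar>x k\<bar>) \<le> sqrt s"
proof -
  let ?S = "{k. x k \<noteq> 0}"
  have "(\<Sum>k<n. \<bar>x k\<bar>) = (\<Sum>k\<in>?S. \<bar>1\<bar> * \<bar>x k\<bar>)"
    by (simp add: sum_restrict_support[OF x])
  also have "\<dots> \<le> L2_set (\<lambda>_. 1) ?S * L2_set x ?S"
    by (rule L2_set_mult_ineq)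
  also have "\<dots> \<le> sqrt s * 1"
  proof (rule mult_mono)
    show "L2_set (\<lambda>_. 1) ?S \<le> sqrt s" using x by (simp add: L2_set_def sparse_ball_def)
    have "L2_set x ?S = sqrt (\<Sum>k<n. (x k)\<^sup>2)"
      unfolding L2_set_def by (subst sum_restrict_support[OF x]) auto
    also have "\<dots> \<le> 1" using x by (simp add: sparse_ball_def)
    finally show "L2_set x ?S \<le> 1" .
  qed auto
  finally show ?thesis by simp
qed

text \<open>
  A grid vector is determined by a list of \<open>s\<close> positions that contains its support and by its
  values there, of which there are at most \<open>2K + 1\<close>.
\<close>

lemma sparse_grid_card:
  assumes n: "n > 0" and K: "K > 0"
  shows "finite (sparse_grid n s K)" "card (sparse_grid n s K) \<le> (n * (2 * K + 1)) ^ s"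
proof -
  define G where "G = (\<lambda>i. real_of_int i / K) ` {- int K..int K}"
  define XS where "XS = {xs. set xs \<subseteq> {..<n} \<and> length xs = s}"
  have finG: "finite G" by (simp add: G_def)
  have cardG: "card G \<le> 2 * K + 1"
    unfolding G_def by (rule order_trans[OF card_image_le]) auto
  have G0: "card G > 0" using finG by (auto simp: card_gt_0_iff G_def)
  have finXS: "finite XS" unfolding XS_def by (rule finite_lists_length_eq) simp
  have cardXS: "card XS = n ^ s" unfolding XS_def by (subst card_lists_length_eq) auto
  let ?U = "\<Union>xs\<in>XS. PiE_dflt (set xs) 0 (\<lambda>_. G)"
  have finU: "finite ?U" using finXS finG by (intro finite_UN_I finite_PiE_dflt) auto
  have sub: "sparse_grid n s K \<subseteq> ?U"
  proof
    fix x assume xg: "x \<in> sparse_grid n s K"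
    then have x: "x \<in> sparse_ball n s" and gr: "\<And>k. \<exists>i::int. x k = i / K"
      by (auto simp: sparse_grid_def)
    let ?S = "{k. x k \<noteq> 0}"
    have S: "?S \<subseteq> {..<n}" "finite ?S" by (rule sparse_ball_support[OF x])+
    have cs: "card ?S \<le> s" using x by (simp add: sparse_ball_def)
    \<comment> \<open>The support is listed with repetitions of index \<open>0\<close> so that all lists have length \<open>s\<close>.\<close>
    define xs where "xs = sorted_list_of_set ?S @ replicate (s - card ?S) 0"
    have "length xs = s" using cs by (simp add: xs_def)
    moreover have setxs: "?S \<subseteq> set xs" "set xs \<subseteq> {..<n}" using S n by (auto simp: xs_def)
    moreover have "x k \<in> G" for k
    proof -
      obtain i :: int where i: "x k = i / K" using gr by blast
      have "\<bar>real_of_int i\<bar> \<le> real K" using sparse_ball_abs_le_1[OF x, of k] K by (simp add: i)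
      then have "i \<in> {- int K..int K}" by (auto simp: abs_le_iff)
      then show ?thesis unfolding G_def i by blast
    qed
    then have "x \<in> PiE_dflt (set xs) 0 (\<lambda>_. G)" using setxs by (auto simp: PiE_dflt_def)
    ultimately show "x \<in> ?U" by (auto simp: XS_def)
  qed
  show "finite (sparse_grid n s K)" by (rule finite_subset[OF sub finU])
  have "card (sparse_grid n s K) \<le> card ?U" by (rule card_mono[OF finU sub])
  also have "\<dots> \<le> (\<Sum>xs\<in>XS. card (PiE_dflt (set xs) (0::real) (\<lambda>_. G)))"
    by (rule card_UN_le[OF finXS])
  also have "\<dots> \<le> (\<Sum>xs\<in>XS. card G ^ s)"
  proof (rule sum_mono)
    fix xs assume "xs \<in> XS"
    then have "card (set xs) \<le> s" using card_length[of xs] by (simp add: XS_def)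
    then show "card (PiE_dflt (set xs) (0::real) (\<lambda>_. G)) \<le> card G ^ s"
      using G0 finG by (simp add: card_PiE_dflt power_increasing)
  qed
  also have "\<dots> = (n * card G) ^ s" by (simp add: cardXS power_mult_distrib)
  also have "\<dots> \<le> (n * (2 * K + 1)) ^ s" using cardG by (intro power_mono mult_left_mono) auto
  finally show "card (sparse_grid n s K) \<le> (n * (2 * K + 1)) ^ s" .
qed

text \<open>Rounding towards zero stays inside the ball and does not enlarge the support.\<close>

definition grid_round :: "nat \<Rightarrow> real \<Rightarrow> real" where
  "grid_round K t = sgn t * real_of_int \<lfloor>\<bar>t\<bar> * K\<rfloor> / K"

lemma grid_round_0 [simp]: "grid_round K 0 = 0"
  by (simp add: grid_round_def)

lemma abs_grid_round_le:
  assumes "K > 0"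
  shows "\<bar>grid_round K t\<bar> \<le> \<bar>t\<bar>"
proof -
  have "\<bar>grid_round K t\<bar> = \<bar>sgn t\<bar> * (real_of_int \<lfloor>\<bar>t\<bar> * K\<rfloor> / K)"
    by (simp add: grid_round_def abs_mult)
  also have "\<dots> \<le> 1 * (real_of_int \<lfloor>\<bar>t\<bar> * K\<rfloor> / K)"
    by (intro mult_right_mono) (auto simp: sgn_if)
  also have "\<dots> \<le> 1 * (\<bar>t\<bar> * K / K)" by (intro mult_left_mono divide_right_mono of_int_floor_le) auto
  finally show ?thesis using assms by simp
qed

lemma grid_round_close:
  assumes "K > 0"
  shows "\<bar>t - grid_round K t\<bar> \<le> 1 / K"
proof -
  let ?F = "real_of_int \<lfloor>\<bar>t\<bar> * K\<rfloor>"
  have "t - grid_round K t = sgn t * ((\<bar>t\<bar> * K - ?F) / K)"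
    using assms by (simp add: grid_round_def field_simps abs_mult_sgn)
  then have "\<bar>t - grid_round K t\<bar> = \<bar>sgn t\<bar> * (\<bar>\<bar>t\<bar> * K - ?F\<bar> / K)" by (simp add: abs_mult)
  also have "\<dots> \<le> 1 * (1 / K)"
  proof (intro mult_mono divide_right_mono)
    show "\<bar>\<bar>t\<bar> * K - ?F\<bar> \<le> 1" by linarith
  qed (auto simp: sgn_if)
  finally show ?thesis by simp
qed

lemma grid_round_in_grid: "\<exists>i::int. grid_round K t = i / K"
proof -
  have "grid_round K t = real_of_int (\<lfloor>sgn t\<rfloor> * \<lfloor>\<bar>t\<bar> * K\<rfloor>) / K"
    by (auto simp: grid_round_def sgn_if)
  then show ?thesis by blast
qed

lemma grid_round_sparse_grid:
  assumes x: "x \<in> sparse_ball n s" and K: "K > 0"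
  shows "(\<lambda>k. grid_round K (x k)) \<in> sparse_grid n s K"
proof -
  have "card {k. grid_round K (x k) \<noteq> 0} \<le> card {k. x k \<noteq> 0}"
    using sparse_ball_support(2)[OF x] by (intro card_mono) auto
  moreover have "(\<Sum>k<n. (grid_round K (x k))\<^sup>2) \<le> (\<Sum>k<n. (x k)\<^sup>2)"
    using abs_grid_round_le[OF K] by (intro sum_mono) (simp add: abs_le_square_iff)
  ultimately show ?thesis
    using x grid_round_in_grid[of K] by (auto simp: sparse_grid_def sparse_ball_def)
qed

context circulant_rows begin

text \<open>
  Every row of \<open>V x\<close> has the \<open>\<ell>\<^sub>1\<close>-norm of \<open>x\<close> divided by \<open>\<surd>m\<close>, so a change of \<open>x\<close> that is small
  in \<open>\<ell>\<^sub>1\<close> changes \<open>\<parallel>V x \<epsilon>\<parallel>\<^sup>2\<close> little, whatever the signs are.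
\<close>

lemma deviation_grid_round:
  assumes x: "x \<in> sparse_ball n s" and K: "K > 0" and e: "\<epsilon> \<in> signs {..<n}"
  defines "y \<equiv> (\<lambda>k. grid_round K (x k))"
  shows "\<bar>(len (rip_mat x) \<epsilon>)\<^sup>2 - (\<Sum>k<n. (x k)\<^sup>2)\<bar>
    \<le> \<bar>(len (rip_mat y) \<epsilon>)\<^sup>2 - (\<Sum>k<n. (y k)\<^sup>2)\<bar> + 4 * (real s)\<^sup>2 / K"
proof -
  have y: "y \<in> sparse_ball n s"
    using grid_round_sparse_grid[OF x K] by (simp add: y_def sparse_grid_def)
  have sS: "card {k. x k \<noteq> 0} \<le> s" using x by (simp add: sparse_ball_def)
  have l1: "(\<Sum>k<n. \<bar>z k\<bar>) \<le> s" if "z \<in> sparse_ball n s" for z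
  proof -
    have "real s \<le> (real s)\<^sup>2" by (cases s) (auto simp: power2_eq_square algebra_simps)
    then have "sqrt s \<le> s" by (intro real_le_lsqrt) auto
    then show ?thesis using sparse_ball_l1_le[OF that] by linarith
  qed
  have d1: "(\<Sum>k<n. \<bar>x k - y k\<bar>) \<le> s / K"
  proof -
    have "(\<Sum>k<n. \<bar>x k - y k\<bar>) = (\<Sum>k\<in>{k. x k \<noteq> 0}. \<bar>x k - y k\<bar>)"
      by (intro sum_restrict_support[OF x]) (simp add: y_def)
    also have "\<dots> \<le> card {k. x k \<noteq> 0} * (1 / K)"
      unfolding y_def by (intro sum_bounded_above grid_round_close K)
    also have "\<dots> \<le> s * (1 / K)" using sS by (intro mult_right_mono) auto
    finally show ?thesis by simp
  qed
  have sq: "\<bar>a\<^sup>2 - b\<^sup>2\<bar> \<le> s / K * (2 * real s)"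
    if "\<bar>a - b\<bar> \<le> s / K" "\<bar>a\<bar> \<le> s" "\<bar>b\<bar> \<le> s" for a b :: real
  proof -
    have "\<bar>a\<^sup>2 - b\<^sup>2\<bar> = \<bar>a - b\<bar> * \<bar>a + b\<bar>" by (simp add: power2_eq_square square_diff_square_factored abs_mult mult.commute)
    also have "\<dots> \<le> s / K * (2 * real s)" using that by (intro mult_mono) auto
    finally show ?thesis .
  qed
  have "\<bar>(len (rip_mat x) \<epsilon>)\<^sup>2 - (len (rip_mat y) \<epsilon>)\<^sup>2\<bar> \<le> s / K * (2 * real s)"
  proof -
    let ?r = "\<lambda>x j. \<Sum>l<n. circ n x j l * \<epsilon> l"
    have row: "\<bar>(?r x j)\<^sup>2 - (?r y j)\<^sup>2\<bar> \<le> s / K * (2 * real s)" for j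
    proof (rule sq)
      have "?r x j - ?r y j = ?r (\<lambda>k. x k - y k) j"
        by (simp add: circ_diff left_diff_distrib sum_subtractf)
      then show "\<bar>?r x j - ?r y j\<bar> \<le> s / K"
        using abs_circ_row_le[OF n_pos e, of "\<lambda>k. x k - y k" j] d1 by simp
      show "\<bar>?r x j\<bar> \<le> s" "\<bar>?r y j\<bar> \<le> s"
        using abs_circ_row_le[OF n_pos e] l1 x y order_trans by blast+
    qed
    have "(len (rip_mat x) \<epsilon>)\<^sup>2 - (len (rip_mat y) \<epsilon>)\<^sup>2 = (\<Sum>j\<in>\<Omega>. (?r x j)\<^sup>2 - (?r y j)\<^sup>2) / m"
      by (simp add: len_rip_mat_sq sum_subtractf diff_divide_distrib)
    then have "\<bar>(len (rip_mat x) \<epsilon>)\<^sup>2 - (len (rip_mat y) \<epsilon>)\<^sup>2\<bar> = \<bar>\<Sum>j\<in>\<Omega>. (?r x j)\<^sup>2 - (?r y j)\<^sup>2\<bar> / m"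
      by simp
    also have "\<dots> \<le> (\<Sum>j\<in>\<Omega>. s / K * (2 * real s)) / m"
      by (intro divide_right_mono order_trans[OF sum_abs] sum_mono row) auto
    also have "\<dots> = s / K * (2 * real s)" using m by (simp add: card_Omega)
    finally show ?thesis .
  qed
  moreover have "\<bar>(\<Sum>k<n. (x k)\<^sup>2) - (\<Sum>k<n. (y k)\<^sup>2)\<bar> \<le> s / K * (2 * real s)"
  proof -
    have "\<bar>(\<Sum>k<n. (x k)\<^sup>2) - (\<Sum>k<n. (y k)\<^sup>2)\<bar> \<le> (\<Sum>k<n. \<bar>(x k)\<^sup>2 - (y k)\<^sup>2\<bar>)"
      by (simp add: sum_subtractf[symmetric])
    also have "\<dots> \<le> (\<Sum>k<n. \<bar>x k - y k\<bar> * 2)"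
    proof (rule sum_mono)
      fix k
      have "\<bar>(x k)\<^sup>2 - (y k)\<^sup>2\<bar> = \<bar>x k - y k\<bar> * \<bar>x k + y k\<bar>"
        by (simp add: power2_eq_square square_diff_square_factored abs_mult mult.commute)
      also have "\<dots> \<le> \<bar>x k - y k\<bar> * 2"
        using sparse_ball_abs_le_1[OF x, of k] sparse_ball_abs_le_1[OF y, of k]
        by (intro mult_left_mono) auto
      finally show "\<bar>(x k)\<^sup>2 - (y k)\<^sup>2\<bar> \<le> \<bar>x k - y k\<bar> * 2" .
    qed
    also have "\<dots> \<le> s / K * 2" unfolding sum_distrib_right[symmetric] using d1 by (intro mult_right_mono) auto
    also have "\<dots> \<le> s / K * (2 * real s)"
    proof (cases "s = 0")
      case False
      then show ?thesis by (intro mult_left_mono) auto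
    qed simp
    finally show ?thesis .
  qed
  moreover have "4 * (real s)\<^sup>2 / K = s / K * (2 * real s) + s / K * (2 * real s)"
    by (simp add: power2_eq_square)
  ultimately show ?thesis by linarith
qed

end

section \<open>The chain of nets for sparse vectors\<close>

lemma ln_ge_two_thirds:
  assumes "n \<ge> (2::nat)"
  shows "2 / 3 \<le> ln (real n)"
  using ln2_ge_two_thirds ln_le_cancel_iff[of 2 "real n"] assms by linarith

text \<open>
  The first level consists of the zero vector.  Level \<open>r \<ge> 1\<close> is a Maurey net with \<open>L = 4\<^sup>r\<^sup>-\<^sup>1 \<lceil>ln n\<rceil>\<close> sample points.  Its
  mesh is proportional to \<open>2\<^sup>-\<^sup>r\<close> and the logarithm of its size to \<open>4\<^sup>r\<close>, so
  that all levels contribute equally to the entropy sum.  Once \<open>4\<^sup>r\<close> reaches \<open>s\<close>, the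
  whole grid is no larger than such a net, and the chain stops there after about
  \<open>log\<^sub>4 s\<close> levels.
\<close>

lemma sparse_grid_chain:
  assumes n: "n \<ge> 2" and s: "2 \<le> s" "s \<le> n"
  defines "T \<equiv> sparse_grid n s (n ^ 4)"
  obtains p R where
    "\<And>r x. x \<in> T \<Longrightarrow> r \<le> R \<Longrightarrow> p r x \<in> T"
    "\<And>x. x \<in> T \<Longrightarrow> p R x = x"
    "\<And>x. x \<in> T \<Longrightarrow> p 0 x = (\<lambda>_. 0)"
    "\<And>r x f. x \<in> T \<Longrightarrow> r \<le> R \<Longrightarrow> f < n \<Longrightarrow>
       cmod (fourier n x f - fourier n (p r x) f) \<le> 24 * sqrt s / 2 ^ r"
    "\<And>r. r \<le> R \<Longrightarrow> real (card (p r ` T)) \<le> exp (3 * 4 ^ r * (ln n)\<^sup>2)"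
    "real R \<le> 4 * ln s"
proof -
  define l where "l = nat \<lceil>ln (real n)\<rceil>"
  have ln23: "2 / 3 \<le> ln (real n)" "2 / 3 \<le> ln (real s)"
    using ln_ge_two_thirds n s by auto
  then have ln_pos: "0 < ln (real n)" by linarith
  have l_lower: "ln n \<le> l" unfolding l_def by linarith
  have l_upper: "real l \<le> 3 * ln n"
  proof -
    have "real l \<le> ln n + 1" unfolding l_def using ln_pos by linarith
    then show ?thesis using ln23 by linarith
  qed
  have l_pos: "l > 0" using l_lower ln_pos by (cases l) auto
  have l1: "(\<Sum>k<n. \<bar>x k\<bar>) \<le> sqrt s" if "x \<in> T" for x
    using that sparse_ball_l1_le by (simp add: T_def sparse_grid_def)
  have zero: "(\<lambda>_. 0) \<in> T"
    unfolding T_def sparse_grid_def sparse_ball_def by (auto intro!: exI[of _ 0])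
  have "\<exists>p. (\<forall>x\<in>T. p x \<in> T \<and> (\<forall>f<n. cmod (fourier n x f - fourier n (p x) f)
      \<le> 12 * sqrt s * sqrt (ln n / real (4 ^ q * l)))) \<and> card (p ` T) \<le> (2 * n) ^ (4 ^ q * l)" for q
    by (rule fourier_net[where n = n and a = "sqrt s" and T = T and L = "4 ^ q * l"])
      (use n s l_pos l1 in auto)
  then obtain P where P_in: "\<And>q x. x \<in> T \<Longrightarrow> P q x \<in> T"
    and P_close: "\<And>q x f. x \<in> T \<Longrightarrow> f < n \<Longrightarrow> cmod (fourier n x f - fourier n (P q x) f)
      \<le> 12 * sqrt s * sqrt (ln n / real (4 ^ q * l))"
    and P_card: "\<And>q. card (P q ` T) \<le> (2 * n) ^ (4 ^ q * l)"
    by metis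
  define R0 where "R0 = nat \<lceil>log 4 s\<rceil>"
  have log4: "0 \<le> log 4 (real s)" using s by simp
  have R0_le: "real R0 \<le> log 4 s + 1" unfolding R0_def using log4 by linarith
  have s_le: "real s \<le> 4 ^ R0"
  proof -
    have "real s = 4 powr log 4 s" using s by simp
    also have "\<dots> \<le> 4 powr R0" unfolding R0_def by (intro powr_mono) (linarith, simp)
    finally show ?thesis by (simp add: powr_realpow)
  qed
  define R where "R = Suc R0"
  define p where "p r = (if r = 0 then (\<lambda>_ _. 0) else if r \<le> R0 then P (r - 1) else (\<lambda>x. x))" for r
  have R_le: "real R \<le> 4 * ln s"
  proof -
    have "ln 4 = 2 * ln (2::real)" using ln_realpow[of 2 2] by simp
    then have "4 / 3 \<le> ln (4::real)" using ln2_ge_two_thirds by linarith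
    then have "log 4 s \<le> ln s / (4 / 3)"
      unfolding log_def using ln23 by (intro divide_left_mono) auto
    then show ?thesis using R0_le ln23 by (simp add: R_def)
  qed
  show ?thesis
  proof (rule that[of R p])
    show "p r x \<in> T" if "x \<in> T" "r \<le> R" for r x
      using that P_in zero by (auto simp: p_def)
    show "p R x = x" for x by (simp add: p_def R_def)
    show "p 0 x = (\<lambda>_. 0)" for x by (simp add: p_def)
    show "cmod (fourier n x f - fourier n (p r x) f) \<le> 24 * sqrt s / 2 ^ r"
      if x: "x \<in> T" and "r \<le> R" and f: "f < n" for r x f
    proof (cases r)
      case 0
      have "fourier n (\<lambda>_. 0) f = 0" by (simp add: fourier_def)
      then have "cmod (fourier n x f - fourier n (p r x) f) \<le> sqrt s"
        using norm_fourier_le[of n x f] l1[OF x] 0 by (simp add: p_def)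
      also have "\<dots> \<le> 24 * sqrt s" using real_sqrt_ge_zero[of "real s"] by simp
      finally show ?thesis using 0 by simp
    next
      case (Suc q)
      show ?thesis
      proof (cases "r \<le> R0")
        case True
        have "sqrt (ln n / real (4 ^ q * l)) \<le> sqrt (1 / 4 ^ q)"
          using l_lower l_pos by (intro real_sqrt_le_mono) (simp add: field_simps)
        also have "\<dots> = 1 / 2 ^ q"
        proof -
          have "(4::real) ^ q = (2 ^ 2) ^ q" by simp
          also have "\<dots> = (2 ^ q)\<^sup>2" by (simp only: power_mult[symmetric] mult.commute)
          finally have "(4::real) ^ q = (2 ^ q)\<^sup>2" .
          then show ?thesis by (simp add: real_sqrt_divide)
        qed
        finally have "12 * sqrt s * sqrt (ln n / real (4 ^ q * l)) \<le> 12 * sqrt s * (1 / 2 ^ q)"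
          by (intro mult_left_mono) auto
        moreover have "12 * sqrt s * (1 / 2 ^ q) = 24 * sqrt s / 2 ^ r" using Suc by simp
        moreover have "p r x = P q x" using Suc True by (simp add: p_def)
        ultimately show ?thesis using P_close[OF x f, of q] by simp
      next
        case False
        then show ?thesis using Suc by (simp add: p_def)
      qed
    qed
    show "real (card (p r ` T)) \<le> exp (3 * 4 ^ r * (ln n)\<^sup>2)" if r: "r \<le> R" for r
    proof (cases r)
      case 0
      have "card (p r ` T) \<le> card {\<lambda>_ :: nat. 0 :: real}"
        using 0 by (intro card_mono) (auto simp: p_def)
      then have "real (card (p r ` T)) \<le> 1" by simp
      also have "\<dots> \<le> exp (3 * 4 ^ r * (ln n)\<^sup>2)" by simp
      finally show ?thesis .
    next
      case (Suc q)
      show ?thesis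
      proof (cases "r \<le> R0")
        case True
        have "ln (2 * real n) \<le> 2 * ln n"
          using ln_mult[of 2 "real n"] n by (simp add: ln_le_cancel_iff)
        have "p r = P q" using Suc True by (simp add: p_def)
        then have "real (card (p r ` T)) \<le> real ((2 * n) ^ (4 ^ q * l))"
          using P_card[of q] by (simp only: of_nat_le_iff)
        also have "\<dots> = exp (real (4 ^ q * l) * ln (2 * real n))"
          using n by (subst exp_of_nat_mult) simp
        also have "\<dots> \<le> exp (3 * 4 ^ r * (ln n)\<^sup>2)"
        proof (subst exp_le_cancel_iff)
          have "real (4 ^ q * l) * ln (2 * real n) \<le> (4 ^ q * (3 * ln n)) * (2 * ln n)"
            using l_upper \<open>ln (2 * real n) \<le> 2 * ln n\<close> n by (intro mult_mono) auto
          also have "\<dots> = 6 * 4 ^ q * (ln n)\<^sup>2" by (simp add: power2_eq_square)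
          also have "\<dots> \<le> 12 * 4 ^ q * (ln n)\<^sup>2" by (intro mult_right_mono) auto
          also have "\<dots> = 3 * 4 ^ r * (ln n)\<^sup>2" using Suc by simp
          finally show "real (4 ^ q * l) * ln (2 * real n) \<le> 3 * 4 ^ r * (ln n)\<^sup>2" .
        qed
        finally show ?thesis .
      next
        case False
        then have rR: "r = Suc R0" using r by (simp add: R_def)
        have "real (2 * n ^ 4 + 1) \<le> real n ^ 6"
        proof -
          have "4 \<le> real n ^ 2" using n power_mono[of 2 "real n" 2] by simp
          then have "4 * real n ^ 4 \<le> real n ^ 2 * real n ^ 4" by (intro mult_right_mono) auto
          moreover have "1 \<le> real n ^ 4" using n by (intro one_le_power) simp
          ultimately show ?thesis by (simp add: power_add[symmetric])
        qed
        then have "real n * real (2 * n ^ 4 + 1) \<le> real n * real n ^ 6" by (intro mult_left_mono) auto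
        then have base: "real (n * (2 * n ^ 4 + 1)) \<le> real n ^ 7"
          by (simp only: of_nat_mult power_Suc[symmetric]) simp
        have "real (card (p r ` T)) = real (card T)" using False rR by (simp add: p_def)
        also have "\<dots> \<le> real ((n * (2 * n ^ 4 + 1)) ^ s)"
          unfolding T_def of_nat_le_iff by (rule sparse_grid_card(2)) (use n in auto)
        also have "\<dots> \<le> (real n ^ 7) ^ s"
          unfolding of_nat_power by (intro power_mono base) simp
        also have "\<dots> = exp (real (7 * s) * ln n)"
          using n by (subst exp_of_nat_mult) (simp add: power_mult)
        also have "\<dots> \<le> exp (3 * 4 ^ r * (ln n)\<^sup>2)"
        proof (subst exp_le_cancel_iff)
          have "real (7 * s) * ln n \<le> 12 * real s * (2 / 3) * ln n"
            using ln_pos by (intro mult_right_mono) auto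
          also have "\<dots> \<le> 12 * 4 ^ R0 * ln n * ln n"
            using s_le ln23 ln_pos by (intro mult_right_mono mult_mono) auto
          also have "\<dots> = 3 * 4 ^ r * (ln n)\<^sup>2" using rR by (simp add: power2_eq_square)
          finally show "real (7 * s) * ln n \<le> 3 * 4 ^ r * (ln n)\<^sup>2" .
        qed
        finally show ?thesis .
      qed
    qed
    show "real R \<le> 4 * ln s" by (rule R_le)
  qed
qed

context circulant_rows begin

text \<open>
  The sample size forces \<open>\<delta>\<close> to be at least \<open>16 / n\<close>, so that \<open>1 / \<delta>\<close> is harmless
  among factors polynomial in \<open>n\<close>.
\<close>

lemma delta_n_ge:
  fixes \<delta> :: real
  assumes n: "n \<ge> 2" and s: "2 \<le> s" "s \<le> n" and d: "0 < \<delta>" "\<delta> < 1"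
    and large: "10 ^ 12 * real s * (ln s)\<^sup>2 * (ln n)\<^sup>2 \<le> \<delta>\<^sup>2 * m"
  shows "16 \<le> \<delta> * n"
proof -
  have ln23: "2 / 3 \<le> ln (real n)" "2 / 3 \<le> ln (real s)" using ln_ge_two_thirds n s by auto
  have "10 ^ 12 * 2 * (2 / 3)\<^sup>2 * (2 / 3)\<^sup>2 \<le> 10 ^ 12 * real s * (ln s)\<^sup>2 * (ln n)\<^sup>2"
    using ln23 s by (intro mult_mono power_mono) auto
  then have "16 \<le> 10 ^ 12 * real s * (ln s)\<^sup>2 * (ln n)\<^sup>2"
    by (rule order_trans[rotated]) (simp add: power2_eq_square)
  also note large
  also have "\<delta>\<^sup>2 * m \<le> \<delta>\<^sup>2 * n" using m_le_n by (intro mult_left_mono) auto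
  also have "\<dots> \<le> \<delta> * n" using d by (intro mult_right_mono) (auto simp: power2_eq_square)
  finally show ?thesis .
qed

text \<open>
  The choice of the parameters of the chain.  The nets at levels \<open>r\<close> and \<open>r + 1\<close> have together at most
  \<open>exp (15 * 4\<^sup>r (ln n)\<^sup>2)\<close> pairs of points, which the first summand in \<open>(\<tau> r)\<^sup>2 / 2\<close> pays for.  The
  second summand \<open>h\<close> leaves a probability of at most \<open>4 exp (- h)\<close> per level, and its part \<open>15 ln n\<close>
  absorbs all factors polynomial in \<open>n\<close>.  As \<open>ln n \<le> 27/8 * A\<^sup>2\<close>, it does not change the order of
  \<open>\<surd>h\<close>, and since \<open>\<Delta> r\<close> decays geometrically, \<open>h\<close> contributes only once to the entropy sum.
  That sum is at most \<open>1656 * \<rho> * A\<close>; the constant \<open>10\<^sup>1\<^sup>2\<close> makes \<open>\<rho> * A\<close> at most \<open>10\<^sup>-\<^sup>6 * \<delta>\<close>.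
\<close>

lemma sparse_grid_deviation_tail:
  fixes \<delta> :: real
  assumes n: "n \<ge> 2" and s: "2 \<le> s" "s \<le> n" and d: "0 < \<delta>" "\<delta> < 1"
    and large: "10 ^ 12 * real s * (ln s)\<^sup>2 * (ln n)\<^sup>2 \<le> \<delta>\<^sup>2 * m"
  shows "sign_mean {..<n} (\<lambda>\<epsilon>. of_bool (\<exists>x \<in> sparse_grid n s (n ^ 4).
      \<bar>(len (rip_mat x) \<epsilon>)\<^sup>2 - (\<Sum>k<n. (x k)\<^sup>2)\<bar> > \<delta> / 4))
    \<le> exp (- (ln n * ln s)\<^sup>2)"
proof -
  define T where "T = sparse_grid n s (n ^ 4)"
  define A where "A = ln n * ln s"
  define h where "h = 15 * ln n + A\<^sup>2"
  have ln23: "2 / 3 \<le> ln (real n)" "2 / 3 \<le> ln (real s)" using ln_ge_two_thirds n s by auto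
  have A_ge: "4 / 9 \<le> A" using mult_mono[OF ln23] ln23 by (simp add: A_def)
  have ln_le_A: "ln n \<le> 27 / 8 * A\<^sup>2"
  proof -
    have "(2 / 3 :: real) ^ 2 \<le> (ln s)\<^sup>2" using ln23 by (intro power_mono) auto
    then have "2 / 3 * (4 / 9) \<le> ln n * (ln s)\<^sup>2"
      using ln23 by (intro mult_mono) (auto simp: power2_eq_square)
    then have "1 * ln n \<le> (27 / 8 * (ln n * (ln s)\<^sup>2)) * ln n"
      using ln23 by (intro mult_right_mono) auto
    then show ?thesis by (simp add: A_def power2_eq_square mult_ac)
  qed
  have h0: "0 \<le> h" using ln23 by (simp add: h_def)
  have sqrt_h: "sqrt (2 * h) \<le> 11 * A"
  proof (rule real_le_lsqrt)
    have "2 * h \<le> 30 * (27 / 8 * A\<^sup>2) + 2 * A\<^sup>2" using ln_le_A by (simp add: h_def)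
    also have "\<dots> \<le> 121 * A\<^sup>2" by simp
    finally show "2 * h \<le> (11 * A)\<^sup>2" by (simp add: power_mult_distrib)
  qed (use A_ge in simp)
  define \<rho> where "\<rho> = sqrt (s / m)"
  have rho0: "0 \<le> \<rho>" by (simp add: \<rho>_def)
  have rho_A: "10 ^ 6 * (\<rho> * A) \<le> \<delta>"
  proof -
    have "(10 ^ 6 * (\<rho> * A))\<^sup>2 = 10 ^ 12 * real s * (ln s)\<^sup>2 * (ln n)\<^sup>2 / m"
      by (simp add: \<rho>_def A_def power_mult_distrib)
    also have "\<dots> \<le> \<delta>\<^sup>2 * m / m" using large by (intro divide_right_mono) auto
    also have "\<dots> = \<delta>\<^sup>2" using m by simp
    finally have "(10 ^ 6 * (\<rho> * A))\<^sup>2 \<le> \<delta>\<^sup>2" .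
    then show ?thesis by (rule power2_le_imp_le) (rule less_imp_le[OF d(1)])
  qed
  obtain p R where
    p_in: "\<And>r x. x \<in> T \<Longrightarrow> r \<le> R \<Longrightarrow> p r x \<in> T" and
    p_last: "\<And>x. x \<in> T \<Longrightarrow> p R x = x" and
    p_first: "\<And>x. x \<in> T \<Longrightarrow> p 0 x = (\<lambda>_. 0)" and
    p_close: "\<And>r x f. x \<in> T \<Longrightarrow> r \<le> R \<Longrightarrow> f < n \<Longrightarrow>
       cmod (fourier n x f - fourier n (p r x) f) \<le> 24 * sqrt s / 2 ^ r" and
    p_card: "\<And>r. r \<le> R \<Longrightarrow> real (card (p r ` T)) \<le> exp (3 * 4 ^ r * (ln n)\<^sup>2)" and
    R_le: "real R \<le> 4 * ln s"
    by (rule sparse_grid_chain[OF n s, folded T_def]) (rule that)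
  have finT: "finite T" unfolding T_def by (rule sparse_grid_card(1)) (use n in auto)
  have neT: "T \<noteq> {}"
  proof -
    have "(\<lambda>_. 0) \<in> sparse_grid n s (n ^ 4)"
      unfolding sparse_grid_def sparse_ball_def by (auto intro!: exI[of _ 0])
    then show ?thesis by (auto simp: T_def)
  qed
  have in_ball: "x \<in> sparse_ball n s" if "x \<in> T" for x using that by (simp add: T_def sparse_grid_def)
  define \<Delta> where "\<Delta> r = 36 * \<rho> / 2 ^ r" for r :: nat
  define \<tau> where "\<tau> r = sqrt (2 * (15 * 4 ^ r * (ln n)\<^sup>2 + h))" for r :: nat
  define \<gamma> where "\<gamma> = \<delta> / 68"
  have entropy: "(\<Sum>r<R. \<tau> r * \<Delta> r) \<le> \<gamma>"
  proof -
    have summand: "\<tau> r * \<Delta> r \<le> 36 * \<rho> * (6 * ln n + 11 * A * (1 / 2) ^ r)" for r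
    proof -
      have "\<tau> r \<le> sqrt (30 * 4 ^ r * (ln n)\<^sup>2) + sqrt (2 * h)"
        unfolding \<tau>_def using h0 by (intro order_trans[OF _ sqrt_add_le_add_sqrt]) auto
      also have "sqrt (30 * 4 ^ r * (ln n)\<^sup>2) \<le> 6 * 2 ^ r * ln n"
      proof (rule real_le_lsqrt)
        have "(6 * 2 ^ r * ln n)\<^sup>2 = 36 * 4 ^ r * (ln n)\<^sup>2"
          by (simp add: power_mult_distrib power2_eq_square[of "2 ^ r"] power_mult_distrib[symmetric])
        then show "30 * 4 ^ r * (ln n)\<^sup>2 \<le> (6 * 2 ^ r * ln n)\<^sup>2"
          by (simp add: mult_right_mono)
      qed (use ln23 in simp)
      finally have "\<tau> r \<le> 6 * 2 ^ r * ln n + 11 * A" using sqrt_h by linarith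
      then have "\<tau> r * \<Delta> r \<le> (6 * 2 ^ r * ln n + 11 * A) * \<Delta> r"
        unfolding \<Delta>_def using rho0 by (intro mult_right_mono) auto
      also have "\<dots> = 36 * \<rho> * (6 * ln n + 11 * A * (1 / 2) ^ r)"
        by (simp add: \<Delta>_def field_simps power_divide)
      finally show ?thesis .
    qed
    have geo: "(\<Sum>r<R. (1 / 2 :: real) ^ r) \<le> 2" by (simp add: sum_gp_strict)
    have "(\<Sum>r<R. \<tau> r * \<Delta> r) \<le> (\<Sum>r<R. 36 * \<rho> * (6 * ln n + 11 * A * (1 / 2) ^ r))"
      by (intro sum_mono summand)
    also have "\<dots> = 36 * \<rho> * (R * (6 * ln n) + 11 * A * (\<Sum>r<R. (1 / 2) ^ r))"
      by (simp add: sum_distrib_left[symmetric] sum.distrib)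
    also have "\<dots> \<le> 36 * \<rho> * (4 * ln s * (6 * ln n) + 11 * A * 2)"
      using geo rho0 A_ge ln23 R_le by (intro mult_left_mono add_mono mult_right_mono) auto
    also have "\<dots> = 1656 * (\<rho> * A)" by (simp add: A_def algebra_simps)
    also have "\<dots> \<le> \<gamma>" using rho_A rho0 A_ge d by (simp add: \<gamma>_def)
    finally show ?thesis .
  qed
  interpret C: chaos_chain \<Omega> "{..<n}" T rip_mat p R \<Delta> \<tau> \<gamma> "(real s)\<^sup>2"
  proof unfold_locales
    show "finite T" "T \<noteq> {}" by (fact finT, fact neT)
    show "p r x \<in> T" if "x \<in> T" "r \<le> R" for r x using that by (rule p_in)
    show "p R x = x" if "x \<in> T" for x using that by (rule p_last)
    show "rip_mat (p 0 x) j l = 0" if "x \<in> T" for x j l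
      by (simp add: p_first that rip_mat_def circ_def)
    show "op_bound (\<lambda>i j. rip_mat (p (Suc r) x) i j - rip_mat (p r x) i j) (\<Delta> r)"
      if x: "x \<in> T" and r: "r < R" for x r
    proof -
      have "cmod (fourier n (p (Suc r) x) f - fourier n (p r x) f) \<le> 36 * sqrt s / 2 ^ r"
        if f: "f < n" for f
      proof -
        let ?a = "fourier n x f - fourier n (p r x) f"
        let ?b = "fourier n x f - fourier n (p (Suc r) x) f"
        have "cmod (?a - ?b) \<le> cmod ?a + cmod ?b" by (rule norm_triangle_ineq4)
        also have "\<dots> \<le> 24 * sqrt s / 2 ^ r + 24 * sqrt s / 2 ^ Suc r"
          using x r f by (intro add_mono p_close) auto
        also have "\<dots> = 36 * sqrt s / 2 ^ r" by (simp add: field_simps)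
        finally show ?thesis by simp
      qed
      from op_bound_rip_mat[OF this] show ?thesis
        by (simp add: \<Delta>_def \<rho>_def real_sqrt_divide field_simps)
    qed
    show "0 \<le> \<Delta> r" "0 \<le> \<tau> r" for r using rho0 h0 by (auto simp: \<Delta>_def \<tau>_def)
    show "(\<Sum>r<R. \<tau> r * \<Delta> r) \<le> \<gamma>" by (rule entropy)
    show "sign_mean {..<n} (\<lambda>\<epsilon>. (len (rip_mat x) \<epsilon>)\<^sup>2) \<le> 1" if "x \<in> T" for x
      using in_ball[OF that] by (simp add: sign_mean_rip_mat sparse_ball_def)
    show "(len (rip_mat x) \<epsilon>)\<^sup>2 \<le> (real s)\<^sup>2" if "x \<in> T" "\<epsilon> \<in> signs {..<n}" for x \<epsilon>
    proof -
      have "real s \<le> (real s)\<^sup>2" using s by (simp add: power2_eq_square)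
      then have "sqrt s \<le> s" by (intro real_le_lsqrt) auto
      then have "(\<Sum>k<n. \<bar>x k\<bar>) \<le> s" using sparse_ball_l1_le[OF in_ball[OF that(1)]] by linarith
      then have "(\<Sum>k<n. \<bar>x k\<bar>)\<^sup>2 \<le> (real s)\<^sup>2" by (intro power_mono) (auto intro: sum_nonneg)
      then show ?thesis using len_rip_mat_sq_le[OF that(2), of x] by linarith
    qed
  qed
  have gam: "0 < \<gamma>" "\<gamma> \<le> 1 / 16" using d by (auto simp: \<gamma>_def)
  have exc: "C.exception_prob \<le> 4 * R * exp (- h)"
  proof -
    have "4 * real (card ((\<lambda>x. (p r x, p (Suc r) x)) ` T)) * exp (- (\<tau> r)\<^sup>2 / 2) \<le> 4 * exp (- h)"
      if r: "r < R" for r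
    proof -
      have "card ((\<lambda>x. (p r x, p (Suc r) x)) ` T) \<le> card ((p r ` T) \<times> (p (Suc r) ` T))"
        using finT by (intro card_mono) auto
      then have "real (card ((\<lambda>x. (p r x, p (Suc r) x)) ` T))
          \<le> real (card (p r ` T)) * real (card (p (Suc r) ` T))"
        unfolding card_cartesian_product of_nat_mult[symmetric] by (simp only: of_nat_le_iff)
      also have "\<dots> \<le> exp (3 * 4 ^ r * (ln n)\<^sup>2) * exp (3 * 4 ^ Suc r * (ln n)\<^sup>2)"
        using r by (intro mult_mono p_card) auto
      also have "\<dots> = exp (15 * 4 ^ r * (ln n)\<^sup>2)"
        unfolding exp_add[symmetric] by (rule arg_cong[where f = exp]) simp
      finally have "real (card ((\<lambda>x. (p r x, p (Suc r) x)) ` T)) * exp (- (\<tau> r)\<^sup>2 / 2)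
          \<le> exp (15 * 4 ^ r * (ln n)\<^sup>2) * exp (- (\<tau> r)\<^sup>2 / 2)"
        by (rule mult_right_mono) simp
      also have "\<dots> = exp (- h)"
      proof -
        have "(\<tau> r)\<^sup>2 = 2 * (15 * 4 ^ r * (ln n)\<^sup>2 + h)"
          unfolding \<tau>_def using h0 by (intro real_sqrt_pow2) auto
        then have "15 * 4 ^ r * (ln n)\<^sup>2 + - (\<tau> r)\<^sup>2 / 2 = - h" by (simp add: field_simps)
        then show ?thesis by (simp only: exp_add[symmetric])
      qed
      finally show ?thesis by simp
    qed
    then have "C.exception_prob \<le> (\<Sum>r<R. 4 * exp (- h))"
      unfolding C.exception_prob_def by (intro sum_mono) auto
    then show ?thesis by simp
  qed
  have inv_d: "1 / \<delta> \<le> n"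
    using delta_n_ge[OF n s d large] d by (simp add: field_simps)
  have main: "(real s)\<^sup>2 * C.exception_prob / \<gamma> \<le> exp (- A\<^sup>2)"
  proof -
    have "real R \<le> 4 * n"
    proof -
      have "ln (real s) \<le> s" using s ln_bound[of "real s"] by simp
      then show ?thesis using R_le s by linarith
    qed
    then have "C.exception_prob \<le> 4 * (4 * real n) * exp (- h)"
      using exc by (elim order_trans) (intro mult_right_mono mult_left_mono, auto)
    then have "(real s)\<^sup>2 * C.exception_prob \<le> (real n)\<^sup>2 * (4 * (4 * real n) * exp (- h))"
      using s C.exception_prob_def by (intro mult_mono power_mono) (auto intro!: sum_nonneg simp: C.exception_prob_def)
    then have "(real s)\<^sup>2 * C.exception_prob * (68 * (1 / \<delta>)) \<le> ((real n)\<^sup>2 * (4 * (4 * real n) * exp (- h))) * (68 * real n)"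
    proof (rule mult_mono)
      show "68 * (1 / \<delta>) \<le> 68 * real n" using inv_d by (intro mult_left_mono) auto
    qed (use d in auto)
    also have "\<dots> = (1088 * real n ^ 4) * exp (- h)" by (simp add: eval_nat_numeral)
    also have "\<dots> \<le> (real n ^ 11 * real n ^ 4) * exp (- h)"
      using power_mono[of 2 "real n" 11] n by (intro mult_right_mono) auto
    also have "\<dots> = exp (15 * ln n) * exp (- h)"
      using n exp_of_nat_mult[of 15 "ln (real n)"] by (simp add: power_add[symmetric])
    also have "\<dots> = exp (- A\<^sup>2)" by (simp add: exp_add[symmetric] h_def)
    finally show ?thesis by (simp add: \<gamma>_def)
  qed
  have "(real s)\<^sup>2 * C.exception_prob \<le> 1"
  proof -
    have "(real s)\<^sup>2 * C.exception_prob \<le> exp (- A\<^sup>2) * \<gamma>" using main gam by (simp add: field_simps)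
    also have "\<dots> \<le> 1 * 1" using gam by (intro mult_mono) auto
    finally show ?thesis by simp
  qed
  from C.deviation_tail[OF gam this] main
  show ?thesis by (simp add: sign_mean_rip_mat \<gamma>_def T_def A_def)
qed

end

section \<open>The restricted isometry property\<close>

context circulant_rows begin

lemma len_rip_mat_scale: "(len (rip_mat (\<lambda>k. c * a k)) \<epsilon>)\<^sup>2 = c\<^sup>2 * (len (rip_mat a) \<epsilon>)\<^sup>2"
proof -
  have "(\<Sum>l<n. circ n (\<lambda>k. c * a k) j l * \<epsilon> l) = c * (\<Sum>l<n. circ n a j l * \<epsilon> l)" for j
    by (simp add: circ_def sum_distrib_left mult.assoc)
  then show ?thesis
    by (simp add: len_rip_mat_sq power_mult_distrib sum_distrib_left[symmetric])
qed

text \<open>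
  By homogeneity \<open>a\<close> may be normalised and then rounded to the grid; with mesh \<open>n\<^sup>-\<^sup>4\<close> the
  rounding error \<open>4 s\<^sup>2 / n\<^sup>4\<close> is at most \<open>\<delta> / 4\<close>.
\<close>

lemma sparse_isometry_of_grid:
  fixes \<delta> :: real
  assumes e: "\<epsilon> \<in> signs {..<n}" and s: "s \<le> n" and d: "0 < \<delta>" and nd: "16 \<le> \<delta> * n"
    and grid: "\<And>y. y \<in> sparse_grid n s (n ^ 4) \<Longrightarrow>
      \<bar>(len (rip_mat y) \<epsilon>)\<^sup>2 - (\<Sum>k<n. (y k)\<^sup>2)\<bar> \<le> \<delta> / 4"
    and a: "\<forall>k\<ge>n. a k = 0" "card {k. a k \<noteq> 0} \<le> s"
  shows "\<bar>(len (rip_mat a) \<epsilon>)\<^sup>2 - (\<Sum>k<n. (a k)\<^sup>2)\<bar> \<le> \<delta> * (\<Sum>k<n. (a k)\<^sup>2)"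
proof (cases "(\<Sum>k<n. (a k)\<^sup>2) = 0")
  case True
  then have "a k = 0" for k using a(1) by (cases "k < n") (auto simp: sum_nonneg_eq_0_iff)
  then show ?thesis using True by (simp add: len_rip_mat_sq circ_def)
next
  case False
  define N where "N = (\<Sum>k<n. (a k)\<^sup>2)"
  have N: "N > 0" using False by (simp add: N_def order_less_le sum_nonneg)
  define x where "x = (\<lambda>k. (1 / sqrt N) * a k)"
  have Nx: "(\<Sum>k<n. (x k)\<^sup>2) = 1"
    using N by (simp add: x_def power_divide sum_divide_distrib[symmetric]) (simp add: N_def)
  have "{k. x k \<noteq> 0} = {k. a k \<noteq> 0}" using N by (simp add: x_def)
  then have x: "x \<in> sparse_ball n s" using a Nx by (simp add: sparse_ball_def) (simp add: x_def)
  have n4: "n ^ 4 > 0" using n_pos by simp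
  have "\<bar>(len (rip_mat x) \<epsilon>)\<^sup>2 - (\<Sum>k<n. (x k)\<^sup>2)\<bar> \<le> \<delta> / 4 + 4 * (real s)\<^sup>2 / real (n ^ 4)"
    using deviation_grid_round[OF x n4 e] grid[OF grid_round_sparse_grid[OF x n4]] by linarith
  also have "4 * (real s)\<^sup>2 / real (n ^ 4) \<le> \<delta> / 4"
  proof -
    have "16 * (real s)\<^sup>2 \<le> (\<delta> * n) * (real n)\<^sup>2"
      using nd s by (intro mult_mono power_mono) auto
    also have "\<dots> \<le> (\<delta> * n) * (real n)\<^sup>2 * n"
      using mult_left_mono[of 1 "real n" "(\<delta> * n) * (real n)\<^sup>2"] n_pos d by simp
    finally show ?thesis using n_pos by (simp add: field_simps eval_nat_numeral)
  qed
  finally have "\<bar>(len (rip_mat x) \<epsilon>)\<^sup>2 - 1\<bar> \<le> \<delta>" using d by (simp add: Nx)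
  moreover have "(len (rip_mat x) \<epsilon>)\<^sup>2 = (1 / sqrt N)\<^sup>2 * (len (rip_mat a) \<epsilon>)\<^sup>2"
    unfolding x_def by (rule len_rip_mat_scale)
  moreover have "(1 / sqrt N)\<^sup>2 = 1 / N" using N by (simp add: power_divide)
  ultimately have "\<bar>(len (rip_mat a) \<epsilon>)\<^sup>2 / N - 1\<bar> \<le> \<delta>" by simp
  then have "N * \<bar>(len (rip_mat a) \<epsilon>)\<^sup>2 / N - 1\<bar> \<le> N * \<delta>" using N by (intro mult_left_mono) auto
  moreover have "N * \<bar>(len (rip_mat a) \<epsilon>)\<^sup>2 / N - 1\<bar> = \<bar>N * ((len (rip_mat a) \<epsilon>)\<^sup>2 / N - 1)\<bar>"
    using N by (simp add: abs_mult)
  moreover have "N * ((len (rip_mat a) \<epsilon>)\<^sup>2 / N - 1) = (len (rip_mat a) \<epsilon>)\<^sup>2 - N"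
    using N by (simp add: right_diff_distrib)
  ultimately show ?thesis by (simp add: N_def mult.commute)
qed

lemma partial_circulant_mat_index:
  assumes i: "i < m" and k: "k < n"
  shows "partial_circulant_mat \<Omega> (vec n \<epsilon>) $$ (i, k)
    = \<epsilon> (nat ((int (sorted_list_of_set \<Omega> ! i) - 2 - int k) mod int n)) / sqrt m"
proof -
  let ?w = "sorted_list_of_set \<Omega> ! i"
  let ?C = "circulant_mat (vec n \<epsilon>)"
  let ?R = "restriction_mat n \<Omega> :: real mat"
  have w: "?w \<in> \<Omega>"
    using i finite_Omega card_Omega
    by (metis nth_mem set_sorted_list_of_set length_sorted_list_of_set)
  then have w1: "1 \<le> ?w" "?w \<le> n" using Omega by auto
  have C: "?C \<in> carrier_mat n n" by (simp add: circulant_mat_def Let_def)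
  have R: "?R \<in> carrier_mat m n"
    by (simp add: restriction_mat_def card_Omega)
  have "(?R * ?C) $$ (i, k) = (?R *\<^sub>v col ?C k) $ i"
  proof -
    have "i < dim_row (?R)" "k < dim_col ?C" using i k C R by auto
    then show ?thesis by simp
  qed
  also have "\<dots> = entry (col ?C k) ?w"
    using i col_carrier_vec[OF k C] Omega
    by (subst restriction_mat_mult_vec[where n = n]) (auto simp: card_Omega)
  also have "\<dots> = ?C $$ (?w - 1, k)"
    using w1 k C by (simp add: entry_def)
  also have "\<dots> = \<epsilon> (nat ((int ?w - int (k + 1) - 1) mod int n))"
  proof -
    have "nat ((int ?w - int (k + 1) - 1) mod int n) < n"
      using n_pos by (simp add: nat_less_iff)
    then show ?thesis
      using w1 k by (simp add: circulant_mat_def Let_def entry_def cyclic_sub_def)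
  qed
  also have "int ?w - int (k + 1) - 1 = int ?w - 2 - int k" by simp
  finally have RC: "(?R * ?C) $$ (i, k) = \<epsilon> (nat ((int ?w - 2 - int k) mod int n))" .
  have P: "partial_circulant_mat \<Omega> (vec n \<epsilon>) = (1 / sqrt m) \<cdot>\<^sub>m (?R * ?C)"
    by (simp add: partial_circulant_mat_def card_Omega)
  have "i < dim_row (?R * ?C)" "k < dim_col (?R * ?C)" using i k C R by auto
  then have "((1 / sqrt m) \<cdot>\<^sub>m (?R * ?C)) $$ (i, k) = (1 / sqrt m) * (?R * ?C) $$ (i, k)"
    by (rule index_smult_mat(1))
  then show ?thesis unfolding P RC by (simp only: times_divide_eq_left mult_1)
qed

lemma partial_circulant_mat_carrier: "partial_circulant_mat \<Omega> (vec n \<epsilon>) \<in> carrier_mat m n"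
  by (rule carrier_matI)
    (simp_all add: partial_circulant_mat_def restriction_mat_def circulant_mat_def Let_def card_Omega)

text \<open>Convolution is commutative, so the matrix generated by \<open>a\<close> may act on the signs instead.\<close>

lemma sum_circ_commute:
  "(\<Sum>k<n. \<epsilon> (nat ((int j - 2 - int k) mod int n)) * a k) = (\<Sum>l<n. circ n a j l * \<epsilon> l)"
proof -
  let ?t = "\<lambda>k. nat ((int j - 2 - int k) mod int n)"
  have "?t (?t k) = k" if "k < n" for k
  proof -
    have "int (?t (?t k)) = (int j - 2 - (int j - 2 - int k) mod int n) mod int n"
      using n_pos by simp
    also have "\<dots> = int k mod int n" by (simp add: mod_diff_right_eq)
    finally show ?thesis using that by simp
  qed
  then have "(\<Sum>k<n. \<epsilon> (?t k) * a k) = (\<Sum>k<n. \<epsilon> (?t k) * a (?t (?t k)))"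
    by (intro sum.cong) auto
  also have "\<dots> = (\<Sum>l<n. \<epsilon> l * a (?t l))"
    by (rule sum_residues_row[OF n_pos, where g = "\<lambda>l. \<epsilon> l * a (?t l)"])
  finally show ?thesis by (simp add: circ_def mult.commute)
qed

lemma norm2_partial_circulant_mat:
  assumes x: "x \<in> carrier_vec n"
  defines "a \<equiv> \<lambda>k. if k < n then Re (x $ k) else 0" and "b \<equiv> \<lambda>k. if k < n then Im (x $ k) else 0"
  shows "(norm2 (map_mat complex_of_real (partial_circulant_mat \<Omega> (vec n \<epsilon>)) *\<^sub>v x))\<^sup>2
    = (len (rip_mat a) \<epsilon>)\<^sup>2 + (len (rip_mat b) \<epsilon>)\<^sup>2"
proof -
  let ?A = "map_mat complex_of_real (partial_circulant_mat \<Omega> (vec n \<epsilon>))"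
  let ?w = "\<lambda>i. sorted_list_of_set \<Omega> ! i"
  have A: "?A \<in> carrier_mat m n" using partial_circulant_mat_carrier by simp
  define r where "r a j = (\<Sum>l<n. circ n a j l * \<epsilon> l) / sqrt m" for a j
  have row: "(cmod ((?A *\<^sub>v x) $ i))\<^sup>2 = (r a (?w i))\<^sup>2 + (r b (?w i))\<^sup>2" if i: "i < m" for i
  proof -
    have "(?A *\<^sub>v x) $ i = (\<Sum>k<n. ?A $$ (i, k) * x $ k)"
      using i A x by (simp add: scalar_prod_def atLeast0LessThan)
    also have "\<dots> = (\<Sum>k<n. complex_of_real
        (\<epsilon> (nat ((int (?w i) - 2 - int k) mod int n)) / sqrt m) * x $ k)"
      using i A partial_circulant_mat_carrier[of \<epsilon>]
      by (intro sum.cong refl) (simp add: partial_circulant_mat_index)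
    finally have z: "(?A *\<^sub>v x) $ i = (\<Sum>k<n. complex_of_real
        (\<epsilon> (nat ((int (?w i) - 2 - int k) mod int n)) / sqrt m) * x $ k)" .
    have "Re ((?A *\<^sub>v x) $ i) = r a (?w i)"
      unfolding z r_def sum_circ_commute[symmetric] sum_divide_distrib Re_sum
      by (intro sum.cong) (auto simp: a_def)
    moreover have "Im ((?A *\<^sub>v x) $ i) = r b (?w i)"
      unfolding z r_def sum_circ_commute[symmetric] sum_divide_distrib Im_sum
      by (intro sum.cong) (auto simp: b_def)
    ultimately show ?thesis by (simp add: cmod_power2)
  qed
  have sl: "distinct (sorted_list_of_set \<Omega>)" "length (sorted_list_of_set \<Omega>) = m"
    "set (sorted_list_of_set \<Omega>) = \<Omega>"
    using finite_Omega by (auto simp: card_Omega)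
  have bij: "bij_betw ?w {..<m} \<Omega>" by (rule bij_betw_nth) (use sl in auto)
  have "(norm2 (?A *\<^sub>v x))\<^sup>2 = (\<Sum>j=1..m. (cmod ((?A *\<^sub>v x) $ (j - 1)))\<^sup>2)"
    using A by (simp add: norm2_sq entry_def)
  also have "\<dots> = (\<Sum>i<m. (cmod ((?A *\<^sub>v x) $ i))\<^sup>2)"
    by (rule sum.reindex_bij_witness[of _ Suc "\<lambda>j. j - 1"]) auto
  also have "\<dots> = (\<Sum>i<m. (r a (?w i))\<^sup>2 + (r b (?w i))\<^sup>2)"
    by (intro sum.cong) (auto simp: row)
  also have "\<dots> = (\<Sum>j\<in>\<Omega>. (r a j)\<^sup>2 + (r b j)\<^sup>2)"
    by (rule sum.reindex_bij_betw[OF bij])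
  also have "\<dots> = (len (rip_mat a) \<epsilon>)\<^sup>2 + (len (rip_mat b) \<epsilon>)\<^sup>2"
  proof -
    have "(r c j)\<^sup>2 = (\<Sum>l<n. circ n c j l * \<epsilon> l)\<^sup>2 / m" for c j
      by (simp only: r_def power_divide real_sqrt_pow2[OF of_nat_0_le_iff])
    then show ?thesis by (simp only: sum.distrib len_rip_mat_sq sum_divide_distrib)
  qed
  finally show ?thesis .
qed

text \<open>
  The matrix is real, so it acts separately on real and imaginary parts, both of which are as
  sparse as the complex vector.
\<close>

lemma restricted_isometry_of_real:
  assumes iso: "\<And>a. \<forall>k\<ge>n. a k = 0 \<Longrightarrow> card {k. a k \<noteq> 0} \<le> s \<Longrightarrow>
      \<bar>(len (rip_mat a) \<epsilon>)\<^sup>2 - (\<Sum>k<n. (a k)\<^sup>2)\<bar> \<le> \<delta> * (\<Sum>k<n. (a k)\<^sup>2)"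
  shows "restricted_isometry_bound (map_mat complex_of_real (partial_circulant_mat \<Omega> (vec n \<epsilon>))) s \<delta>"
  unfolding restricted_isometry_bound_def
proof (intro ballI impI)
  let ?A = "map_mat complex_of_real (partial_circulant_mat \<Omega> (vec n \<epsilon>))"
  fix x :: "complex vec" assume "x \<in> carrier_vec (dim_col ?A)" and sp: "sparse s x"
  then have x: "x \<in> carrier_vec n" using partial_circulant_mat_carrier[of \<epsilon>] by simp
  define a where "a = (\<lambda>k. if k < n then Re (x $ k) else 0)"
  define b where "b = (\<lambda>k. if k < n then Im (x $ k) else 0)"
  have supp: "card {k. k < n \<and> x $ k \<noteq> 0} \<le> s"
  proof -
    have "Suc ` {k. k < n \<and> x $ k \<noteq> 0} \<subseteq> {j \<in> {1..dim_vec x}. entry x j \<noteq> 0}"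
      using x by (auto simp: entry_def)
    then have "card (Suc ` {k. k < n \<and> x $ k \<noteq> 0}) \<le> card {j \<in> {1..dim_vec x}. entry x j \<noteq> 0}"
      by (intro card_mono) auto
    then show ?thesis using sp by (simp add: card_image sparse_def)
  qed
  have zero: "\<forall>k\<ge>n. a k = 0" "\<forall>k\<ge>n. b k = 0" by (simp_all add: a_def b_def)
  have card_supp: "card {k. a k \<noteq> 0} \<le> s" "card {k. b k \<noteq> 0} \<le> s"
  proof -
    have "{k. a k \<noteq> 0} \<subseteq> {k. k < n \<and> x $ k \<noteq> 0}" "{k. b k \<noteq> 0} \<subseteq> {k. k < n \<and> x $ k \<noteq> 0}"
      by (auto simp: a_def b_def split: if_splits)
    then have "card {k. a k \<noteq> 0} \<le> card {k. k < n \<and> x $ k \<noteq> 0}"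
      "card {k. b k \<noteq> 0} \<le> card {k. k < n \<and> x $ k \<noteq> 0}"
      by (simp_all add: card_mono)
    then show "card {k. a k \<noteq> 0} \<le> s" "card {k. b k \<noteq> 0} \<le> s" using supp by simp_all
  qed
  have "\<bar>(len (rip_mat a) \<epsilon>)\<^sup>2 - (\<Sum>k<n. (a k)\<^sup>2)\<bar> \<le> \<delta> * (\<Sum>k<n. (a k)\<^sup>2)"
    "\<bar>(len (rip_mat b) \<epsilon>)\<^sup>2 - (\<Sum>k<n. (b k)\<^sup>2)\<bar> \<le> \<delta> * (\<Sum>k<n. (b k)\<^sup>2)"
    by (rule iso[OF zero(1) card_supp(1)], rule iso[OF zero(2) card_supp(2)])
  moreover have "(norm2 x)\<^sup>2 = (\<Sum>k<n. (a k)\<^sup>2) + (\<Sum>k<n. (b k)\<^sup>2)"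
  proof -
    have "(norm2 x)\<^sup>2 = (\<Sum>j=1..n. (cmod (x $ (j - 1)))\<^sup>2)"
      using x by (simp add: norm2_sq entry_def)
    also have "\<dots> = (\<Sum>k<n. (cmod (x $ k))\<^sup>2)"
      by (rule sum.reindex_bij_witness[of _ Suc "\<lambda>j. j - 1"]) auto
    also have "\<dots> = (\<Sum>k<n. (a k)\<^sup>2 + (b k)\<^sup>2)"
      by (intro sum.cong) (auto simp: a_def b_def cmod_power2)
    finally show ?thesis by (simp add: sum.distrib)
  qed
  moreover have "(norm2 (?A *\<^sub>v x))\<^sup>2 = (len (rip_mat a) \<epsilon>)\<^sup>2 + (len (rip_mat b) \<epsilon>)\<^sup>2"
    unfolding a_def b_def by (rule norm2_partial_circulant_mat[OF x])
  ultimately show "(1 - \<delta>) * (norm2 x)\<^sup>2 \<le> (norm2 (?A *\<^sub>v x))\<^sup>2 \<and>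
      (norm2 (?A *\<^sub>v x))\<^sup>2 \<le> (1 + \<delta>) * (norm2 x)\<^sup>2"
    by (simp add: abs_le_iff algebra_simps)
qed

end

lemma rademacher_vector_eq_map_Pi_pmf:
  "rademacher_vector n = map_pmf (vec n) (Pi_pmf {..<n} 0 (\<lambda>_. pmf_of_set {-1, 1}))"
proof -
  have "Pi_pmf {..<n} (0::real) (\<lambda>_. pmf_of_set {-1, 1})
      = map_pmf (\<lambda>g. g \<circ> Suc) (Pi_pmf {1..n} 0 (\<lambda>_. pmf_of_set {-1, 1}))"
    by (rule Pi_pmf_bij_betw) (auto simp: bij_betw_def image_Suc_lessThan)
  then show ?thesis by (simp add: rademacher_vector_def map_pmf_comp o_def)
qed

theorem theorem1p1:
  shows "\<exists>c::real. c > 0 \<and>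
    (\<forall>(m::nat) (n::nat) (s::nat) (\<Omega>::nat set) (\<delta>::real).
       0 < m \<longrightarrow> m \<le> n \<longrightarrow> \<Omega> \<subseteq> {1..n} \<longrightarrow> card \<Omega> = m \<longrightarrow>
       0 < s \<longrightarrow> s \<le> n \<longrightarrow> 0 < \<delta> \<longrightarrow> \<delta> < 1 \<longrightarrow>
       real m \<ge> c * \<delta> powi (-2) * real s * (ln (real s))\<^sup>2 * (ln (real n))\<^sup>2 \<longrightarrow>
       measure_pmf.prob (rademacher_vector n)
         {\<epsilon>. restricted_isometry_constant
                (map_mat complex_of_real (partial_circulant_mat \<Omega> \<epsilon>)) s \<le> \<delta>}
       \<ge> 1 - real n powr (- (ln (real n) * (ln (real s))\<^sup>2)))"
proof (intro exI[of _ "10 ^ 12"] conjI allI impI)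
  show "(0::real) < 10 ^ 12" by simp
  fix m n s :: nat and \<Omega> :: "nat set" and \<delta> :: real
  assume m: "0 < m" "m \<le> n" and Om: "\<Omega> \<subseteq> {1..n}" "card \<Omega> = m"
    and s: "0 < s" "s \<le> n" and d: "0 < \<delta>" "\<delta> < 1"
    and large: "10 ^ 12 * \<delta> powi (-2) * real s * (ln (real s))\<^sup>2 * (ln (real n))\<^sup>2 \<le> real m"
  let ?A = "\<lambda>\<epsilon>. map_mat complex_of_real (partial_circulant_mat \<Omega> \<epsilon>)"
  let ?G = "{\<epsilon>. restricted_isometry_constant (?A \<epsilon>) s \<le> \<delta>}"
  show "measure_pmf.prob (rademacher_vector n) ?G \<ge> 1 - real n powr (- (ln (real n) * (ln (real s))\<^sup>2))"
  proof (cases "s = 1 \<or> n = 1")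
    case True
    \<comment> \<open>One of the logarithms vanishes, so the asserted probability is \<open>0\<close>.\<close>
    then have "real n powr (- (ln (real n) * (ln (real s))\<^sup>2)) = 1" using m by auto
    then show ?thesis by simp
  next
    case False
    then have n2: "2 \<le> n" and s2: "2 \<le> s" using s by auto
    interpret circulant_rows n m \<Omega> using m Om by unfold_locales auto
    have large': "10 ^ 12 * real s * (ln s)\<^sup>2 * (ln n)\<^sup>2 \<le> \<delta>\<^sup>2 * m"
    proof -
      have "\<delta>\<^sup>2 * \<delta> powi (-2) = 1" using d by (simp add: power_int_minus)
      then have "10 ^ 12 * real s * (ln s)\<^sup>2 * (ln n)\<^sup>2
          = (\<delta>\<^sup>2 * \<delta> powi (-2)) * (10 ^ 12 * real s * (ln s)\<^sup>2 * (ln n)\<^sup>2)" by simp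
      also have "\<dots> = \<delta>\<^sup>2 * (10 ^ 12 * \<delta> powi (-2) * real s * (ln s)\<^sup>2 * (ln n)\<^sup>2)"
        by (simp only: mult_ac)
      also have "\<dots> \<le> \<delta>\<^sup>2 * m" using large by (intro mult_left_mono) auto
      finally show ?thesis .
    qed
    let ?P = "Pi_pmf {..<n} (0::real) (\<lambda>_. pmf_of_set {-1, 1})"
    let ?viol = "\<lambda>\<epsilon>. \<exists>x \<in> sparse_grid n s (n ^ 4).
        \<bar>(len (rip_mat x) \<epsilon>)\<^sup>2 - (\<Sum>k<n. (x k)\<^sup>2)\<bar> > \<delta> / 4"
    have good: "vec n \<epsilon> \<in> ?G" if e: "\<epsilon> \<in> signs {..<n}" and v: "\<not> ?viol \<epsilon>" for \<epsilon>
    proof -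
      have "restricted_isometry_bound (?A (vec n \<epsilon>)) s \<delta>"
      proof (rule restricted_isometry_of_real, rule sparse_isometry_of_grid[OF e s(2) d(1)])
        show "16 \<le> \<delta> * n" by (rule delta_n_ge[OF n2 s2 s(2) d large'])
      qed (use v in \<open>auto simp: not_less\<close>)
      moreover have "dim_col (?A (vec n \<epsilon>)) > 0"
        using partial_circulant_mat_carrier[of \<epsilon>] n2 by simp
      ultimately show ?thesis using restricted_isometry_constant_least(2) s(1) by blast
    qed
    have "measure_pmf.prob ?P {\<epsilon>. vec n \<epsilon> \<notin> ?G} = sign_mean {..<n} (\<lambda>\<epsilon>. of_bool (vec n \<epsilon> \<notin> ?G))"
      by (rule sign_mean_of_bool_eq_prob[symmetric]) simp
    also have "\<dots> \<le> sign_mean {..<n} (\<lambda>\<epsilon>. of_bool (?viol \<epsilon>))"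
      using good by (intro sign_mean_mono) (auto simp: of_bool_def)
    also have "\<dots> \<le> exp (- (ln n * ln s)\<^sup>2)"
      by (rule sparse_grid_deviation_tail[OF n2 s2 s(2) d large'])
    also have "\<dots> = real n powr (- (ln (real n) * (ln (real s))\<^sup>2))"
      using n2 by (simp add: powr_def power2_eq_square mult_ac)
    finally have "measure_pmf.prob ?P {\<epsilon>. vec n \<epsilon> \<notin> ?G} \<le> real n powr (- (ln (real n) * (ln (real s))\<^sup>2))" .
    moreover have "measure_pmf.prob (rademacher_vector n) ?G = 1 - measure_pmf.prob ?P {\<epsilon>. vec n \<epsilon> \<notin> ?G}"
    proof -
      have "measure_pmf.prob (rademacher_vector n) ?G = measure_pmf.prob ?P (vec n -` ?G)"
        unfolding rademacher_vector_eq_map_Pi_pmf by (rule measure_map_pmf)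
      also have "\<dots> = 1 - measure_pmf.prob ?P (space (measure_pmf ?P) - vec n -` ?G)"
        by (subst measure_pmf.prob_compl) auto
      also have "space (measure_pmf ?P) - vec n -` ?G = {\<epsilon>. vec n \<epsilon> \<notin> ?G}" by auto
      finally show ?thesis .
    qed
    ultimately show ?thesis by linarith
  qed
qed

end
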